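(* Let $N\ge2$. Assume $g\in C(\mathbb{R})$ is nondecreasing, $g(0)\ge0$, satisfies the Keller–Osserman condition, and that $-\Delta u+g(u)=0$ in $\mathbb{R}^N$ possesses a subsolution $V$. Let $\mathcal U_V(\mathbb{R}^N)=\{h\in L^1_{loc}(\mathbb{R}^N):h\ge V\text{ a.e.}\}$. Then: (i) for every nonnegative $f\in L^1_{loc}(\mathbb{R}^N)$, the equation $-\Delta u+g(u)=f$ in $\mathbb{R}^N$ possesses a solution $u\in\mathcal U_V(\mathbb{R}^N)$; (ii) if in addition $g$ is convex and $-\Delta u+g(u)=0$ possesses a unique solution in $\mathcal U_V(\mathbb{R}^N)$, then for every nonnegative $f\in L^1_{loc}(\mathbb{R}^N)$ the equation $-\Delta u+g(u)=f$ possesses a unique solution in $\mathcal U_V(\mathbb{R}^N)$.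
   Context: Keller–Osserman condition: for every $a>0$, $\int_a^\infty\big(\int_0^t g(s)\,ds\big)^{-1/2}dt<\infty$. A solution (resp. subsolution) of $-\Delta u+g(u)=f$ in $\mathbb{R}^N$ is a $u\in L^1_{loc}(\mathbb{R}^N)$ with $g(u)\in L^1_{loc}(\mathbb{R}^N)$ and $-\Delta u+g(u)-f=0$ (resp. $\le0$) in the sense of distributions. *)

theory Defs
  imports "HOL-Analysis.Analysis"
begin

definition pd :: "'n::finite \<Rightarrow> (real^'n \<Rightarrow> real) \<Rightarrow> real^'n \<Rightarrow> real" where
  "pd i \<phi> = (\<lambda>x. deriv (\<lambda>t. \<phi> (x + t *\<^sub>R axis i 1)) 0)"

definition laplacian :: "(real^'n::finite \<Rightarrow> real) \<Rightarrow> real^'n \<Rightarrow> real" where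
  "laplacian \<phi> = (\<lambda>x. \<Sum>i\<in>UNIV. pd i (pd i \<phi>) x)"

definition smooth :: "(real^'n::finite \<Rightarrow> real) \<Rightarrow> bool" where
  "smooth \<phi> \<longleftrightarrow> (\<forall>\<alpha>::'n list. \<forall>x. foldr pd \<alpha> \<phi> differentiable (at x))"

definition test_fun :: "(real^'n::finite \<Rightarrow> real) \<Rightarrow> bool" where
  "test_fun \<phi> \<longleftrightarrow> smooth \<phi> \<and> bounded {x. \<phi> x \<noteq> 0}"

definition loc_int :: "(real^'n::finite \<Rightarrow> real) \<Rightarrow> bool" where
  "loc_int u \<longleftrightarrow> (\<forall>K. compact K \<longrightarrow> set_integrable lebesgue K u)"

definition is_solution :: "(real \<Rightarrow> real) \<Rightarrow> (real^'n::finite \<Rightarrow> real) \<Rightarrow> (real^'n \<Rightarrow> real) \<Rightarrow> bool" where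
  "is_solution g f u \<longleftrightarrow> loc_int u \<and> loc_int (\<lambda>x. g (u x)) \<and>
     (\<forall>\<phi>. test_fun \<phi> \<longrightarrow>
        integral\<^sup>L lebesgue (\<lambda>x. - u x * laplacian \<phi> x + g (u x) * \<phi> x - f x * \<phi> x) = 0)"

definition is_subsolution :: "(real \<Rightarrow> real) \<Rightarrow> (real^'n::finite \<Rightarrow> real) \<Rightarrow> (real^'n \<Rightarrow> real) \<Rightarrow> bool" where
  "is_subsolution g f u \<longleftrightarrow> loc_int u \<and> loc_int (\<lambda>x. g (u x)) \<and>
     (\<forall>\<phi>. test_fun \<phi> \<longrightarrow> (\<forall>x. \<phi> x \<ge> 0) \<longrightarrow>
        integral\<^sup>L lebesgue (\<lambda>x. - u x * laplacian \<phi> x + g (u x) * \<phi> x - f x * \<phi> x) \<le> 0)"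

definition keller_osserman :: "(real \<Rightarrow> real) \<Rightarrow> bool" where
  "keller_osserman g \<longleftrightarrow> (\<forall>a>0.
     (\<integral>\<^sup>+ t. indicator {a..} t * inverse (ennreal (sqrt (integral {0..t} g))) \<partial>lborel) < \<infinity>)"

definition UV :: "(real^'n::finite \<Rightarrow> real) \<Rightarrow> (real^'n \<Rightarrow> real) set" where
  "UV V = {h. loc_int h \<and> (AE x in lebesgue. V x \<le> h x)}"

end

theory Submission
  imports Defs
begin

text \<open>
  Let \<open>m\<close> be a suitable radial probability measure on the unit ball. There is a companion measure \<open>k\<close> such
  that \<open>m\<^sub>\<epsilon> * \<phi> - \<phi> = \<epsilon>\<^sup>2 k\<^sub>\<epsilon> * \<Delta> \<phi>\<close> for test functions, so that a distributional inequality \<open>- \<Delta> z \<le> h\<close>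
  is equivalent to the pointwise mean value inequalities \<open>z \<le> m\<^sub>\<epsilon> * z + \<epsilon>\<^sup>2 k\<^sub>\<epsilon> * h\<close>. Everything is deduced from these.
  Kato's inequality follows by taking the maximum at the centre and letting \<open>\<epsilon>\<close> tend to zero.

  Keller--Osserman: by comparison with a paraboloid, if \<open>u \<le> 2 t\<close> in a ball of radius \<open>\<rho> + r\<close> with
  \<open>r\<^sup>2 = 12 N t / g (t / 2)\<close>, then \<open>u \<le> t\<close> in the concentric ball of radius \<open>\<rho>\<close>. The radii for \<open>t, 2 t, 4 t, \<dots>\<close> are summable,
  which bounds subsolutions locally from above; for \<open>f = 0\<close> there is room in the whole space and every subsolution is \<open>\<le> 0\<close>.

  Existence: if \<open>k \<le> m / 8\<close> and \<open>g\<close> is Lipschitz, then \<open>u \<mapsto> m\<^sub>\<epsilon> * u + \<epsilon>\<^sup>2 k\<^sub>\<epsilon> * (f - g(u))\<close> is monotone for small \<open>\<epsilon>\<close>, and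
  its iterates from \<open>V\<close> increase to the minimal solution between \<open>V\<close> and a supersolution. One then approximates \<open>g\<close> from
  below by Lipschitz functions and \<open>f\<close> by bounded functions, for which large constants are supersolutions.

  Uniqueness: given two solutions \<open>u\<^sub>1, u\<^sub>2\<close> for \<open>f\<close>, the unique solution \<open>v\<close> for \<open>f = 0\<close> lies below \<open>u\<^sub>1\<close>, and by convexity
  \<open>v + (u\<^sub>2 - u\<^sub>1)\<^sup>+\<close> is a subsolution for \<open>f = 0\<close>. The solution above it must be \<open>v\<close>, hence \<open>u\<^sub>2 \<le> u\<^sub>1\<close>.
\<close>

section \<open>Smooth functions and test functions\<close>

text \<open>Solutions are merely locally integrable, and so is \<open>g (u x)\<close>; no regularity
  of \<open>u\<close> is available for a classical comparison. The mean value form contains only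
  integrals of \<open>z\<close> and \<open>h\<close>, hence survives dominated a.e. limits and
  changes of representative. Two pairs of kernels occur for a reason. The kernel \<open>k\<close>
  that inverts the Laplacian carries the singularity of the fundamental solution at the origin, so
  for N \<ge> 2 no \<open>m\<close> of bounded density can dominate it; bounded density is what
  converts an L1 bound into a pointwise one, domination is what makes the fixed point map monotone.
  In the existence part the scale is fixed by the Lipschitz constant and never tends to 0. A fixed
  point therefore satisfies the equation only against averaged test functions. The rest follows by
  positivity: the defect is already known to be a nonnegative functional, and it vanishes on
  functions majorizing every given test function. Choosing minimal solutions makes the
  approximations monotone in the Lipschitz parameter and in the truncation of \<open>f\<close>, so
  that limits exist without any compactness argument.\<close>

lemma smooth_pd: "smooth \<phi> \<Longrightarrow> smooth (pd i \<phi>)"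
  unfolding smooth_def
proof (intro allI)
  fix \<alpha> x assume *: "\<forall>\<alpha> x. foldr pd \<alpha> \<phi> differentiable (at x)"
  show "foldr pd \<alpha> (pd i \<phi>) differentiable (at x)"
    \<comment> \<open>\<open>foldr\<close> applies the last entry of the list first, hence the
      appended \<open>i\<close>.\<close>
    using *[rule_format, of "\<alpha> @ [i]" x] by simp
qed

lemma smooth_imp_differentiable: "smooth \<phi> \<Longrightarrow> \<phi> differentiable (at x)"
  unfolding smooth_def by (metis foldr.simps(1) id_apply)

lemma pd_eqI: "((\<lambda>t. f (x + t *\<^sub>R axis i 1)) has_real_derivative d) (at 0) \<Longrightarrow> pd i f x = d"
  unfolding pd_def by (rule DERIV_imp_deriv)

lemma has_derivative_pd:
  fixes \<phi> :: "real^'n::finite \<Rightarrow> real"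
  assumes "\<phi> differentiable (at x)"
  shows "(\<phi> has_derivative (\<lambda>h. \<Sum>i\<in>UNIV. h $ i * pd i \<phi> x)) (at x)"
proof -
  obtain D where D: "(\<phi> has_derivative D) (at x)" using assms by (auto simp: differentiable_def)
  interpret D: bounded_linear D using D by (rule has_derivative_bounded_linear)
  have pd: "pd i \<phi> x = D (axis i 1)" for i
  proof (rule pd_eqI)
    have "((\<lambda>t. \<phi> (x + t *\<^sub>R axis i 1)) has_derivative (\<lambda>t. D (t *\<^sub>R axis i 1))) (at 0)"
      by (rule has_derivative_compose[where g = \<phi>]) (use D in \<open>auto intro!: derivative_eq_intros\<close>)
    then show "((\<lambda>t. \<phi> (x + t *\<^sub>R axis i 1)) has_real_derivative D (axis i 1)) (at 0)"
      by (rule has_derivative_imp_has_field_derivative) (simp add: D.scaleR mult.commute)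
  qed
  have "D = (\<lambda>h. \<Sum>i\<in>UNIV. h $ i * pd i \<phi> x)"
  proof
    fix h :: "real^'n"
    have "D h = D (\<Sum>i\<in>UNIV. h $ i *\<^sub>R axis i 1)" by (simp add: basis_expansion scalar_mult_eq_scaleR[symmetric])
    then show "D h = (\<Sum>i\<in>UNIV. h $ i * pd i \<phi> x)" by (simp add: D.sum D.scaleR pd)
  qed
  with D show ?thesis by simp
qed

lemma has_real_derivative_pd_line:
  fixes \<phi> :: "real^'n::finite \<Rightarrow> real"
  assumes "\<phi> differentiable (at (x + t *\<^sub>R v))"
  shows "((\<lambda>t. \<phi> (x + t *\<^sub>R v)) has_real_derivative (\<Sum>i\<in>UNIV. v $ i * pd i \<phi> (x + t *\<^sub>R v))) (at t)"
proof -
  have "((\<lambda>t. \<phi> (x + t *\<^sub>R v)) has_derivative (\<lambda>s. \<Sum>i\<in>UNIV. (s *\<^sub>R v) $ i * pd i \<phi> (x + t *\<^sub>R v))) (at t)"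
    by (rule has_derivative_compose[where g = \<phi>])
      (use has_derivative_pd[OF assms] in \<open>auto intro!: derivative_eq_intros\<close>)
  then show ?thesis
    by (rule has_derivative_imp_has_field_derivative) (simp add: sum_distrib_left mult_ac)
qed

lemma has_real_derivative_pd_axis:
  fixes \<phi> :: "real^'n::finite \<Rightarrow> real"
  assumes "\<phi> differentiable (at (x + t *\<^sub>R axis i 1))"
  shows "((\<lambda>t. \<phi> (x + t *\<^sub>R axis i 1)) has_real_derivative pd i \<phi> (x + t *\<^sub>R axis i 1)) (at t)"
  using has_real_derivative_pd_line[OF assms] by (simp add: axis_def if_distrib if_distribR cong: if_cong)

lemma pd_add:
  assumes "f differentiable (at x)" "g differentiable (at x)"
  shows "pd i (\<lambda>x. f x + g x) x = pd i f x + pd i g x"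
  by (rule pd_eqI) (use assms has_real_derivative_pd_axis[of f x 0 i] has_real_derivative_pd_axis[of g x 0 i]
      in \<open>auto intro!: derivative_eq_intros\<close>)

lemma pd_mult:
  assumes "f differentiable (at x)" "g differentiable (at x)"
  shows "pd i (\<lambda>x. f x * g x) x = pd i f x * g x + f x * pd i g x"
  by (rule pd_eqI) (use assms has_real_derivative_pd_axis[of f x 0 i] has_real_derivative_pd_axis[of g x 0 i]
      in \<open>auto intro!: derivative_eq_intros\<close>)

lemma pd_const [simp]: "pd i (\<lambda>x. c) = (\<lambda>x. 0)"
  by (rule ext, rule pd_eqI) auto

lemma pd_lincomb:
  assumes "f differentiable (at x)" "g differentiable (at x)"
  shows "pd i (\<lambda>x. a * f x + b * g x) x = a * pd i f x + b * pd i g x"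
  by (rule pd_eqI) (use assms has_real_derivative_pd_axis[of f x 0 i] has_real_derivative_pd_axis[of g x 0 i]
      in \<open>auto intro!: derivative_eq_intros\<close>)

lemma foldr_pd_lincomb:
  assumes "smooth f" "smooth g"
  shows "foldr pd \<alpha> (\<lambda>x. a * f x + b * g x) = (\<lambda>x. a * foldr pd \<alpha> f x + b * foldr pd \<alpha> g x)"
proof (induction \<alpha>)
  case (Cons i \<alpha>)
  have "pd i (\<lambda>x. a * foldr pd \<alpha> f x + b * foldr pd \<alpha> g x) x
      = a * pd i (foldr pd \<alpha> f) x + b * pd i (foldr pd \<alpha> g) x" for x
    by (rule pd_lincomb) (use assms in \<open>auto simp: smooth_def\<close>)
  then show ?case using Cons by auto
qed auto

lemma smooth_lincomb: "smooth f \<Longrightarrow> smooth g \<Longrightarrow> smooth (\<lambda>x. a * f x + b * g x)"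
  unfolding smooth_def[of "\<lambda>x. a * f x + b * g x"]
proof (intro allI)
  fix \<alpha> x assume "smooth f" "smooth g"
  then show "foldr pd \<alpha> (\<lambda>x. a * f x + b * g x) differentiable (at x)"
    unfolding foldr_pd_lincomb[OF \<open>smooth f\<close> \<open>smooth g\<close>]
    by (intro differentiable_add differentiable_mult differentiable_const) (auto simp: smooth_def)
qed

lemma test_fun_lincomb:
  assumes "test_fun f" "test_fun g" shows "test_fun (\<lambda>x. a * f x + b * g x)"
proof -
  have "{x. a * f x + b * g x \<noteq> 0} \<subseteq> {x. f x \<noteq> 0} \<union> {x. g x \<noteq> 0}" by auto
  then show ?thesis
    using assms smooth_lincomb[of f g a b] unfolding test_fun_def
    by (meson bounded_Un bounded_subset)
qed

lemma pd_affine: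
  assumes "f differentiable (at (c *\<^sub>R x + d))"
  shows "pd i (\<lambda>x. K * f (c *\<^sub>R x + d)) x = K * c * pd i f (c *\<^sub>R x + d)"
proof (rule pd_eqI)
  have "((\<lambda>t. f ((c *\<^sub>R x + d) + t *\<^sub>R axis i 1)) has_real_derivative pd i f (c *\<^sub>R x + d)) (at (c * 0))"
    using has_real_derivative_pd_axis[of f "c *\<^sub>R x + d" 0 i] assms by simp
  from DERIV_chain'[OF DERIV_cmult[OF DERIV_ident] this]
  have "((\<lambda>t. f ((c *\<^sub>R x + d) + (c * t) *\<^sub>R axis i 1)) has_real_derivative c * pd i f (c *\<^sub>R x + d)) (at 0)"
    by (simp add: mult.commute)
  from DERIV_cmult[OF this, of K]
  show "((\<lambda>t. K * f (c *\<^sub>R (x + t *\<^sub>R axis i 1) + d)) has_real_derivative K * c * pd i f (c *\<^sub>R x + d)) (at 0)"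
    by (simp add: algebra_simps)
qed

lemma foldr_pd_affine:
  assumes "smooth f"
  shows "foldr pd \<alpha> (\<lambda>x. f (c *\<^sub>R x + d)) = (\<lambda>x. c ^ length \<alpha> * foldr pd \<alpha> f (c *\<^sub>R x + d))"
proof (induction \<alpha>)
  case (Cons i \<alpha>)
  have "pd i (\<lambda>x. c ^ length \<alpha> * foldr pd \<alpha> f (c *\<^sub>R x + d)) x
      = c ^ length \<alpha> * c * pd i (foldr pd \<alpha> f) (c *\<^sub>R x + d)" for x
    by (rule pd_affine) (use assms in \<open>auto simp: smooth_def\<close>)
  then show ?case using Cons by (auto simp: mult_ac)
qed auto

lemma smooth_affine: "smooth f \<Longrightarrow> smooth (\<lambda>x. f (c *\<^sub>R x + d))"
  unfolding smooth_def[of "\<lambda>x. f (c *\<^sub>R x + d)"]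
proof (intro allI)
  fix \<alpha> x assume f: "smooth f"
  have "(\<lambda>x. foldr pd \<alpha> f (c *\<^sub>R x + d)) differentiable (at x)"
    using f by (intro differentiable_compose[where f = "foldr pd \<alpha> f" and g = "\<lambda>x. c *\<^sub>R x + d"]
        differentiable_add differentiable_const differentiable_scaleR differentiable_ident) (auto simp: smooth_def)
  then show "foldr pd \<alpha> (\<lambda>x. f (c *\<^sub>R x + d)) differentiable (at x)"
    using f by (simp add: foldr_pd_affine)
qed

lemma test_fun_affine:
  assumes f: "test_fun f" and c: "c \<noteq> 0" shows "test_fun (\<lambda>x. f (c *\<^sub>R x + d))"
proof -
  have "{x. f (c *\<^sub>R x + d) \<noteq> 0} \<subseteq> (\<lambda>y. (1 / c) *\<^sub>R (y - d)) ` {x. f x \<noteq> 0}"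
  proof
    fix x assume "x \<in> {x. f (c *\<^sub>R x + d) \<noteq> 0}"
    moreover have "x = (1 / c) *\<^sub>R ((c *\<^sub>R x + d) - d)" using c by simp
    ultimately show "x \<in> (\<lambda>y. (1 / c) *\<^sub>R (y - d)) ` {x. f x \<noteq> 0}" by blast
  qed
  moreover have "bounded ((\<lambda>y. (1 / c) *\<^sub>R (y - d)) ` {x. f x \<noteq> 0})"
  proof -
    have "bounded ((\<lambda>x. -d + x) ` {x. f x \<noteq> 0})" using f by (intro bounded_translation) (auto simp: test_fun_def)
    from bounded_scaling[OF this, of "1/c"] show ?thesis by (simp add: image_image)
  qed
  ultimately show ?thesis using f smooth_affine[of f c d] unfolding test_fun_def by (meson bounded_subset)
qed

lemma test_fun_vanish:
  assumes "test_fun \<phi>" obtains R where "R > 0" "\<And>x. norm x > R \<Longrightarrow> \<phi> x = 0"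
  using assms unfolding test_fun_def bounded_pos by (metis (mono_tags) mem_Collect_eq not_le)

lemma pd_vanish:
  fixes \<phi> :: "real^'n::finite \<Rightarrow> real"
  assumes "\<And>x. norm x > R \<Longrightarrow> \<phi> x = 0" "norm x > R"
  shows "pd i \<phi> x = 0"
proof (rule pd_eqI)
  have "open {t::real. norm (x + t *\<^sub>R axis i 1) > R}"
    by (intro open_Collect_less continuous_intros)
  moreover have "0 \<in> {t::real. norm (x + t *\<^sub>R axis i 1) > R}" using assms by simp
  ultimately have "\<forall>\<^sub>F t in nhds 0. \<phi> (x + t *\<^sub>R axis i 1) = 0"
    using assms(1) by (auto simp: eventually_nhds)
  moreover have "((\<lambda>t. 0::real) has_real_derivative 0) (at 0)" by simp
  ultimately show "((\<lambda>t. \<phi> (x + t *\<^sub>R axis i 1)) has_real_derivative 0) (at 0)"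
    using DERIV_cong_ev[of 0 0 "\<lambda>t. \<phi> (x + t *\<^sub>R axis i 1)" "\<lambda>t. 0"] by auto
qed

lemma test_fun_pd: assumes "test_fun \<phi>" shows "test_fun (pd i \<phi>)"
proof -
  obtain R where R: "\<And>x. norm x > R \<Longrightarrow> \<phi> x = 0" using test_fun_vanish[OF assms] by blast
  have "norm x \<le> R" if "pd i \<phi> x \<noteq> 0" for x
    using pd_vanish[of R \<phi> x i] R that by (meson not_le)
  then have "bounded {x. pd i \<phi> x \<noteq> 0}" by (auto simp: bounded_iff)
  moreover have "smooth (pd i \<phi>)" using assms by (simp add: test_fun_def smooth_pd)
  ultimately show ?thesis by (simp add: test_fun_def)
qed

lemma test_fun_zero [simp]: "test_fun (\<lambda>x. 0)"
proof -
  have "foldr pd \<alpha> (\<lambda>x::real^'a. 0::real) = (\<lambda>x. 0)" for \<alpha> by (induction \<alpha>) auto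
  then show ?thesis by (simp add: test_fun_def smooth_def)
qed

lemma test_fun_add: "test_fun f \<Longrightarrow> test_fun g \<Longrightarrow> test_fun (\<lambda>x. f x + g x)"
  using test_fun_lincomb[of f g 1 1] by simp

lemma test_fun_laplacian: assumes "test_fun \<phi>" shows "test_fun (laplacian \<phi>)"
proof -
  have "test_fun (\<lambda>x. \<Sum>i\<in>A. pd i (pd i \<phi>) x)" if "finite A" for A
    using that by (induction A) (auto intro!: test_fun_add test_fun_pd assms)
  from this[of UNIV] show ?thesis unfolding laplacian_def by simp
qed

lemma laplacian_lincomb:
  assumes "smooth f" "smooth g"
  shows "laplacian (\<lambda>x. a * f x + b * g x) x = a * laplacian f x + b * laplacian g x"
proof -
  have 1: "pd i (\<lambda>x. a * f x + b * g x) = (\<lambda>x. a * pd i f x + b * pd i g x)" for i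
    using assms by (intro ext pd_lincomb smooth_imp_differentiable)
  have 2: "pd i (\<lambda>x. a * pd i f x + b * pd i g x) x = a * pd i (pd i f) x + b * pd i (pd i g) x" for i
    using assms by (intro pd_lincomb smooth_imp_differentiable smooth_pd)
  show ?thesis unfolding laplacian_def 1 2 by (simp add: sum.distrib sum_distrib_left)
qed

lemma continuous_test_fun: "test_fun \<phi> \<Longrightarrow> continuous_on A \<phi>"
  unfolding test_fun_def
  by (meson continuous_at_imp_continuous_on differentiable_imp_continuous_within smooth_imp_differentiable)

lemma test_fun_bounded:
  assumes "test_fun \<phi>" obtains B where "B > 0" "\<And>x. \<bar>\<phi> x\<bar> \<le> B"
proof -
  obtain R where R: "\<And>x. norm x > R \<Longrightarrow> \<phi> x = 0" using test_fun_vanish[OF assms] by blast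
  have "compact (\<phi> ` cball 0 R)" by (intro compact_continuous_image continuous_test_fun assms compact_cball)
  then obtain B where B: "B > 0" "\<And>x. x \<in> cball 0 R \<Longrightarrow> norm (\<phi> x) \<le> B"
    by (metis bounded_pos compact_imp_bounded imageI)
  have "\<bar>\<phi> x\<bar> \<le> B" for x using B R[of x] by (cases "norm x > R") (auto simp: not_less)
  with B show ?thesis using that by blast
qed

lemma test_fun_lipschitz:
  fixes \<phi> :: "real^'n::finite \<Rightarrow> real"
  assumes "test_fun \<phi>" obtains L where "L > 0" "\<And>x y. \<bar>\<phi> x - \<phi> y\<bar> \<le> L * norm (x - y)"
proof -
  have "\<exists>B>0. \<forall>x. \<bar>pd i \<phi> x\<bar> \<le> B" for i using test_fun_bounded[OF test_fun_pd[OF assms]] by metis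
  then obtain B where B: "\<And>i. B i > 0" "\<And>i x. \<bar>pd i \<phi> x\<bar> \<le> B i" by metis
  define L where "L = (\<Sum>i\<in>UNIV. B i)"
  have "norm (\<phi> x - \<phi> y) \<le> L * norm (x - y)" for x y
  proof (rule differentiable_bound[of UNIV \<phi> "\<lambda>x h. \<Sum>i\<in>UNIV. h $ i * pd i \<phi> x"])
    fix x :: "real^'n"
    show "(\<phi> has_derivative (\<lambda>h. \<Sum>i\<in>UNIV. h $ i * pd i \<phi> x)) (at x within UNIV)"
      using has_derivative_pd[of \<phi> x] assms by (auto simp: test_fun_def smooth_imp_differentiable)
    show "onorm (\<lambda>h. \<Sum>i\<in>UNIV. h $ i * pd i \<phi> x) \<le> L"
    proof (rule onorm_bound)
      show "0 \<le> L" unfolding L_def using B by (intro sum_nonneg) (auto intro: less_imp_le)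
      fix h :: "real^'n"
      have "norm (\<Sum>i\<in>UNIV. h $ i * pd i \<phi> x) \<le> (\<Sum>i\<in>UNIV. \<bar>h $ i * pd i \<phi> x\<bar>)" by (simp add: sum_abs)
      also have "\<dots> \<le> (\<Sum>i\<in>UNIV. norm h * B i)"
        unfolding abs_mult by (intro sum_mono mult_mono component_le_norm_cart B) auto
      finally show "norm (\<Sum>i\<in>UNIV. h $ i * pd i \<phi> x) \<le> L * norm h"
        by (simp add: L_def sum_distrib_left mult.commute)
    qed
  qed auto
  moreover have "L > 0" unfolding L_def by (intro sum_pos) (auto simp: B)
  ultimately show ?thesis using that by simp
qed

text \<open>The remainder is uniform in \<open>x\<close>, so it can be integrated against a finite
  measure. This is how derivatives, in space and in the scale, pass through averages.\<close>

lemma test_fun_taylor: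
  fixes \<phi> :: "real^'n::finite \<Rightarrow> real"
  assumes "test_fun \<phi>"
  obtains C where "C > 0" "\<And>x h. \<bar>\<phi> (x + h) - \<phi> x - (\<Sum>i\<in>UNIV. h $ i * pd i \<phi> x)\<bar> \<le> C * (norm h)\<^sup>2"
proof -
  have "\<exists>B>0. \<forall>x y. \<bar>pd i \<phi> x - pd i \<phi> y\<bar> \<le> B * norm (x - y)" for i
    using test_fun_lipschitz[OF test_fun_pd[OF assms]] by metis
  then obtain B where B: "\<And>i. B i > 0" "\<And>i x y. \<bar>pd i \<phi> x - pd i \<phi> y\<bar> \<le> B i * norm (x - y)" by metis
  define L where "L = (\<Sum>i\<in>UNIV. B i)"
  have Lpos: "L > 0" unfolding L_def by (intro sum_pos) (auto simp: B)
  have "\<bar>\<phi> (x + h) - \<phi> x - (\<Sum>i\<in>UNIV. h $ i * pd i \<phi> x)\<bar> \<le> L * (norm h)\<^sup>2" for x h :: "real^'n"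
  proof -
    have "norm (\<phi> (x + h) - \<phi> x - (\<Sum>i\<in>UNIV. ((x + h) - x) $ i * pd i \<phi> x)) \<le> norm ((x + h) - x) * (L * norm h)"
    proof (rule differentiable_bound_linearization[where S = "cball x (norm h)" and f' = "\<lambda>x h. \<Sum>i\<in>UNIV. h $ i * pd i \<phi> x"])
      fix t :: real assume "t \<in> {0..1}"
      then show "x + t *\<^sub>R (x + h - x) \<in> cball x (norm h)" by (auto simp: dist_norm mult_left_le_one_le)
    next
      fix y assume y: "y \<in> cball x (norm h)"
      show "(\<phi> has_derivative (\<lambda>h. \<Sum>i\<in>UNIV. h $ i * pd i \<phi> y)) (at y within cball x (norm h))"
        using has_derivative_pd[of \<phi> y] assms
        by (auto simp: test_fun_def smooth_imp_differentiable intro: has_derivative_at_withinI)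
      show "onorm ((\<lambda>h. \<Sum>i\<in>UNIV. h $ i * pd i \<phi> y) - (\<lambda>h. \<Sum>i\<in>UNIV. h $ i * pd i \<phi> x)) \<le> L * norm h"
      proof (rule onorm_bound)
        show "0 \<le> L * norm h" using Lpos by simp
        fix k :: "real^'n"
        have yx: "norm (y - x) \<le> norm h" using y by (simp add: dist_norm norm_minus_commute)
        have "norm (((\<lambda>h. \<Sum>i\<in>UNIV. h $ i * pd i \<phi> y) - (\<lambda>h. \<Sum>i\<in>UNIV. h $ i * pd i \<phi> x)) k)
            = \<bar>\<Sum>i\<in>UNIV. k $ i * (pd i \<phi> y - pd i \<phi> x)\<bar>"
          by (simp add: sum_subtractf algebra_simps)
        also have "\<dots> \<le> (\<Sum>i\<in>UNIV. \<bar>k $ i * (pd i \<phi> y - pd i \<phi> x)\<bar>)" by (rule sum_abs)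
        also have "\<dots> \<le> (\<Sum>i\<in>UNIV. norm k * (B i * norm h))"
          unfolding abs_mult
          by (intro sum_mono mult_mono component_le_norm_cart order_trans[OF B(2)] mult_left_mono yx)
            (auto simp: less_imp_le B(1))
        finally show "norm (((\<lambda>h. \<Sum>i\<in>UNIV. h $ i * pd i \<phi> y) - (\<lambda>h. \<Sum>i\<in>UNIV. h $ i * pd i \<phi> x)) k) \<le> L * norm h * norm k"
          by (simp add: L_def sum_distrib_left sum_distrib_right mult_ac)
      qed
    qed auto
    then show ?thesis by (simp add: power2_eq_square mult_ac)
  qed
  with Lpos show ?thesis using that by blast
qed

subsection \<open>Bump functions\<close>

text \<open>Powers of 1/t are included because differentiating exp(-1/t) creates them: the span of
  this family is closed under differentiation.\<close>

definition flat :: "nat \<Rightarrow> real \<Rightarrow> real" where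
  "flat n t = (if t > 0 then (1 / t) ^ n * exp (- (1 / t)) else 0)"

lemma flat_has_derivative:
  "(flat n has_real_derivative flat (n + 2) t - n * flat (n + 1) t) (at t)"
proof -
  consider "t > 0" | "t < 0" | "t = 0" by linarith
  then show ?thesis
  proof cases
    case 1
    have "((\<lambda>t. (1 / t) ^ n * exp (- (1 / t))) has_real_derivative flat (n + 2) t - n * flat (n + 1) t) (at t)"
    proof -
      have "((\<lambda>t. 1 / t) has_real_derivative - (1 / t) * (1 / t)) (at t)"
        using 1 by (auto intro!: derivative_eq_intros)
      note d = this DERIV_power[OF this, of n]
      have D: "((\<lambda>t. (1 / t) ^ n * exp (- (1 / t))) has_real_derivative
          real n * (- (1 / t) * (1 / t) * (1 / t) ^ (n - Suc 0)) * exp (- (1 / t))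
          + (exp (- (1 / t)) * - (- (1 / t) * (1 / t))) * (1 / t) ^ n) (at t)"
        by (rule DERIV_mult[OF d(2)]) (intro DERIV_fun_exp DERIV_minus d)
      have "real n * (- (1 / t) * (1 / t) * (1 / t) ^ (n - Suc 0)) = - n * (1 / t) ^ (n + 1)"
        using 1 by (cases n) (auto simp: field_simps)
      then have "real n * (- (1 / t) * (1 / t) * (1 / t) ^ (n - Suc 0)) * exp (- (1 / t))
          + (exp (- (1 / t)) * - (- (1 / t) * (1 / t))) * (1 / t) ^ n = flat (n + 2) t - n * flat (n + 1) t"
        using 1 by (simp add: flat_def algebra_simps)
      with D show ?thesis by (simp only:)
    qed
    moreover have "\<forall>\<^sub>F s in nhds t. flat n s = (1 / s) ^ n * exp (- (1 / s))"
      using 1 by (auto simp: eventually_nhds flat_def intro!: exI[of _ "{0<..}"])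
    ultimately show ?thesis using DERIV_cong_ev[of t t "flat n" "\<lambda>t. (1 / t) ^ n * exp (- (1 / t))"] by blast
  next
    case 2
    have "\<forall>\<^sub>F s in nhds t. flat n s = 0"
      using 2 by (auto simp: eventually_nhds flat_def intro!: exI[of _ "{..<0}"])
    moreover have "((\<lambda>t. 0) has_real_derivative flat (n + 2) t - n * flat (n + 1) t) (at t)"
      using 2 by (auto simp: flat_def)
    ultimately show ?thesis using DERIV_cong_ev[of t t "flat n" "\<lambda>_. 0"] by blast
  next
    case 3
    \<comment> \<open>The substitution x = 1/h reduces this to the decay of x^(n+1) / exp x; the
      extra power comes from the division by \<open>h\<close> in the difference quotient.\<close>
    have lim: "((\<lambda>h. (1 / h) ^ (n+1) * exp (- (1 / h))) \<longlongrightarrow> 0) (at_right (0::real))"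
    proof -
      have "((\<lambda>x::real. x ^ (n+1) / exp x) \<longlongrightarrow> 0) at_top" by (rule tendsto_power_div_exp_0)
      then have "((\<lambda>h. inverse h ^ (n+1) / exp (inverse h)) \<longlongrightarrow> 0) (at_right (0::real))"
        using filterlim_compose filterlim_inverse_at_top_right by blast
      then show ?thesis by (simp add: exp_minus field_simps)
    qed
    have r: "((\<lambda>h. flat n h / h) \<longlongrightarrow> 0) (at_right 0)"
      by (rule Lim_transform_eventually[OF lim])
        (auto simp: eventually_at_filter flat_def field_simps)
    have l: "((\<lambda>h. flat n h / h) \<longlongrightarrow> 0) (at_left 0)"
      by (rule Lim_transform_eventually[OF tendsto_const])
        (auto simp: eventually_at_filter flat_def)
    have "((\<lambda>h. flat n h / h) \<longlongrightarrow> 0) (at 0)"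
      using l r by (rule filterlim_split_at)
    then show ?thesis using 3 by (simp add: DERIV_def flat_def)
  qed
qed

text \<open>A class of functions closed under partial derivatives, so that its members are smooth.\<close>
inductive flat_alg :: "(real^'n::finite \<Rightarrow> real) \<Rightarrow> bool" where
  flat: "flat_alg (\<lambda>x. flat n (\<sigma> * x $ i + 1))"
| const: "flat_alg (\<lambda>x. c)"
| add: "flat_alg f \<Longrightarrow> flat_alg g \<Longrightarrow> flat_alg (\<lambda>x. f x + g x)"
| mult: "flat_alg f \<Longrightarrow> flat_alg g \<Longrightarrow> flat_alg (\<lambda>x. f x * g x)"

lemma flat_alg_pd:
  fixes f :: "real^'n::finite \<Rightarrow> real"
  assumes "flat_alg f"
  shows "(\<forall>x. f differentiable (at x)) \<and> (\<forall>i. flat_alg (pd i f))"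
  using assms
proof induction
  case (flat n \<sigma> j)
  have d: "((\<lambda>t. flat n (\<sigma> * (x + t *\<^sub>R axis i 1) $ j + 1)) has_real_derivative
     (flat (n + 2) (\<sigma> * x $ j + 1) + (- n) * flat (n + 1) (\<sigma> * x $ j + 1)) * (\<sigma> * axis i 1 $ j)) (at 0)" for x :: "real^'n" and i
  proof -
    have "((\<lambda>t. \<sigma> * (x + t *\<^sub>R axis i 1) $ j + 1) has_real_derivative (\<sigma> * axis i 1 $ j)) (at 0)"
      by (auto intro!: derivative_eq_intros simp: algebra_simps)
    from DERIV_chain2[OF _ this, of "flat n"] flat_has_derivative[of n "\<sigma> * x $ j + 1"]
    show ?thesis by simp
  qed
  have pd: "pd i (\<lambda>x. flat n (\<sigma> * x $ j + 1)) = (\<lambda>x. (flat (n + 2) (\<sigma> * x $ j + 1) + (- n) * flat (n + 1) (\<sigma> * x $ j + 1)) * (\<sigma> * axis i 1 $ j))" for i :: 'n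
    by (intro ext pd_eqI d)
  have "(\<lambda>x::real^'n. flat n (\<sigma> * x $ j + 1)) differentiable (at x)" for x
  proof -
    have "flat n differentiable (at (\<sigma> * x $ j + 1))"
      using flat_has_derivative[of n "\<sigma> * x $ j + 1"] unfolding has_field_derivative_def differentiable_def by blast
    moreover have "(\<lambda>x::real^'n. \<sigma> * x $ j + 1) differentiable (at x)"
      unfolding differentiable_def by (auto intro!: derivative_eq_intros bounded_linear.has_derivative[OF bounded_linear_vec_nth] exI)
    ultimately show ?thesis by (rule differentiable_compose)
  qed
  moreover have "flat_alg (pd i (\<lambda>x. flat n (\<sigma> * x $ j + 1)))" for i :: 'n
    unfolding pd by (intro flat_alg.intros)
  ultimately show ?case by blast
next
  case (const c) then show ?case by (auto intro: flat_alg.intros)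
next
  case (add f g)
  have "pd i (\<lambda>x. f x + g x) = (\<lambda>x. pd i f x + pd i g x)" for i using add by (intro ext pd_add) auto
  with add show ?case by (auto intro: flat_alg.intros)
next
  case (mult f g)
  have "pd i (\<lambda>x. f x * g x) = (\<lambda>x. pd i f x * g x + f x * pd i g x)" for i using mult by (intro ext pd_mult) auto
  with mult show ?case by (auto intro!: flat_alg.add flat_alg.mult)
qed

lemma flat_alg_smooth: "flat_alg f \<Longrightarrow> smooth f"
proof -
  assume f: "flat_alg f"
  have "flat_alg (foldr pd \<alpha> f)" for \<alpha> by (induction \<alpha>) (auto simp: f flat_alg_pd)
  then show ?thesis by (auto simp: smooth_def flat_alg_pd)
qed

text \<open>A product over coordinates rather than a function of the norm: each factor is
  \<open>flat 0\<close> of an affine function of one coordinate, a generator of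
  \<open>flat_alg\<close>. The literal factors 1 and -1 match its parameter.\<close>

definition bump :: "real^'n::finite \<Rightarrow> real" where
  "bump x = (\<Prod>i\<in>UNIV. flat 0 (1 * x $ i + 1) * flat 0 ((-1) * x $ i + 1))"

lemma bump_nonneg: "bump x \<ge> 0"
  unfolding bump_def by (intro prod_nonneg) (auto simp: flat_def)

lemma bump_pos: "bump 0 > 0"
  unfolding bump_def by (intro prod_pos) (auto simp: flat_def)

text \<open>The function lives on a cube; the l1 norm dominates the Euclidean one, so a norm above
  the dimension forces some coordinate of modulus at least 1.\<close>

lemma bump_vanish: assumes "norm x > CARD('n)" shows "bump (x::real^'n::finite) = 0"
proof -
  have "\<exists>i. \<bar>x $ i\<bar> \<ge> 1"
  proof (rule ccontr)
    assume "\<not> ?thesis"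
    then have "(\<Sum>i\<in>UNIV. \<bar>x $ i\<bar>) \<le> (\<Sum>i\<in>(UNIV::'n set). 1)" by (intro sum_mono) (meson less_imp_le not_le)
    then show False using norm_le_l1_cart[of x] assms by simp
  qed
  then obtain i where "\<bar>x $ i\<bar> \<ge> 1" by blast
  then have "flat 0 (1 * x $ i + 1) * flat 0 ((-1) * x $ i + 1) = 0" by (auto simp: flat_def)
  then show ?thesis unfolding bump_def by (intro prod_zero) auto
qed

lemma test_fun_bump: "test_fun (bump :: real^'n::finite \<Rightarrow> real)"
proof -
  have "flat_alg (\<lambda>x::real^'n. \<Prod>i\<in>A. flat 0 (1 * x $ i + 1) * flat 0 ((-1) * x $ i + 1))" if "finite A" for A
    using that
  proof (induction A)
    case (insert i A)
    have "flat_alg (\<lambda>x::real^'n. (flat 0 (1 * x $ i + 1) * flat 0 ((-1) * x $ i + 1))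
        * (\<Prod>i\<in>A. flat 0 (1 * x $ i + 1) * flat 0 ((-1) * x $ i + 1)))"
      using insert by (intro flat_alg.mult flat_alg.flat)
    then show ?case unfolding prod.insert[OF insert(1,2)] .
  qed (auto intro: flat_alg.const)
  from this[of UNIV] have "flat_alg (bump :: real^'n \<Rightarrow> real)" unfolding bump_def by simp
  moreover have "bounded {x::real^'n. bump x \<noteq> 0}"
    unfolding bounded_iff using bump_vanish by (intro exI[of _ "real CARD('n)"]) (auto simp: not_less[symmetric])
  ultimately show ?thesis by (simp add: test_fun_def flat_alg_smooth)
qed

section \<open>Averages of locally integrable functions\<close>

text \<open>Larger than the space of test functions: Kato's inequality pairs with a test function
  times the indicator of a Borel set, and the density arguments pair with indicators of
  balls.\<close>

definition bdsupp :: "('a::euclidean_space \<Rightarrow> real) \<Rightarrow> bool" where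
  "bdsupp \<psi> \<longleftrightarrow> \<psi> \<in> borel_measurable borel \<and> (\<exists>B R. \<forall>x. \<bar>\<psi> x\<bar> \<le> B \<and> (norm x > R \<longrightarrow> \<psi> x = 0))"

text \<open>Borel rather than Lebesgue measurability, because \<open>u (x + e *\<^sub>R y)\<close>
  has to be measurable in the pair and, for a general measure in \<open>y\<close>, this is not
  inherited from Lebesgue measurability of \<open>u\<close>. Representatives are exchanged in the
  section before the last.\<close>

definition locint :: "('a::euclidean_space \<Rightarrow> real) \<Rightarrow> bool" where
  "locint u \<longleftrightarrow> u \<in> borel_measurable borel \<and> (\<forall>R. integrable lborel (\<lambda>x. indicator (cball 0 R) x * u x))"

lemma locint_measurable [measurable_dest]: "locint u \<Longrightarrow> u \<in> borel_measurable borel"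
  by (simp add: locint_def)

lemma bdsupp_measurable [measurable_dest]: "bdsupp u \<Longrightarrow> u \<in> borel_measurable borel"
  by (simp add: bdsupp_def)

lemma bdsuppE:
  assumes "bdsupp \<psi>"
  obtains B R where "B > 0" "R > 0" "\<And>x. \<bar>\<psi> x\<bar> \<le> B" "\<And>x. norm x > R \<Longrightarrow> \<psi> x = 0"
proof -
  obtain B R where "\<And>x. \<bar>\<psi> x\<bar> \<le> B" "\<And>x. norm x > R \<Longrightarrow> \<psi> x = 0"
    using assms unfolding bdsupp_def by blast
  then show ?thesis
    by (intro that[of "max B 1" "max R 1"]) (auto simp: le_max_iff_disj)
qed

lemma bdsuppI:
  assumes "\<psi> \<in> borel_measurable borel" "\<And>x. \<bar>\<psi> x\<bar> \<le> B" "\<And>x. norm x > R \<Longrightarrow> \<psi> x = 0"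
  shows "bdsupp \<psi>"
  using assms unfolding bdsupp_def by blast

lemma bdsupp_test: "test_fun \<phi> \<Longrightarrow> bdsupp \<phi>"
  using test_fun_bounded[of \<phi>] test_fun_vanish[of \<phi>] continuous_test_fun[of \<phi> UNIV]
  by (metis bdsuppI borel_measurable_continuous_onI)

lemma bdsupp_laplacian: "test_fun \<phi> \<Longrightarrow> bdsupp (laplacian \<phi>)"
  by (intro bdsupp_test test_fun_laplacian)

lemma bdsupp_indicator: "bdsupp (indicator (cball 0 R) :: 'a::euclidean_space \<Rightarrow> real)"
  by (rule bdsuppI[of _ 1 R]) (auto simp: indicator_def intro!: borel_measurable_indicator)

lemma bdsupp_mult_bounded:
  assumes "bdsupp \<psi>" "h \<in> borel_measurable borel" "\<And>x. \<bar>h x\<bar> \<le> C"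
  shows "bdsupp (\<lambda>x. h x * \<psi> x)"
proof -
  obtain B R where B: "B > 0" "\<And>x. \<bar>\<psi> x\<bar> \<le> B" "\<And>x. norm x > R \<Longrightarrow> \<psi> x = 0"
    using bdsuppE[OF assms(1)] by metis
  have "\<bar>h x * \<psi> x\<bar> \<le> C * B" for x
    unfolding abs_mult using B(1) order_trans[OF abs_ge_zero assms(3)] by (intro mult_mono assms B) auto
  with B assms show ?thesis by (intro bdsuppI[of _ "C * B" R]) (auto dest: bdsupp_measurable)
qed

lemma bdsupp_diff:
  assumes "bdsupp f" "bdsupp g" shows "bdsupp (\<lambda>x. f x - g x)"
proof -
  obtain B R where B: "\<And>x. \<bar>f x\<bar> \<le> B" "\<And>x. norm x > R \<Longrightarrow> f x = 0" using bdsuppE[OF assms(1)] by metis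
  obtain B' R' where B': "\<And>x. \<bar>g x\<bar> \<le> B'" "\<And>x. norm x > R' \<Longrightarrow> g x = 0" using bdsuppE[OF assms(2)] by metis
  have "\<bar>f x - g x\<bar> \<le> B + B'" for x using B(1)[of x] B'(1)[of x] by linarith
  with B B' assms show ?thesis
    by (intro bdsuppI[of _ "B + B'" "max R R'"]) (auto dest: bdsupp_measurable)
qed

lemma locint_bdsupp_integrable:
  assumes "locint u" "bdsupp \<psi>" shows "integrable lborel (\<lambda>x. u x * \<psi> x)"
proof -
  obtain B R where B: "B > 0" "\<And>x. \<bar>\<psi> x\<bar> \<le> B" "\<And>x. norm x > R \<Longrightarrow> \<psi> x = 0"
    using bdsuppE[OF assms(2)] by metis
  have int: "integrable lborel (\<lambda>x. B * (indicator (cball 0 R) x * u x))"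
    using assms(1) by (auto simp: locint_def)
  show ?thesis
  proof (rule Bochner_Integration.integrable_bound[OF int])
    show "(\<lambda>x. u x * \<psi> x) \<in> borel_measurable lborel"
      using locint_measurable[OF assms(1)] bdsupp_measurable[OF assms(2)] by measurable
    have "norm (u x * \<psi> x) \<le> norm (B * (indicator (cball 0 R) x * u x))" for x
      using B(1) B(2)[of x] B(3)[of x]
      by (cases "norm x > R") (auto simp: abs_mult mult.commute not_less intro: mult_right_mono)
    then show "AE x in lborel. norm (u x * \<psi> x) \<le> norm (B * (indicator (cball 0 R) x * u x))" by simp
  qed
qed

lemma locintI:
  assumes "u \<in> borel_measurable borel" "\<And>R. integrable lborel (\<lambda>x. indicator (cball 0 R) x * u x)"
  shows "locint u" using assms by (simp add: locint_def)

lemma locint_bound: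
  assumes v: "locint v" and u: "u \<in> borel_measurable borel" and le: "AE x in lborel. \<bar>u x\<bar> \<le> v x"
  shows "locint u"
proof (rule locintI[OF u])
  fix R
  have "integrable lborel (\<lambda>x. indicator (cball 0 R) x * v x)" using v by (simp add: locint_def)
  then show "integrable lborel (\<lambda>x. indicator (cball 0 R) x * u x)"
    by (rule Bochner_Integration.integrable_bound)
      (use u le in \<open>auto simp: abs_mult indicator_def elim!: eventually_mono\<close>)
qed

lemma locint_lincomb:
  assumes "locint u" "locint v" shows "locint (\<lambda>x. a * u x + b * v x)"
proof (rule locintI)
  fix R
  have "integrable lborel (\<lambda>x. a * (indicator (cball 0 R) x * u x) + b * (indicator (cball 0 R) x * v x))"
    using assms by (auto simp: locint_def)
  then show "integrable lborel (\<lambda>x. indicator (cball 0 R) x * (a * u x + b * v x))"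
    by (simp add: algebra_simps)
qed (use assms[THEN locint_measurable] in measurable)

lemma locint_add: "locint u \<Longrightarrow> locint v \<Longrightarrow> locint (\<lambda>x. u x + v x)"
  using locint_lincomb[of u v 1 1] by simp
lemma locint_diff: "locint u \<Longrightarrow> locint v \<Longrightarrow> locint (\<lambda>x. u x - v x)"
  using locint_lincomb[of u v 1 "-1"] by simp
lemma locint_cmult: "locint u \<Longrightarrow> locint (\<lambda>x. c * u x)"
  using locint_lincomb[of u u c 0] by simp
lemma locint_uminus: "locint u \<Longrightarrow> locint (\<lambda>x. - u x)"
  using locint_cmult[of u "-1"] by simp
lemma locint_abs: "locint u \<Longrightarrow> locint (\<lambda>x. \<bar>u x\<bar>)"
  using integrable_abs by (fastforce simp: locint_def abs_mult)
lemma locint_const: "locint (\<lambda>x. c)"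
  by (rule locintI) (auto intro!: integrable_mult_left integrable_real_indicator emeasure_bounded_finite)

lemma locint_between:
  assumes "locint v" "locint w" "u \<in> borel_measurable borel"
    and "AE x in lborel. v x \<le> u x" "AE x in lborel. u x \<le> w x"
  shows "locint u"
proof (rule locint_bound[OF locint_add[OF locint_abs[OF assms(1)] locint_abs[OF assms(2)]] assms(3)])
  show "AE x in lborel. \<bar>u x\<bar> \<le> \<bar>v x\<bar> + \<bar>w x\<bar>" using assms(4,5) by eventually_elim linarith
qed

lemma locint_if:
  assumes "locint u" "locint v" "{x. P x} \<in> sets borel" shows "locint (\<lambda>x. if P x then u x else v x)"
proof (rule locint_bound[OF locint_add[OF locint_abs[OF assms(1)] locint_abs[OF assms(2)]]])
  show "(\<lambda>x. if P x then u x else v x) \<in> borel_measurable borel"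
    using assms by (intro measurable_If) (auto dest: locint_measurable)
qed auto

lemma locint_max: "locint u \<Longrightarrow> locint v \<Longrightarrow> locint (\<lambda>x. max (u x) (v x))"
  unfolding max_def by (intro locint_if) (auto dest!: locint_measurable)

lemma locint_integral_abs_mono:
  assumes "locint u" shows "integrable lborel (\<lambda>x. indicator (cball 0 R) x * \<bar>u x\<bar>)"
  using locint_abs[OF assms] by (simp add: locint_def)

lemma lborel_integrable_translate:
  fixes f :: "'a::euclidean_space \<Rightarrow> real"
  assumes "f \<in> borel_measurable borel"
  shows "integrable lborel (\<lambda>x. f (x + c)) \<longleftrightarrow> integrable lborel f"
proof -
  have "integrable (distr lborel borel ((+) c)) f \<longleftrightarrow> integrable lborel (\<lambda>x. f (c + x))"
    by (rule integrable_distr_eq) (use assms in auto)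
  then show ?thesis by (simp add: lborel_distr_plus add.commute)
qed

lemma lborel_integral_translate:
  fixes f :: "'a::euclidean_space \<Rightarrow> real"
  assumes "f \<in> borel_measurable borel"
  shows "(\<integral>x. f (x + c) \<partial>lborel) = integral\<^sup>L lborel f"
proof -
  have "integral\<^sup>L (distr lborel borel ((+) c)) f = (\<integral>x. f (c + x) \<partial>lborel)"
    by (rule integral_distr) (use assms in auto)
  then show ?thesis by (simp add: lborel_distr_plus add.commute)
qed

lemma lborel_AE_translate:
  fixes c :: "'a::euclidean_space"
  assumes "N \<in> null_sets lborel" shows "AE x in lborel. x + c \<notin> N"
proof -
  have "AE x in distr lborel borel ((+) c). x \<notin> N"
    using assms by (simp add: lborel_distr_plus AE_not_in)
  then have "AE x in lborel. c + x \<notin> N"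
    using assms by (subst (asm) AE_distr_iff) auto
  then show ?thesis by (simp add: add.commute)
qed

section \<open>Averages against a finite measure carried by the unit ball\<close>

definition avg :: "'a::euclidean_space measure \<Rightarrow> real \<Rightarrow> ('a \<Rightarrow> real) \<Rightarrow> 'a \<Rightarrow> real" where
  "avg m e u x = (\<integral>y. u (x + e *\<^sub>R y) \<partial>m)"

text \<open>Measures instead of densities, because the kernels obtained below by averaging over
  scales are image measures. With the support in the unit ball, \<open>\<bar>e\<bar>\<close> is the
  radius of the averaging region.\<close>

locale kernel = finite_measure m for m :: "'a::euclidean_space measure" +
  assumes sets_m [measurable_cong]: "sets m = sets borel" and supp: "AE y in m. norm y \<le> 1"
begin

sublocale P: pair_sigma_finite lborel m ..
sublocale Q: pair_sigma_finite m lborel ..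

text \<open>For \<bar>y\<bar> \<le> 1 the translate of \<psi> by e y stays in one ball, so all inner
  L1 norms are below a common constant, and constants are integrable for the finite measure
  \<open>m\<close>.\<close>

lemma integrable_Q:
  assumes u: "locint u" and \<psi>: "bdsupp (\<psi> :: 'a \<Rightarrow> real)"
  shows "integrable (m \<Otimes>\<^sub>M lborel) (\<lambda>(y, x). u (x + e *\<^sub>R y) * \<psi> x)"
proof -
  note [measurable] = locint_measurable[OF u] bdsupp_measurable[OF \<psi>]
  obtain B R where B: "B > 0" "R > 0" "\<And>x. \<bar>\<psi> x\<bar> \<le> B" "\<And>x. norm x > R \<Longrightarrow> \<psi> x = 0"
    using bdsuppE[OF \<psi>] by metis
  define C where "C = (\<integral>x. B * (indicator (cball 0 (R + \<bar>e\<bar>)) x * \<bar>u x\<bar>) \<partial>lborel)"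
  have intC: "integrable lborel (\<lambda>x. B * (indicator (cball 0 (R + \<bar>e\<bar>)) x * \<bar>u x\<bar>))"
    using locint_integral_abs_mono[OF u] by auto
  have int: "integrable lborel (\<lambda>x. u (x + e *\<^sub>R y) * \<psi> x)"
    and bd: "norm y \<le> 1 \<Longrightarrow> (\<integral>x. norm (u (x + e *\<^sub>R y) * \<psi> x) \<partial>lborel) \<le> C" for y
  proof -
    have \<psi>': "bdsupp (\<lambda>x. \<psi> (x - e *\<^sub>R y))"
    proof (rule bdsuppI[of _ B "R + norm (e *\<^sub>R y)"])
      fix x :: 'a assume "norm x > R + norm (e *\<^sub>R y)"
      then show "\<psi> (x - e *\<^sub>R y) = 0" using norm_triangle_ineq2[of x "e *\<^sub>R y"] by (intro B) linarith
    qed (use B in auto)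
    have i: "integrable lborel (\<lambda>x. u x * \<psi> (x - e *\<^sub>R y))" by (rule locint_bdsupp_integrable[OF u \<psi>'])
    then show "integrable lborel (\<lambda>x. u (x + e *\<^sub>R y) * \<psi> x)"
      using lborel_integrable_translate[of "\<lambda>x. u x * \<psi> (x - e *\<^sub>R y)" "e *\<^sub>R y"] by simp
    assume y: "norm y \<le> 1"
    have ey: "norm (e *\<^sub>R y) \<le> \<bar>e\<bar>" using y by (simp add: mult_left_le)
    have "(\<integral>x. norm (u (x + e *\<^sub>R y) * \<psi> x) \<partial>lborel) = (\<integral>x. norm (u x * \<psi> (x - e *\<^sub>R y)) \<partial>lborel)"
      using lborel_integral_translate[of "\<lambda>x. norm (u x * \<psi> (x - e *\<^sub>R y))" "e *\<^sub>R y"] by simp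
    also have "\<dots> \<le> C" unfolding C_def
    proof (rule Bochner_Integration.integral_mono[OF integrable_norm[OF i] intC])
      fix x :: 'a
      have "norm x > R + \<bar>e\<bar> \<Longrightarrow> \<psi> (x - e *\<^sub>R y) = 0"
        using norm_triangle_ineq2[of x "e *\<^sub>R y"] ey by (intro B) linarith
      then show "norm (u x * \<psi> (x - e *\<^sub>R y)) \<le> B * (indicator (cball 0 (R + \<bar>e\<bar>)) x * \<bar>u x\<bar>)"
        using B(3)[of "x - e *\<^sub>R y"]
        by (cases "norm x > R + \<bar>e\<bar>") (auto simp: abs_mult mult.commute[of B] not_less intro: mult_left_mono)
    qed
    finally show "(\<integral>x. norm (u (x + e *\<^sub>R y) * \<psi> x) \<partial>lborel) \<le> C" .
  qed
  show ?thesis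
  proof (rule Q.Fubini_integrable)
    show "integrable m (\<lambda>y. \<integral>x. norm (case (y, x) of (y, x) \<Rightarrow> u (x + e *\<^sub>R y) * \<psi> x) \<partial>lborel)"
    proof (rule integrable_const_bound[where B = C])
      show "AE y in m. norm (\<integral>x. norm (case (y, x) of (y, x) \<Rightarrow> u (x + e *\<^sub>R y) * \<psi> x) \<partial>lborel) \<le> C"
        using supp by eventually_elim (use bd in auto)
    qed measurable
  qed (use int in auto)
qed

lemma integrable_P:
  assumes "locint u" "bdsupp \<psi>"
  shows "integrable (lborel \<Otimes>\<^sub>M m) (\<lambda>(x, y). u (x + e *\<^sub>R y) * \<psi> x)"
  using Q.integrable_product_swap[OF integrable_Q[OF assms]] by simp

lemma avg_measurable:
  assumes [measurable]: "u \<in> borel_measurable borel"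
  shows "avg m e u \<in> borel_measurable borel"
proof -
  have "(\<lambda>x. \<integral>y. u (x + e *\<^sub>R y) \<partial>m) \<in> borel_measurable borel" by measurable
  then show ?thesis by (simp add: avg_def[abs_def])
qed

lemma AE_integrable:
  assumes "locint u" shows "AE x in lborel. integrable m (\<lambda>y. u (x + e *\<^sub>R y))"
proof -
  have "\<forall>n::nat. AE x in lborel. integrable m (\<lambda>y. u (x + e *\<^sub>R y) * indicator (cball 0 (real n)) x)"
    using P.AE_integrable_fst'[OF integrable_P[OF assms bdsupp_indicator]] by auto
  then have "AE x in lborel. \<forall>n::nat. integrable m (\<lambda>y. u (x + e *\<^sub>R y) * indicator (cball 0 (real n)) x)"
    unfolding AE_all_countable .
  then show ?thesis
  proof eventually_elim
    fix x assume *: "\<forall>n::nat. integrable m (\<lambda>y. u (x + e *\<^sub>R y) * indicator (cball 0 (real n)) x)"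
    obtain n :: nat where "norm x \<le> n" using real_arch_simple by blast
    then show "integrable m (\<lambda>y. u (x + e *\<^sub>R y))" using *[rule_format, of n] by simp
  qed
qed

lemma locint_avg: assumes u: "locint u" shows "locint (avg m e u)"
proof (rule locintI)
  show "avg m e u \<in> borel_measurable borel" using u by (intro avg_measurable) (rule locint_measurable)
  fix R
  have "integrable lborel (\<lambda>x. \<integral>y. u (x + e *\<^sub>R y) * indicator (cball 0 R) x \<partial>m)"
    using P.integrable_fst'[OF integrable_P[OF u bdsupp_indicator, of e R]] by simp
  then show "integrable lborel (\<lambda>x. indicator (cball 0 R) x * avg m e u x)"
    by (simp add: avg_def mult.commute)
qed

lemma avg_pairing:
  assumes u: "locint u" and \<psi>: "bdsupp \<psi>"
  shows "(\<integral>x. avg m e u x * \<psi> x \<partial>lborel) = (\<integral>y. \<integral>x. u (x + e *\<^sub>R y) * \<psi> x \<partial>lborel \<partial>m)"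
proof -
  have "(\<integral>x. avg m e u x * \<psi> x \<partial>lborel) = (\<integral>x. \<integral>y. u (x + e *\<^sub>R y) * \<psi> x \<partial>m \<partial>lborel)"
    by (simp add: avg_def)
  also have "\<dots> = (\<integral>y. \<integral>x. u (x + e *\<^sub>R y) * \<psi> x \<partial>lborel \<partial>m)"
    using Q.Fubini_integral[of "\<lambda>y x. u (x + e *\<^sub>R y) * \<psi> x"] integrable_Q[OF assms] by simp
  finally show ?thesis .
qed

lemma avg_bdsupp: assumes \<psi>: "bdsupp \<psi>" shows "bdsupp (avg m e \<psi>)"
proof -
  note [measurable] = bdsupp_measurable[OF \<psi>]
  obtain B R where B: "B > 0" "R > 0" "\<And>x. \<bar>\<psi> x\<bar> \<le> B" "\<And>x. norm x > R \<Longrightarrow> \<psi> x = 0"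
    using bdsuppE[OF \<psi>] by metis
  show ?thesis
  proof (rule bdsuppI[of _ "B * measure m (space m)" "R + \<bar>e\<bar>"])
    show "avg m e \<psi> \<in> borel_measurable borel" by (intro avg_measurable) simp
    fix x :: 'a
    have "integrable m (\<lambda>y. \<psi> (x + e *\<^sub>R y))"
      by (rule integrable_const_bound[where B = B]) (use B in auto)
    then have "norm (avg m e \<psi> x) \<le> (\<integral>y. B \<partial>m)" unfolding avg_def
      by (rule Bochner_Integration.integral_norm_bound_integral) (use B in auto)
    then show "\<bar>avg m e \<psi> x\<bar> \<le> B * measure m (space m)" by (simp add: mult.commute)
    assume x: "norm x > R + \<bar>e\<bar>"
    have "AE y in m. \<psi> (x + e *\<^sub>R y) = 0" using supp
    proof eventually_elim
      fix y :: 'a assume "norm y \<le> 1"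
      then have "norm (e *\<^sub>R y) \<le> \<bar>e\<bar>" by (simp add: mult_left_le)
      then show "\<psi> (x + e *\<^sub>R y) = 0" using x norm_diff_ineq[of x "e *\<^sub>R y"] by (intro B) linarith
    qed
    then show "avg m e \<psi> x = 0" unfolding avg_def by (intro integral_eq_zero_AE)
  qed
qed

text \<open>Translation invariance moves the shift from \<open>u\<close> to \<psi> and reverses its
  sign, so the adjoint of averaging at scale \<open>e\<close> is averaging at scale
  \<open>-e\<close>.\<close>

lemma avg_adjoint:
  assumes u: "locint u" and \<psi>: "bdsupp \<psi>"
  shows "(\<integral>x. avg m e u x * \<psi> x \<partial>lborel) = (\<integral>x. u x * avg m (-e) \<psi> x \<partial>lborel)"
proof -
  note [measurable] = locint_measurable[OF u] bdsupp_measurable[OF \<psi>]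
  have "(\<integral>x. u (x + e *\<^sub>R y) * \<psi> x \<partial>lborel) = (\<integral>x. \<psi> (x + (- e) *\<^sub>R y) * u x \<partial>lborel)" for y
    using lborel_integral_translate[of "\<lambda>x. u x * \<psi> (x - e *\<^sub>R y)" "e *\<^sub>R y"] by (simp add: mult.commute)
  then have "(\<integral>x. avg m e u x * \<psi> x \<partial>lborel) = (\<integral>y. \<integral>x. \<psi> (x + (- e) *\<^sub>R y) * u x \<partial>lborel \<partial>m)"
    by (simp add: avg_pairing[OF assms])
  also have "\<dots> = (\<integral>x. \<integral>y. \<psi> (x + (- e) *\<^sub>R y) * u x \<partial>m \<partial>lborel)"
  proof (rule Q.Fubini_integral[symmetric])
    \<comment> \<open>The integrand is the one of \<open>integrable_Q\<close> after the shear (y, x)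
      to (y, x - e y), which leaves every inner integral over \<open>x\<close> unchanged.\<close>
    have "integrable (m \<Otimes>\<^sub>M lborel) (\<lambda>p. (\<lambda>(y,x). u (x + e *\<^sub>R y) * \<psi> x) (fst p, snd p + (- e) *\<^sub>R fst p))"
    proof (rule Q.Fubini_integrable)
      have "(\<integral>x. norm (u x * \<psi> (x + (- e) *\<^sub>R y)) \<partial>lborel) = (\<integral>x. norm (u (x + e *\<^sub>R y) * \<psi> x) \<partial>lborel)" for y
        using lborel_integral_translate[of "\<lambda>x. norm (u x * \<psi> (x + (- e) *\<^sub>R y))" "e *\<^sub>R y"] by simp
      moreover have "integrable m (\<lambda>y. \<integral>x. norm (u (x + e *\<^sub>R y) * \<psi> x) \<partial>lborel)"
        using Q.integrable_fst'[OF integrable_norm[OF integrable_Q[OF u \<psi>, of e]]] by simp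
      ultimately show "integrable m (\<lambda>y. \<integral>x. norm ((\<lambda>(y,x). u (x + e *\<^sub>R y) * \<psi> x)
          (fst (y, x), snd (y, x) + (- e) *\<^sub>R fst (y, x))) \<partial>lborel)"
        by simp
      have "AE y in m. integrable lborel (\<lambda>x. u (x + e *\<^sub>R y) * \<psi> x)"
        using Q.AE_integrable_fst'[OF integrable_Q[OF u \<psi>, of e]] by simp
      then show "AE y in m. integrable lborel (\<lambda>x. (\<lambda>(y,x). u (x + e *\<^sub>R y) * \<psi> x)
          (fst (y, x), snd (y, x) + (- e) *\<^sub>R fst (y, x)))"
      proof eventually_elim
        case (elim y)
        then show ?case
          using lborel_integrable_translate[of "\<lambda>x. u x * \<psi> (x + (- e) *\<^sub>R y)" "e *\<^sub>R y"] by simp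
      qed
    qed measurable
    then show "integrable (m \<Otimes>\<^sub>M lborel) (\<lambda>(y, x). \<psi> (x + (- e) *\<^sub>R y) * u x)"
      by (simp add: case_prod_beta' mult.commute)
  qed
  also have "\<dots> = (\<integral>x. u x * avg m (-e) \<psi> x \<partial>lborel)"
    by (simp add: avg_def mult.commute)
  finally show ?thesis .
qed

text \<open>Every translate of a null set is null; Fubini then exchanges the quantifiers. The
  exceptional set of \<open>x\<close> is unavoidable, since \<open>m\<close> may charge Lebesgue
  null sets.\<close>

lemma AE_translate:
  assumes "AE x in lborel. P x"
  shows "AE x in lborel. AE y in m. P (x + e *\<^sub>R y)"
proof -
  obtain N where N: "N \<in> null_sets lborel" "{x. \<not> P x} \<subseteq> N"
    using assms unfolding eventually_ae_filter by auto
  have [measurable]: "N \<in> sets borel" using N by auto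
  have "AE y in m. AE x in lborel. x + e *\<^sub>R y \<notin> N" using lborel_AE_translate[OF N(1)] by simp
  then have "AE x in lborel. AE y in m. x + e *\<^sub>R y \<notin> N"
    by (subst P.AE_commute) measurable
  then show ?thesis by eventually_elim (use N in \<open>auto elim!: eventually_mono\<close>)
qed

lemma avg_mono_AE:
  assumes "locint u" "locint v" "AE x in lborel. u x \<le> v x"
  shows "AE x in lborel. avg m e u x \<le> avg m e v x"
  using AE_translate[OF assms(3), of e] AE_integrable[OF assms(1), of e] AE_integrable[OF assms(2), of e]
  by eventually_elim (auto simp: avg_def intro: integral_mono_AE)

lemma avg_lincomb:
  assumes "locint u" "locint v"
  shows "AE x in lborel. avg m e (\<lambda>x. a * u x + b * v x) x = a * avg m e u x + b * avg m e v x"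
  using AE_integrable[OF assms(1), of e] AE_integrable[OF assms(2), of e]
  by eventually_elim (auto simp: avg_def)

lemma avg_nonneg: "(\<And>x. 0 \<le> u x) \<Longrightarrow> 0 \<le> avg m e u x"
  unfolding avg_def by (rule Bochner_Integration.integral_nonneg) simp

end

lemma cball_borel [measurable]: "cball (x::'a::euclidean_space) r \<in> sets borel" by simp

lemma (in kernel) integrable_bdsupp:
  assumes "bdsupp \<psi>" shows "integrable m (\<lambda>y. \<psi> (x + e *\<^sub>R y))"
proof -
  obtain B R where B: "\<And>x. \<bar>\<psi> x\<bar> \<le> B" using bdsuppE[OF assms] by metis
  note [measurable] = bdsupp_measurable[OF assms]
  show ?thesis by (rule integrable_const_bound[where B = B]) (use B in auto)
qed

section \<open>Averages of test functions are test functions\<close>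

lemma has_derivative_imp_pd:
  fixes f :: "real^'n::finite \<Rightarrow> real"
  assumes "(f has_derivative (\<lambda>h. \<Sum>i\<in>UNIV. h $ i * c i)) (at x)"
  shows "pd i f x = c i"
proof -
  have "(f has_derivative (\<lambda>h. \<Sum>i\<in>UNIV. h $ i * pd i f x)) (at x)"
    by (rule has_derivative_pd) (use assms in \<open>auto simp: differentiable_def\<close>)
  from has_derivative_unique[OF this assms, THEN fun_cong, of "axis i 1"]
  show ?thesis by (simp add: axis_def if_distrib if_distribR cong: if_cong)
qed

lemma avg_has_derivative:
  fixes m :: "(real^'n::finite) measure"
  assumes "kernel m" and \<phi>: "test_fun \<phi>"
  shows "(avg m e \<phi> has_derivative (\<lambda>h. \<Sum>i\<in>UNIV. h $ i * avg m e (pd i \<phi>) x)) (at x)"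
proof -
  interpret kernel m by fact
  obtain C where C: "C > 0" "\<And>x h. \<bar>\<phi> (x + h) - \<phi> x - (\<Sum>i\<in>UNIV. h $ i * pd i \<phi> x)\<bar> \<le> C * (norm h)\<^sup>2"
    using test_fun_taylor[OF \<phi>] by metis
  define K where "K = C * measure m (space m)"
  note int = integrable_bdsupp[OF bdsupp_test[OF \<phi>]]
  have intd: "integrable m (\<lambda>z. pd i \<phi> (x + e *\<^sub>R z))" for i
    by (rule integrable_bdsupp[OF bdsupp_test[OF test_fun_pd[OF \<phi>]]])
  show ?thesis
  proof (rule has_derivativeI_sandwich[of 1 _ _ _ _ "\<lambda>y. K * norm (y - x)"])
    show "bounded_linear (\<lambda>h::real^'n. \<Sum>i\<in>UNIV. h $ i * avg m e (pd i \<phi>) x)"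
      by (intro bounded_linear_sum bounded_linear_mult_const bounded_linear_vec_nth)
    show "((\<lambda>y. K * norm (y - x)) \<longlongrightarrow> 0) (at x)"
      by (intro tendsto_mult_right_zero tendsto_norm_zero) (simp add: LIM_zero)
    fix y :: "real^'n" assume "y \<noteq> x"
    define h where "h = y - x"
    have "avg m e \<phi> y - avg m e \<phi> x - (\<Sum>i\<in>UNIV. h $ i * avg m e (pd i \<phi>) x)
      = (\<integral>z. \<phi> ((x + e *\<^sub>R z) + h) - \<phi> (x + e *\<^sub>R z) - (\<Sum>i\<in>UNIV. h $ i * pd i \<phi> (x + e *\<^sub>R z)) \<partial>m)"
      using int[of y e] int[of x e] intd by (simp add: avg_def h_def algebra_simps)
    also have "norm \<dots> \<le> (\<integral>z. C * (norm h)\<^sup>2 \<partial>m)"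
    proof (rule Bochner_Integration.integral_norm_bound_integral)
      have "integrable m (\<lambda>z. \<phi> (y + e *\<^sub>R z))" by (rule int)
      then have "integrable m (\<lambda>z. \<phi> ((x + e *\<^sub>R z) + h))" by (simp add: h_def algebra_simps)
      then show "integrable m (\<lambda>z. \<phi> ((x + e *\<^sub>R z) + h) - \<phi> (x + e *\<^sub>R z) - (\<Sum>i\<in>UNIV. h $ i * pd i \<phi> (x + e *\<^sub>R z)))"
        using int[of x e] intd by auto
    qed (use C in auto)
    also have "\<dots> = K * (norm h)\<^sup>2" by (simp add: K_def)
    finally have "norm (avg m e \<phi> y - avg m e \<phi> x - (\<Sum>i\<in>UNIV. (y - x) $ i * avg m e (pd i \<phi>) x)) \<le> K * (norm (y - x))\<^sup>2"
      by (simp add: h_def)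
    then show "norm (avg m e \<phi> y - avg m e \<phi> x - (\<Sum>i\<in>UNIV. (y - x) $ i * avg m e (pd i \<phi>) x)) / norm (y - x)
        \<le> K * norm (y - x)"
      using \<open>y \<noteq> x\<close> by (simp add: field_simps power2_eq_square)
  qed simp
qed

lemma pd_avg:
  assumes "kernel m" "test_fun \<phi>" shows "pd i (avg m e \<phi>) = avg m e (pd i \<phi>)"
  by (intro ext has_derivative_imp_pd avg_has_derivative assms)

text \<open>This admits averages as test functions in a weak inequality, which is how mean value
  inequalities are extracted from it.\<close>

lemma test_fun_avg:
  fixes m :: "(real^'n::finite) measure"
  assumes m: "kernel m" and \<phi>: "test_fun \<phi>" shows "test_fun (avg m e \<phi>)"
proof -
  interpret kernel m by fact
  have t: "test_fun (foldr pd \<alpha> \<phi>)" for \<alpha> by (induction \<alpha>) (auto simp: \<phi> test_fun_pd)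
  have "foldr pd \<alpha> (avg m e \<phi>) = avg m e (foldr pd \<alpha> \<phi>)" for \<alpha>
    by (induction \<alpha>) (auto simp: pd_avg[OF m t])
  then have "smooth (avg m e \<phi>)"
    unfolding smooth_def using avg_has_derivative[OF m t, THEN differentiableI] by simp
  moreover obtain B R where "\<And>x. norm x > R \<Longrightarrow> avg m e \<phi> x = 0"
    using bdsuppE[OF avg_bdsupp[OF bdsupp_test[OF \<phi>]]] by metis
  then have "bounded {x. avg m e \<phi> x \<noteq> 0}" unfolding bounded_iff by (intro exI[of _ R]) (auto simp: not_less[symmetric])
  ultimately show ?thesis by (simp add: test_fun_def)
qed

lemma laplacian_avg:
  fixes m :: "(real^'n::finite) measure"
  assumes m: "kernel m" and \<phi>: "test_fun \<phi>" shows "laplacian (avg m e \<phi>) = avg m e (laplacian \<phi>)"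
proof
  interpret kernel m by fact
  fix x
  have "integrable m (\<lambda>z. pd i (pd i \<phi>) (x + e *\<^sub>R z))" for i
    by (rule integrable_bdsupp[OF bdsupp_test[OF test_fun_pd[OF test_fun_pd[OF \<phi>]]]])
  then show "laplacian (avg m e \<phi>) x = avg m e (laplacian \<phi>) x"
    by (simp add: laplacian_def pd_avg[OF m \<phi>] pd_avg[OF m test_fun_pd[OF \<phi>]]) (simp add: avg_def)
qed

text \<open>Integration by parts without a divergence theorem: difference quotients of
  \<open>F\<close> have integral zero by translation invariance, and they converge boundedly to
  \<open>G\<close>. Since \<open>G\<close> need not be continuous, the lemma also covers functions
  that are only once differentiable.\<close>

lemma integral_directional_derivative_zero:
  fixes F G :: "'a::euclidean_space \<Rightarrow> real"
  assumes F: "bdsupp F" and G: "bdsupp G"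
    and d: "\<And>x. ((\<lambda>t. F (x + t *\<^sub>R v)) has_real_derivative G x) (at 0)"
  shows "integral\<^sup>L lborel G = 0"
proof -
  note [measurable] = bdsupp_measurable[OF F] bdsupp_measurable[OF G]
  obtain R where R: "\<And>x. norm x > R \<Longrightarrow> F x = 0" using bdsuppE[OF F] by metis
  obtain C where C: "C > 0" "\<And>x. \<bar>G x\<bar> \<le> C" using bdsuppE[OF G] by metis
  have d': "((\<lambda>t. F (x + t *\<^sub>R v)) has_real_derivative G (x + s *\<^sub>R v)) (at s)" for x s
  proof -
    have "((\<lambda>t. t - s) has_real_derivative 1) (at s)" by (auto intro!: derivative_eq_intros)
    from DERIV_chain2[OF _ this, of "\<lambda>t. F ((x + s *\<^sub>R v) + t *\<^sub>R v)" "G (x + s *\<^sub>R v)"] d[of "x + s *\<^sub>R v"]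
    have "((\<lambda>t. F ((x + s *\<^sub>R v) + (t - s) *\<^sub>R v)) has_real_derivative G (x + s *\<^sub>R v)) (at s)"
      by simp
    then show ?thesis by (simp add: algebra_simps)
  qed
  \<comment> \<open>The mean value theorem turns the bound on \<open>G\<close> into the common
    majorant of the difference quotients.\<close>
  have lip: "\<bar>F (x + s *\<^sub>R v) - F x\<bar> \<le> C * s" if s: "s > 0" for x s
  proof -
    obtain z where "F (x + s *\<^sub>R v) - F (x + 0 *\<^sub>R v) = (s - 0) * G (x + z *\<^sub>R v)"
      using MVT2[OF s, of "\<lambda>t. F (x + t *\<^sub>R v)" "\<lambda>t. G (x + t *\<^sub>R v)"] d' by blast
    then show ?thesis using C(2)[of "x + z *\<^sub>R v"] that by (simp add: abs_mult mult.commute[of C] mult_left_mono)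
  qed
  define q where "q n x = Suc n *\<^sub>R (F (x + inverse (Suc n) *\<^sub>R v) - F x)" for n :: nat and x
  have "(\<lambda>n. integral\<^sup>L lborel (q n)) \<longlonglongrightarrow> integral\<^sup>L lborel G"
  proof (rule integral_dominated_convergence[where w = "\<lambda>x. C * indicator (cball 0 (R + norm v)) x"])
    show "integrable lborel (\<lambda>x::'a. C * indicator (cball 0 (R + norm v)) x)"
      using locint_const[where 'a = 'a, of C] unfolding locint_def by (auto simp: mult.commute[of C])
    show "AE x in lborel. (\<lambda>n. q n x) \<longlonglongrightarrow> G x"
    proof (rule AE_I2)
      fix x
      have "((\<lambda>h. (F (x + h *\<^sub>R v) - F x) / h) \<longlongrightarrow> G x) (at 0)" using d[of x] by (simp add: DERIV_def)
      moreover have "filterlim (\<lambda>n. inverse (real (Suc n))) (at 0) sequentially"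
        unfolding filterlim_at using LIMSEQ_inverse_real_of_nat by auto
      ultimately have "(\<lambda>n. (F (x + inverse (real (Suc n)) *\<^sub>R v) - F x) / inverse (real (Suc n))) \<longlonglongrightarrow> G x"
        by (rule filterlim_compose)
      then show "(\<lambda>n. q n x) \<longlonglongrightarrow> G x" by (simp add: q_def field_simps)
    qed
    show "AE x in lborel. norm (q n x) \<le> C * indicator (cball 0 (R + norm v)) x" for n
    proof (rule AE_I2)
      fix x
      show "norm (q n x) \<le> C * indicator (cball 0 (R + norm v)) x"
      proof (cases "norm x > R + norm v")
        case True
        have "norm (inverse (real (Suc n)) *\<^sub>R v) \<le> norm v" by (simp add: mult_left_le_one_le field_simps)
        then have "norm (x + inverse (real (Suc n)) *\<^sub>R v) > R"
          using True norm_diff_ineq[of x "inverse (real (Suc n)) *\<^sub>R v"] by linarith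
        moreover have "norm x > R" using True norm_ge_zero[of v] by linarith
        ultimately show ?thesis using R C by (simp add: q_def)
      next
        case False
        have "real (Suc n) * \<bar>F (x + inverse (Suc n) *\<^sub>R v) - F x\<bar> \<le> real (Suc n) * (C * inverse (Suc n))"
          by (intro mult_left_mono lip) auto
        also have "\<dots> = C" by simp
        finally have "\<bar>q n x\<bar> \<le> C" by (simp add: q_def abs_mult del: of_nat_Suc)
        then show ?thesis using False by simp
      qed
    qed
    show "q n \<in> borel_measurable lborel" for n unfolding q_def[abs_def] by measurable
  qed simp
  moreover have "integral\<^sup>L lborel (q n) = 0" for n
  proof -
    have i: "integrable lborel F"
      using locint_bdsupp_integrable[OF locint_const[of 1] F] by simp
    then show ?thesis
      using lborel_integrable_translate[of F "inverse (Suc n) *\<^sub>R v"] lborel_integral_translate[of F "inverse (Suc n) *\<^sub>R v"]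
      by (simp add: q_def[abs_def])
  qed
  ultimately have "(\<lambda>n. 0) \<longlonglongrightarrow> integral\<^sup>L lborel G" by simp
  then show ?thesis by (simp add: LIMSEQ_const_iff)
qed

section \<open>Continuity of translations in L1 and approximate identities\<close>

lemma clip_tendsto:
  fixes x :: real shows "(\<lambda>k. max (- real k) (min (real k) x)) \<longlonglongrightarrow> x"
proof -
  obtain n :: nat where n: "\<bar>x\<bar> \<le> n" using real_arch_simple by blast
  have "\<forall>\<^sub>F k in sequentially. max (- real k) (min (real k) x) = x"
    using eventually_ge_at_top[of n] by eventually_elim (use n in auto)
  then show ?thesis by (rule tendsto_eventually)
qed

text \<open>Density in L1 of a ball in two moves: truncate \<open>h\<close> at \<plusminus>k, then
  use that \<open>h\<close> is an a.e. limit of continuous functions.\<close>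

lemma locint_continuous_approx:
  fixes h :: "'a::euclidean_space \<Rightarrow> real"
  assumes h: "locint h" and e: "\<delta> > 0"
  obtains c B where "continuous_on UNIV c" "\<And>x. \<bar>c x\<bar> \<le> B"
    "(\<integral>x. indicator (cball 0 R) x * \<bar>h x - c x\<bar> \<partial>lborel) < \<delta>"
proof -
  note [measurable] = locint_measurable[OF h]
  define hk where "hk k x = max (- real k) (min (real k) (h x))" for k :: nat and x
  have [measurable]: "hk k \<in> borel_measurable borel" for k unfolding hk_def by measurable
  have hk: "locint (hk k)" for k
    by (rule locint_bound[OF locint_abs[OF h]]) (auto simp: hk_def abs_if max_def min_def)
  have "(\<lambda>k. \<integral>x. indicator (cball 0 R) x * \<bar>h x - hk k x\<bar> \<partial>lborel) \<longlonglongrightarrow> integral\<^sup>L lborel (\<lambda>x::'a. 0::real)"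
  proof (rule integral_dominated_convergence[where w = "\<lambda>x. indicator (cball 0 R) x * \<bar>h x\<bar>"])
    show "integrable lborel (\<lambda>x. indicator (cball 0 R) x * \<bar>h x\<bar>)" by (rule locint_integral_abs_mono[OF h])
    show "AE x in lborel. (\<lambda>k. indicator (cball 0 R) x * \<bar>h x - hk k x\<bar>) \<longlonglongrightarrow> 0"
    proof (rule AE_I2)
      fix x
      have "(\<lambda>k. h x - hk k x) \<longlonglongrightarrow> h x - h x" unfolding hk_def by (intro tendsto_diff tendsto_const clip_tendsto)
      then show "(\<lambda>k. indicator (cball 0 R) x * \<bar>h x - hk k x\<bar>) \<longlonglongrightarrow> 0"
        by (intro tendsto_mult_right_zero tendsto_rabs_zero) simp
    qed
    show "AE x in lborel. norm (indicator (cball 0 R) x * \<bar>h x - hk k x\<bar>) \<le> indicator (cball 0 R) x * \<bar>h x\<bar>" for k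
      by (rule AE_I2) (auto simp: hk_def indicator_def)
    show "(\<lambda>x. indicator (cball 0 R) x * \<bar>h x - hk k x\<bar>) \<in> borel_measurable lborel" for k by measurable
  qed simp
  then have "\<forall>\<^sub>F k in sequentially. (\<integral>x. indicator (cball 0 R) x * \<bar>h x - hk k x\<bar> \<partial>lborel) < \<delta> / 2"
    by (rule order_tendstoD) (use e in auto)
  then obtain k where k: "(\<integral>x. indicator (cball 0 R) x * \<bar>h x - hk k x\<bar> \<partial>lborel) < \<delta> / 2"
    by (auto simp: eventually_sequentially)
  have "h \<in> borel_measurable lebesgue" by (rule measurable_completion) simp
  then have "h measurable_on UNIV" by (rule lebesgue_measurable_imp_measurable_on_real) simp
  then obtain N g where N: "negligible N" and g: "\<And>n. continuous_on UNIV (g n)"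
    and lim: "\<And>x. x \<notin> N \<Longrightarrow> (\<lambda>n. g n x) \<longlonglongrightarrow> h x"
    unfolding measurable_on_def by auto
  have [measurable]: "g n \<in> borel_measurable borel" for n using g by (rule borel_measurable_continuous_onI)
  \<comment> \<open>Clipping the approximants at the same level \<open>k\<close> supplies the
    majorant for dominated convergence and keeps them continuous.\<close>
  define c where "c n x = max (- real k) (min (real k) (g n x))" for n :: nat and x
  have [measurable]: "c n \<in> borel_measurable borel" for n unfolding c_def by measurable
  have cc: "continuous_on UNIV (c n)" for n unfolding c_def by (intro continuous_intros g)
  have AEN: "AE x in lborel. x \<notin> N"
  proof -
    have "AE x in lebesgue. x \<notin> N" using N by (intro AE_not_in) (simp add: negligible_iff_null_sets)
    then show ?thesis by (simp add: AE_completion_iff)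
  qed
  have "(\<lambda>n. \<integral>x. indicator (cball 0 R) x * \<bar>hk k x - c n x\<bar> \<partial>lborel) \<longlonglongrightarrow> integral\<^sup>L lborel (\<lambda>x::'a. 0::real)"
  proof (rule integral_dominated_convergence[where w = "\<lambda>x. indicator (cball 0 R) x * (2 * real k)"])
    show "integrable lborel (\<lambda>x::'a. indicator (cball 0 R) x * (2 * real k))"
      using locint_const[of "2 * real k"] unfolding locint_def by blast
    show "AE x in lborel. (\<lambda>n. indicator (cball 0 R) x * \<bar>hk k x - c n x\<bar>) \<longlonglongrightarrow> 0"
      using AEN
    proof eventually_elim
      case (elim x)
      then have "(\<lambda>n. c n x) \<longlonglongrightarrow> hk k x" unfolding c_def hk_def by (intro tendsto_max tendsto_min tendsto_const lim)
      then have "(\<lambda>n. hk k x - c n x) \<longlonglongrightarrow> hk k x - hk k x" by (intro tendsto_diff tendsto_const)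
      then show ?case by (intro tendsto_mult_right_zero tendsto_rabs_zero) simp
    qed
    show "AE x in lborel. norm (indicator (cball 0 R) x * \<bar>hk k x - c n x\<bar>) \<le> indicator (cball 0 R) x * (2 * real k)" for n
      by (rule AE_I2) (auto simp: hk_def c_def indicator_def)
    show "(\<lambda>x. indicator (cball 0 R) x * \<bar>hk k x - c n x\<bar>) \<in> borel_measurable lborel" for n by measurable
  qed simp
  then have "\<forall>\<^sub>F n in sequentially. (\<integral>x. indicator (cball 0 R) x * \<bar>hk k x - c n x\<bar> \<partial>lborel) < \<delta> / 2"
    by (rule order_tendstoD) (use e in auto)
  then obtain n where n: "(\<integral>x. indicator (cball 0 R) x * \<bar>hk k x - c n x\<bar> \<partial>lborel) < \<delta> / 2"
    by (auto simp: eventually_sequentially)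
  have lc: "locint (c n)" by (rule locint_bound[OF locint_const[of "real k"]]) (auto simp: c_def)
  have i: "integrable lborel (\<lambda>x. indicator (cball 0 R) x * \<bar>h x - hk k x\<bar>)"
    "integrable lborel (\<lambda>x. indicator (cball 0 R) x * \<bar>hk k x - c n x\<bar>)"
    "integrable lborel (\<lambda>x. indicator (cball 0 R) x * \<bar>h x - c n x\<bar>)"
    by (intro locint_integral_abs_mono locint_diff h hk lc)+
  have "(\<integral>x. indicator (cball 0 R) x * \<bar>h x - c n x\<bar> \<partial>lborel)
     \<le> (\<integral>x. indicator (cball 0 R) x * \<bar>h x - hk k x\<bar> + indicator (cball 0 R) x * \<bar>hk k x - c n x\<bar> \<partial>lborel)"
    by (intro Bochner_Integration.integral_mono Bochner_Integration.integrable_add i) (auto simp: indicator_def)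
  also have "\<dots> < \<delta>" using k n i by simp
  finally show ?thesis by (intro that[of "c n" "real k"] cc) (auto simp: c_def)
qed

lemma locint_translate:
  fixes z :: "'a::euclidean_space"
  assumes h: "locint h" shows "locint (\<lambda>x. h (x + z))"
proof (rule locintI)
  note [measurable] = locint_measurable[OF h]
  show "(\<lambda>x. h (x + z)) \<in> borel_measurable borel" by measurable
  fix S
  have "bdsupp (\<lambda>x. indicator (cball 0 S) (x - z) :: real)"
  proof (rule bdsuppI[of _ 1 "S + norm z"])
    fix x :: 'a assume "norm x > S + norm z"
    then show "indicator (cball 0 S) (x - z) = 0" using norm_triangle_ineq2[of x z] by (auto simp: indicator_def)
  qed (auto simp: indicator_def)
  from locint_bdsupp_integrable[OF h this]
  show "integrable lborel (\<lambda>x. indicator (cball 0 S) x * h (x + z))"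
    using lborel_integrable_translate[of "\<lambda>x. h x * indicator (cball 0 S) (x - z)" z] by (simp add: mult.commute)
qed

lemma L1_translation_continuous:
  fixes h :: "'a::euclidean_space \<Rightarrow> real"
  assumes h: "locint h" and a: "a \<longlonglongrightarrow> 0"
  shows "(\<lambda>n. \<integral>x. indicator (cball 0 R) x * \<bar>h (x + a n) - h x\<bar> \<partial>lborel) \<longlonglongrightarrow> 0"
proof (rule LIMSEQ_I)
  fix r :: real assume r: "r > 0"
  note [measurable] = locint_measurable[OF h]
  \<comment> \<open>The approximation is made on the radius \<open>R + 1\<close>, so that it also
    controls shifts of norm below 1.\<close>
  obtain c B where c: "continuous_on UNIV c" and B: "\<And>x. \<bar>c x\<bar> \<le> B"
    and hc: "(\<integral>x. indicator (cball 0 (R + 1)) x * \<bar>h x - c x\<bar> \<partial>lborel) < r / 3"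
    using locint_continuous_approx[OF h, of "r / 3" "R + 1"] r by (metis divide_pos_pos zero_less_numeral)
  have [measurable]: "c \<in> borel_measurable borel" using c by (rule borel_measurable_continuous_onI)
  have lc: "locint c" by (rule locint_bound[OF locint_const[of B]]) (auto simp: B)
  have lct: "locint (\<lambda>x. c (x + z))" for z by (rule locint_bound[OF locint_const[of B]]) (auto simp: B)
  note lht = locint_translate[OF h]
  have "(\<lambda>n. \<integral>x. indicator (cball 0 R) x * \<bar>c (x + a n) - c x\<bar> \<partial>lborel) \<longlonglongrightarrow> integral\<^sup>L lborel (\<lambda>x::'a. 0::real)"
  proof (rule integral_dominated_convergence[where w = "\<lambda>x. indicator (cball 0 R) x * (2 * B)"])
    show "integrable lborel (\<lambda>x::'a. indicator (cball 0 R) x * (2 * B))"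
      using locint_const[of "2 * B"] unfolding locint_def by blast
    show "AE x in lborel. (\<lambda>n. indicator (cball 0 R) x * \<bar>c (x + a n) - c x\<bar>) \<longlonglongrightarrow> 0"
    proof (rule AE_I2)
      fix x
      have "isCont c x" using c by (simp add: continuous_on_eq_continuous_at)
      moreover have "(\<lambda>n. x + a n) \<longlonglongrightarrow> x" using tendsto_add[OF tendsto_const[of x] a] by simp
      ultimately have "(\<lambda>n. c (x + a n)) \<longlonglongrightarrow> c x" using isCont_tendsto_compose by blast
      then have "(\<lambda>n. c (x + a n) - c x) \<longlonglongrightarrow> 0" by (rule LIM_zero)
      then show "(\<lambda>n. indicator (cball 0 R) x * \<bar>c (x + a n) - c x\<bar>) \<longlonglongrightarrow> 0"
        by (intro tendsto_mult_right_zero tendsto_rabs_zero)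
    qed
    show "AE x in lborel. norm (indicator (cball 0 R) x * \<bar>c (x + a n) - c x\<bar>) \<le> indicator (cball 0 R) x * (2 * B)" for n
    proof (rule AE_I2)
      fix x show "norm (indicator (cball 0 R) x * \<bar>c (x + a n) - c x\<bar>) \<le> indicator (cball 0 R) x * (2 * B)"
        using B[of x] B[of "x + a n"] by (auto simp: indicator_def)
    qed
    show "(\<lambda>x. indicator (cball 0 R) x * \<bar>c (x + a n) - c x\<bar>) \<in> borel_measurable lborel" for n by measurable
  qed simp
  then have "\<forall>\<^sub>F n in sequentially. (\<integral>x. indicator (cball 0 R) x * \<bar>c (x + a n) - c x\<bar> \<partial>lborel) < r / 3"
    by (rule order_tendstoD) (use r in auto)
  moreover have "\<forall>\<^sub>F n in sequentially. norm (a n) < 1"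
    using tendsto_norm_zero[OF a] by (rule order_tendstoD) simp
  ultimately have "\<forall>\<^sub>F n in sequentially. norm ((\<integral>x. indicator (cball 0 R) x * \<bar>h (x + a n) - h x\<bar> \<partial>lborel) - 0) < r"
  proof eventually_elim
    case (elim n)
    have i: "integrable lborel (\<lambda>x. indicator (cball 0 R) x * \<bar>h (x + a n) - h x\<bar>)"
      "integrable lborel (\<lambda>x. indicator (cball 0 R) x * \<bar>h (x + a n) - c (x + a n)\<bar>)"
      "integrable lborel (\<lambda>x. indicator (cball 0 R) x * \<bar>c (x + a n) - c x\<bar>)"
      "integrable lborel (\<lambda>x. indicator (cball 0 R) x * \<bar>h x - c x\<bar>)"
      "integrable lborel (\<lambda>x. indicator (cball 0 (R + 1)) x * \<bar>h x - c x\<bar>)"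
      by (intro locint_integral_abs_mono locint_diff h lc lct lht)+
    have 1: "(\<integral>x. indicator (cball 0 R) x * \<bar>h x - c x\<bar> \<partial>lborel) < r / 3"
      by (rule le_less_trans[OF _ hc]) (intro Bochner_Integration.integral_mono i, auto simp: indicator_def)
    have iz: "integrable lborel (\<lambda>x. indicator (cball 0 R) (x - a n) * \<bar>h x - c x\<bar>)"
      using lborel_integrable_translate[of "\<lambda>x. indicator (cball 0 R) (x - a n) * \<bar>h x - c x\<bar>" "a n"] i(2) by simp
    have "(\<integral>x. indicator (cball 0 R) x * \<bar>h (x + a n) - c (x + a n)\<bar> \<partial>lborel)
        = (\<integral>x. indicator (cball 0 R) (x - a n) * \<bar>h x - c x\<bar> \<partial>lborel)"
      using lborel_integral_translate[of "\<lambda>x. indicator (cball 0 R) (x - a n) * \<bar>h x - c x\<bar>" "a n"] by simp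
    also have "\<dots> \<le> (\<integral>x. indicator (cball 0 (R + 1)) x * \<bar>h x - c x\<bar> \<partial>lborel)"
    proof (intro Bochner_Integration.integral_mono i iz)
      fix x
      have "norm (x - a n) \<le> R \<Longrightarrow> norm x \<le> R + 1" using elim(2) norm_triangle_ineq2[of x "a n"] by linarith
      then show "indicator (cball 0 R) (x - a n) * \<bar>h x - c x\<bar> \<le> indicator (cball 0 (R + 1)) x * \<bar>h x - c x\<bar>"
        by (auto simp: indicator_def)
    qed
    finally have 2: "(\<integral>x. indicator (cball 0 R) x * \<bar>h (x + a n) - c (x + a n)\<bar> \<partial>lborel) < r / 3" using hc by simp
    have "(\<integral>x. indicator (cball 0 R) x * \<bar>h (x + a n) - h x\<bar> \<partial>lborel) \<le>
       (\<integral>x. indicator (cball 0 R) x * \<bar>h (x + a n) - c (x + a n)\<bar> + indicator (cball 0 R) x * \<bar>c (x + a n) - c x\<bar>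
         + indicator (cball 0 R) x * \<bar>h x - c x\<bar> \<partial>lborel)"
      by (intro Bochner_Integration.integral_mono Bochner_Integration.integrable_add i) (auto simp: indicator_def)
    also have "\<dots> < r" using 1 2 elim(1) i by simp
    finally have "(\<integral>x. indicator (cball 0 R) x * \<bar>h (x + a n) - h x\<bar> \<partial>lborel) < r" .
    moreover have "(\<integral>x. indicator (cball 0 R) x * \<bar>h (x + a n) - h x\<bar> \<partial>lborel) \<ge> 0"
      by (rule Bochner_Integration.integral_nonneg) auto
    ultimately show ?case by simp
  qed
  then show "\<exists>no. \<forall>n\<ge>no. norm ((\<integral>x. indicator (cball 0 R) x * \<bar>h (x + a n) - h x\<bar> \<partial>lborel) - 0) < r"
    by (simp add: eventually_sequentially)
qed

lemma weak_translation_continuous: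
  assumes h: "locint h" and \<psi>: "bdsupp \<psi>" and a: "a \<longlonglongrightarrow> 0"
  shows "(\<lambda>n. \<integral>x. h (x + a n) * \<psi> x \<partial>lborel) \<longlonglongrightarrow> (\<integral>x. h x * \<psi> x \<partial>lborel)"
proof -
  note [measurable] = locint_measurable[OF h] bdsupp_measurable[OF \<psi>]
  obtain B R where B: "B > 0" "\<And>x. \<bar>\<psi> x\<bar> \<le> B" "\<And>x. norm x > R \<Longrightarrow> \<psi> x = 0"
    using bdsuppE[OF \<psi>] by metis
  have bd: "norm ((\<integral>x. h (x + a n) * \<psi> x \<partial>lborel) - (\<integral>x. h x * \<psi> x \<partial>lborel))
     \<le> B * (\<integral>x. indicator (cball 0 R) x * \<bar>h (x + a n) - h x\<bar> \<partial>lborel)" for n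
  proof -
    note i = locint_bdsupp_integrable[OF locint_translate[OF h] \<psi>] locint_bdsupp_integrable[OF h \<psi>]
    have "norm (\<integral>x. h (x + a n) * \<psi> x - h x * \<psi> x \<partial>lborel)
        \<le> (\<integral>x. B * (indicator (cball 0 R) x * \<bar>h (x + a n) - h x\<bar>) \<partial>lborel)"
    proof (rule Bochner_Integration.integral_norm_bound_integral)
      show "integrable lborel (\<lambda>x. B * (indicator (cball 0 R) x * \<bar>h (x + a n) - h x\<bar>))"
        by (intro integrable_mult_right locint_integral_abs_mono locint_diff locint_translate h)
      fix x
      have "h (x + a n) * \<psi> x - h x * \<psi> x = \<psi> x * (h (x + a n) - h x)" by (simp add: algebra_simps)
      then show "norm (h (x + a n) * \<psi> x - h x * \<psi> x) \<le> B * (indicator (cball 0 R) x * \<bar>h (x + a n) - h x\<bar>)"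
        using B(2)[of x] B(3)[of x] by (cases "norm x > R") (auto simp: abs_mult not_less intro!: mult_right_mono)
    qed (use i in auto)
    then show ?thesis using i by simp
  qed
  have "(\<lambda>n. B * (\<integral>x. indicator (cball 0 R) x * \<bar>h (x + a n) - h x\<bar> \<partial>lborel)) \<longlonglongrightarrow> 0"
    by (intro tendsto_mult_right_zero L1_translation_continuous h a)
  then have "(\<lambda>n. (\<integral>x. h (x + a n) * \<psi> x \<partial>lborel) - (\<integral>x. h x * \<psi> x \<partial>lborel)) \<longlonglongrightarrow> 0"
    by (rule Lim_null_comparison[rotated]) (use bd in auto)
  then show ?thesis by (rule LIM_zero_cancel)
qed

text \<open>For fixed \<open>y\<close> the pairing is continuous under translation, and for shifts
  of norm at most 1 it is bounded by the mass of \<open>h\<close> on a fixed ball. The total mass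
  remains as a factor because the kernels to which this is applied are not normalized.\<close>

lemma (in kernel) avg_tendsto:
  assumes h: "locint h" and \<psi>: "bdsupp \<psi>" and e: "e \<longlonglongrightarrow> 0" and e1: "\<And>n. \<bar>e n\<bar> \<le> 1"
  shows "(\<lambda>n. \<integral>x. avg m (e n) h x * \<psi> x \<partial>lborel) \<longlonglongrightarrow> measure m (space m) * (\<integral>x. h x * \<psi> x \<partial>lborel)"
proof -
  note [measurable] = locint_measurable[OF h] bdsupp_measurable[OF \<psi>]
  obtain B R where B: "B > 0" "\<And>x. \<bar>\<psi> x\<bar> \<le> B" "\<And>x. norm x > R \<Longrightarrow> \<psi> x = 0"
    using bdsuppE[OF \<psi>] by metis
  define C where "C = (\<integral>x. B * (indicator (cball 0 (R + 1)) x * \<bar>h x\<bar>) \<partial>lborel)"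
  have bd: "\<bar>\<integral>x. h (x + z) * \<psi> x \<partial>lborel\<bar> \<le> C" if z: "norm z \<le> 1" for z
  proof -
    have "\<bar>\<integral>x. h (x + z) * \<psi> x \<partial>lborel\<bar> \<le> (\<integral>x. \<bar>h (x + z) * \<psi> x\<bar> \<partial>lborel)" by (rule integral_abs_bound)
    also have "\<dots> = (\<integral>x. \<bar>h x * \<psi> (x - z)\<bar> \<partial>lborel)"
      using lborel_integral_translate[of "\<lambda>x. \<bar>h x * \<psi> (x - z)\<bar>" z] by simp
    also have "\<dots> \<le> C" unfolding C_def
    proof (rule Bochner_Integration.integral_mono)
      have "integrable lborel (\<lambda>x. h x * \<psi> (x - z))"
        using lborel_integrable_translate[of "\<lambda>x. h x * \<psi> (x - z)" z]
          locint_bdsupp_integrable[OF locint_translate[OF h] \<psi>, of z] by simp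
      then show "integrable lborel (\<lambda>x. \<bar>h x * \<psi> (x - z)\<bar>)" by (rule integrable_abs)
      show "integrable lborel (\<lambda>x. B * (indicator (cball 0 (R + 1)) x * \<bar>h x\<bar>))"
        by (intro integrable_mult_right locint_integral_abs_mono h)
      fix x
      have "norm x > R + 1 \<Longrightarrow> \<psi> (x - z) = 0" using norm_triangle_ineq2[of x z] z by (intro B) linarith
      then show "\<bar>h x * \<psi> (x - z)\<bar> \<le> B * (indicator (cball 0 (R + 1)) x * \<bar>h x\<bar>)"
        using B(2)[of "x - z"]
        by (cases "norm x > R + 1") (auto simp: abs_mult mult.commute[of B] not_less intro: mult_left_mono)
    qed
    finally show ?thesis .
  qed
  have "(\<lambda>n. \<integral>y. \<integral>x. h (x + e n *\<^sub>R y) * \<psi> x \<partial>lborel \<partial>m) \<longlonglongrightarrow> (\<integral>y. \<integral>x. h x * \<psi> x \<partial>lborel \<partial>m)"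
  proof (rule integral_dominated_convergence[where w = "\<lambda>_. C"])
    show "AE y in m. (\<lambda>n. \<integral>x. h (x + e n *\<^sub>R y) * \<psi> x \<partial>lborel) \<longlonglongrightarrow> (\<integral>x. h x * \<psi> x \<partial>lborel)"
    proof (rule AE_I2)
      fix y :: 'a
      have "(\<lambda>n. e n *\<^sub>R y) \<longlonglongrightarrow> 0" using tendsto_scaleR[OF e tendsto_const[of y sequentially]] by simp
      then show "(\<lambda>n. \<integral>x. h (x + e n *\<^sub>R y) * \<psi> x \<partial>lborel) \<longlonglongrightarrow> (\<integral>x. h x * \<psi> x \<partial>lborel)"
        by (rule weak_translation_continuous[OF h \<psi>])
    qed
    show "AE y in m. norm (\<integral>x. h (x + e n *\<^sub>R y) * \<psi> x \<partial>lborel) \<le> C" for n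
      using supp
    proof eventually_elim
      case (elim y)
      have "norm (e n *\<^sub>R y) \<le> 1" using mult_mono[OF e1[of n] elim] by simp
      then show ?case using bd by simp
    qed
  qed measurable
  then show ?thesis by (simp add: avg_pairing[OF h \<psi>])
qed

subsection \<open>A distribution nonnegative on test functions is nonnegative\<close>

text \<open>The dilation brings the support of \<open>bump\<close>, which lies in the ball of radius
  \<open>CARD('n)\<close>, into the unit ball required by \<open>kernel\<close>.\<close>

definition unit_bump :: "real^'n::finite \<Rightarrow> real" where
  "unit_bump x = bump (real CARD('n) *\<^sub>R x)"

definition bump_measure :: "(real^'n::finite) measure" where
  "bump_measure = density lborel (\<lambda>x. ennreal (unit_bump x))"

lemma test_fun_unit_bump: "test_fun (unit_bump :: real^'n::finite \<Rightarrow> real)"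
  using test_fun_affine[OF test_fun_bump, of "real CARD('n)" 0] by (simp add: unit_bump_def[abs_def])

lemma unit_bump_nonneg: "0 \<le> unit_bump x"
  by (simp add: unit_bump_def bump_nonneg)

lemma kernel_density:
  fixes \<eta> :: "'a::euclidean_space \<Rightarrow> real"
  assumes \<eta>: "bdsupp \<eta>" and nonneg: "\<And>x. 0 \<le> \<eta> x" and supp: "\<And>x. norm x > 1 \<Longrightarrow> \<eta> x = 0"
  shows "kernel (density lborel (\<lambda>x. ennreal (\<eta> x)))"
proof (intro kernel.intro finite_measureI kernel_axioms.intro)
  note [measurable] = bdsupp_measurable[OF \<eta>]
  have i: "integrable lborel \<eta>"
    using locint_bdsupp_integrable[OF locint_const[of 1] \<eta>] by simp
  let ?m = "density lborel (\<lambda>x. ennreal (\<eta> x))"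
  have "emeasure ?m (space ?m) = (\<integral>\<^sup>+ x. ennreal (\<eta> x) \<partial>lborel)"
    by (subst emeasure_density) (auto intro!: nn_integral_cong)
  also have "\<dots> < \<infinity>" using i by (subst nn_integral_eq_integral) (auto simp: nonneg)
  finally show "emeasure ?m (space ?m) \<noteq> \<infinity>" by simp
  show "AE y in ?m. norm y \<le> 1"
    by (subst AE_density) (use supp in \<open>auto simp: not_less[symmetric]\<close>)
qed simp

lemma avg_density:
  fixes \<eta> :: "'a::euclidean_space \<Rightarrow> real"
  assumes [measurable]: "\<eta> \<in> borel_measurable borel" "u \<in> borel_measurable borel" and "\<And>x. 0 \<le> \<eta> x"
  shows "avg (density lborel (\<lambda>x. ennreal (\<eta> x))) e u x = (\<integral>y. \<eta> y * u (x + e *\<^sub>R y) \<partial>lborel)"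
  unfolding avg_def using assms by (subst integral_density) auto

lemma kernel_bump_measure: "kernel (bump_measure :: (real^'n::finite) measure)"
  unfolding bump_measure_def
proof (rule kernel_density)
  fix x :: "real^'n" assume "norm x > 1"
  then have "norm (real CARD('n) *\<^sub>R x) > CARD('n)" by simp
  from bump_vanish[OF this] show "unit_bump x = 0" by (simp add: unit_bump_def)
qed (auto simp: unit_bump_nonneg intro: bdsupp_test test_fun_unit_bump)

lemma measure_bump_measure_pos: "measure (bump_measure :: (real^'n::finite) measure) (space bump_measure) > 0"
proof -
  interpret kernel "bump_measure :: (real^'n) measure" by (rule kernel_bump_measure)
  note t = bdsupp_test[OF test_fun_unit_bump[where 'n = 'n]]
  note [measurable] = bdsupp_measurable[OF t]
  let ?b = "unit_bump :: real^'n \<Rightarrow> real"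
  have "emeasure bump_measure (space (bump_measure :: (real^'n) measure)) \<noteq> 0"
  proof
    assume "emeasure bump_measure (space (bump_measure :: (real^'n) measure)) = 0"
    then have "(\<integral>\<^sup>+ x. ennreal (?b x) \<partial>lborel) = 0"
      unfolding bump_measure_def by (subst (asm) emeasure_density) auto
    then have "AE x in lborel. ennreal (?b x) = 0" by (subst (asm) nn_integral_0_iff_AE) auto
    then have AE0: "AE x in lborel. x \<notin> {x. ?b x > 0}" by eventually_elim (use bump_nonneg in \<open>auto simp: ennreal_eq_0_iff\<close>)
    have "open {x. ?b x > 0}"
      by (intro open_Collect_less continuous_test_fun[OF test_fun_unit_bump] continuous_on_const)
    moreover have "0 \<in> {x. ?b x > 0}" by (simp add: unit_bump_def bump_pos)
    ultimately obtain \<epsilon> where \<epsilon>: "\<epsilon> > 0" "ball 0 \<epsilon> \<subseteq> {x. ?b x > 0}" by (meson openE)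
    have "AE x in lborel. x \<notin> ball (0::real^'n) \<epsilon>" using AE0 by eventually_elim (use \<epsilon> in auto)
    then have "ball (0::real^'n) \<epsilon> \<in> null_sets lborel" by (subst (asm) AE_iff_null_sets[symmetric]) auto
    then have "negligible (ball (0::real^'n) \<epsilon>)" by (simp add: negligible_iff_null_sets null_sets_completionI)
    then show False using open_not_negligible[of "ball (0::real^'n) \<epsilon>"] \<epsilon>(1) by auto
  qed
  then show ?thesis by (simp add: zero_less_measure_iff measure_eq_emeasure_eq_ennreal emeasure_eq_measure less_le)
qed

lemma integral_rescale:
  fixes f :: "'a::euclidean_space \<Rightarrow> real"
  assumes [measurable]: "f \<in> borel_measurable borel" and e: "e \<noteq> 0"
  shows "integral\<^sup>L lborel f = \<bar>e\<bar> ^ DIM('a) * (\<integral>y. f (x + e *\<^sub>R y) \<partial>lborel)"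
proof -
  have "integral\<^sup>L lborel f = integral\<^sup>L (density (distr lborel borel (\<lambda>y. x + e *\<^sub>R y)) (\<lambda>_. ennreal (\<bar>e\<bar> ^ DIM('a)))) f"
    using lborel_affine[of e x] e by (simp add: ennreal_power)
  also have "\<dots> = \<bar>e\<bar> ^ DIM('a) * (\<integral>y. f (x + e *\<^sub>R y) \<partial>lborel)"
    using e by (subst integral_density) (auto simp: integral_distr)
  finally show ?thesis .
qed

text \<open>Averaging \<open>q\<close> with a rescaled bump is, up to a positive factor, testing
  against a nonnegative test function centred at \<open>x\<close>; hence all averages are
  nonnegative, and so is their weak limit.\<close>

lemma nonneg_of_test_fun:
  fixes q :: "real^'n::finite \<Rightarrow> real"
  assumes q: "locint q" and pos: "\<And>\<psi>. test_fun \<psi> \<Longrightarrow> (\<And>x. 0 \<le> \<psi> x) \<Longrightarrow> 0 \<le> (\<integral>x. q x * \<psi> x \<partial>lborel)"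
  shows "AE x in lborel. 0 \<le> q x"
proof -
  let ?m = "bump_measure :: (real^'n) measure"
  let ?b = "unit_bump :: real^'n \<Rightarrow> real"
  interpret kernel ?m by (rule kernel_bump_measure)
  note t = bdsupp_test[OF test_fun_unit_bump[where 'n = 'n]]
  note [measurable] = bdsupp_measurable[OF t] locint_measurable[OF q]
  have nn: "0 \<le> avg ?m e q x" if e: "e > 0" for e x
  proof -
    define \<psi> where "\<psi> z = ?b ((1 / e) *\<^sub>R z + (- (1 / e) *\<^sub>R x))" for z
    have \<psi>: "test_fun \<psi>" unfolding \<psi>_def by (rule test_fun_affine[OF test_fun_unit_bump]) (use e in simp)
    note [measurable] = bdsupp_measurable[OF bdsupp_test[OF \<psi>]]
    have "avg ?m e q x = (\<integral>y. ?b y * q (x + e *\<^sub>R y) \<partial>lborel)"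
      unfolding bump_measure_def by (rule avg_density) (auto simp: unit_bump_nonneg)
    also have "\<dots> = (\<integral>y. q (x + e *\<^sub>R y) * \<psi> (x + e *\<^sub>R y) \<partial>lborel)"
      using e by (intro Bochner_Integration.integral_cong) (auto simp: \<psi>_def algebra_simps)
    also have "\<bar>e\<bar> ^ DIM(real^'n) * \<dots> = (\<integral>y. q y * \<psi> y \<partial>lborel)"
      by (rule integral_rescale[symmetric]) (use e in auto)
    also have "\<dots> \<ge> 0" by (rule pos[OF \<psi>]) (simp add: \<psi>_def unit_bump_nonneg)
    finally have "\<bar>e\<bar> ^ DIM(real^'n) * 0 \<le> \<bar>e\<bar> ^ DIM(real^'n) * avg ?m e q x" by simp
    moreover have "\<bar>e\<bar> ^ DIM(real^'n) > 0" using e by simp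
    ultimately show ?thesis by (rule mult_left_le_imp_le)
  qed
  have "AE x in lborel. 0 \<le> q x \<or> norm x > real R" for R :: nat
  proof -
    \<comment> \<open>Pairing the limit with the indicator of the negativity set gives a value that
      is both \<ge> 0 and \<le> 0.\<close>
    define \<psi> where "\<psi> x = indicator {x. q x < 0} x * (indicator (cball 0 (real R)) x :: real)" for x :: "real^'n"
    have \<psi>: "bdsupp \<psi>" unfolding \<psi>_def
      by (rule bdsupp_mult_bounded[OF bdsupp_indicator, where C = 1]) (auto simp: indicator_def)
    define e where "e n = inverse (real (Suc n))" for n
    have "(\<lambda>n. \<integral>x. avg ?m (e n) q x * \<psi> x \<partial>lborel) \<longlonglongrightarrow> measure ?m (space ?m) * (\<integral>x. q x * \<psi> x \<partial>lborel)"
      unfolding e_def by (intro avg_tendsto[OF q \<psi>] LIMSEQ_inverse_real_of_nat) (auto simp: field_simps)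
    moreover have "0 \<le> (\<integral>x. avg ?m (e n) q x * \<psi> x \<partial>lborel)" for n
      by (intro Bochner_Integration.integral_nonneg mult_nonneg_nonneg nn) (auto simp: e_def \<psi>_def)
    ultimately have "0 \<le> measure ?m (space ?m) * (\<integral>x. q x * \<psi> x \<partial>lborel)"
      using LIMSEQ_le_const by fastforce
    then have "0 \<le> (\<integral>x. q x * \<psi> x \<partial>lborel)" using measure_bump_measure_pos[where 'n = 'n] by (simp add: zero_le_mult_iff)
    moreover have neg: "AE x in lborel. 0 \<le> - (q x * \<psi> x)" by (auto simp: \<psi>_def indicator_def)
    moreover have "(\<integral>x. - (q x * \<psi> x) \<partial>lborel) \<ge> 0" by (rule integral_nonneg_AE[OF neg])
    ultimately have "(\<integral>x. - (q x * \<psi> x) \<partial>lborel) = 0" by simp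
    moreover have "integrable lborel (\<lambda>x. - (q x * \<psi> x))" using locint_bdsupp_integrable[OF q \<psi>] by simp
    ultimately have "AE x in lborel. - (q x * \<psi> x) = 0" using neg by (subst (asm) integral_nonneg_eq_0_iff_AE) auto
    then show ?thesis by eventually_elim (auto simp: \<psi>_def indicator_def split: if_splits)
  qed
  then have "AE x in lborel. \<forall>R::nat. 0 \<le> q x \<or> norm x > real R" by (simp only: AE_all_countable) auto
  then show ?thesis
  proof eventually_elim
    case (elim x)
    obtain R :: nat where "norm x \<le> R" using real_arch_simple by blast
    then show ?case using elim by (meson not_le)
  qed
qed

section \<open>Mean value kernels\<close>

lemma integral_norm_bound_AE:
  fixes f :: "'a \<Rightarrow> real"
  assumes "integrable M f" "integrable M g" "AE x in M. norm (f x) \<le> g x"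
  shows "norm (integral\<^sup>L M f) \<le> integral\<^sup>L M g"
  by (rule order_trans[OF integral_norm_bound integral_mono_AE]) (use assms in auto)

text \<open>Taylor expansion at x + e y with increment (s - e) y. As \<bar>y\<bar> \<le> 1 almost
  everywhere, the remainder is quadratic in s - e uniformly in \<open>y\<close>.\<close>

lemma avg_scale_derivative:
  fixes m :: "(real^'n::finite) measure"
  assumes "kernel m" and \<phi>: "test_fun \<phi>"
  shows "((\<lambda>e. avg m e \<phi> x) has_real_derivative (\<integral>y. (\<Sum>i\<in>UNIV. y $ i * pd i \<phi> (x + e *\<^sub>R y)) \<partial>m)) (at e)"
proof -
  interpret kernel m by fact
  obtain C where C: "C > 0" "\<And>x h. \<bar>\<phi> (x + h) - \<phi> x - (\<Sum>i\<in>UNIV. h $ i * pd i \<phi> x)\<bar> \<le> C * (norm h)\<^sup>2"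
    using test_fun_taylor[OF \<phi>] by metis
  define K where "K = C * measure m (space m)"
  define D where "D y = (\<Sum>i\<in>UNIV. y $ i * pd i \<phi> (x + e *\<^sub>R y))" for y
  note int = integrable_bdsupp[OF bdsupp_test[OF \<phi>]]
  have intd: "integrable m (\<lambda>y. y $ i * pd i \<phi> (x + e *\<^sub>R y))" for i
  proof -
    note t = bdsupp_test[OF test_fun_pd[OF \<phi>, of i]]
    note [measurable] = bdsupp_measurable[OF t]
    obtain B where B: "B > 0" "\<And>x. \<bar>pd i \<phi> x\<bar> \<le> B" using bdsuppE[OF t] by metis
    show ?thesis
    proof (rule integrable_const_bound[where B = B])
      show "AE y in m. norm (y $ i * pd i \<phi> (x + e *\<^sub>R y)) \<le> B" using supp
      proof eventually_elim
        case (elim y)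
        have "\<bar>y $ i\<bar> * \<bar>pd i \<phi> (x + e *\<^sub>R y)\<bar> \<le> 1 * B"
          by (intro mult_mono B order_trans[OF component_le_norm_cart elim]) auto
        then show ?case by (simp add: abs_mult)
      qed
    qed measurable
  qed
  have intD: "integrable m D" unfolding D_def using intd by auto
  have "((\<lambda>e. avg m e \<phi> x) has_derivative (\<lambda>h. h * integral\<^sup>L m D)) (at e)"
  proof (rule has_derivativeI_sandwich[of 1 _ _ _ _ "\<lambda>s. K * \<bar>s - e\<bar>"])
    show "bounded_linear (\<lambda>h. h * integral\<^sup>L m D)" by (rule bounded_linear_mult_left)
    have "((\<lambda>s. s - e) \<longlongrightarrow> 0) (at e)" by (simp add: LIM_zero)
    then show "((\<lambda>s. K * \<bar>s - e\<bar>) \<longlongrightarrow> 0) (at e)"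
      by (intro tendsto_mult_right_zero tendsto_rabs_zero)
    fix s assume "s \<noteq> e"
    have "avg m s \<phi> x - avg m e \<phi> x - (s - e) * integral\<^sup>L m D
      = (\<integral>y. \<phi> (x + s *\<^sub>R y) - \<phi> (x + e *\<^sub>R y) - (s - e) * D y \<partial>m)"
      using int[of x e] int[of x s] intD by (simp add: avg_def)
    also have "norm \<dots> \<le> (\<integral>y. C * (s - e)\<^sup>2 \<partial>m)"
    proof (rule integral_norm_bound_AE)
      show "AE y in m. norm (\<phi> (x + s *\<^sub>R y) - \<phi> (x + e *\<^sub>R y) - (s - e) * D y) \<le> C * (s - e)\<^sup>2"
        using supp
      proof eventually_elim
        case (elim y)
        have eq: "x + e *\<^sub>R y + (s - e) *\<^sub>R y = x + s *\<^sub>R y" by (simp add: algebra_simps)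
        have "norm ((s - e) *\<^sub>R y) \<le> \<bar>s - e\<bar>" using elim by (simp add: mult_left_le)
        then have n: "(norm ((s - e) *\<^sub>R y))\<^sup>2 \<le> (s - e)\<^sup>2" by (metis abs_norm_cancel abs_le_square_iff abs_abs)
        have "(\<Sum>i\<in>UNIV. ((s - e) *\<^sub>R y) $ i * pd i \<phi> (x + e *\<^sub>R y)) = (s - e) * D y"
          by (simp add: D_def sum_distrib_left mult_ac)
        with C(2)[of "x + e *\<^sub>R y" "(s - e) *\<^sub>R y"] eq
        have "\<bar>\<phi> (x + s *\<^sub>R y) - \<phi> (x + e *\<^sub>R y) - (s - e) * D y\<bar> \<le> C * (norm ((s - e) *\<^sub>R y))\<^sup>2" by simp
        also have "\<dots> \<le> C * (s - e)\<^sup>2" by (rule mult_left_mono[OF n]) (use C in simp)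
        finally show ?case by simp
      qed
    qed (use int[of x e] int[of x s] intD in auto)
    also have "\<dots> = K * (s - e)\<^sup>2" by (simp add: K_def)
    finally show "norm (avg m s \<phi> x - avg m e \<phi> x - (s - e) * integral\<^sup>L m D) / norm (s - e) \<le> K * \<bar>s - e\<bar>"
      using \<open>s \<noteq> e\<close> by (simp add: field_simps power2_eq_square)
  qed simp
  then have "((\<lambda>e. avg m e \<phi> x) has_real_derivative integral\<^sup>L m D) (at e)"
    by (rule has_derivative_imp_has_field_derivative) simp
  then show ?thesis by (simp add: D_def[abs_def])
qed

subsection \<open>The basic radial kernel\<close>

definition bowl :: "real^'n::finite \<Rightarrow> real" where "bowl y = max 0 (1 - y \<bullet> y)"

definition bowl_mass :: "'n::finite itself \<Rightarrow> real" where
  "bowl_mass _ = (\<integral>y. 4 * bowl (y::real^'n) \<partial>lborel)"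

text \<open>The densities are chosen such that \<open>\<partial>\<^sub>i theta = - y\<^sub>i * eta\<close>.\<close>
definition eta :: "real^'n::finite \<Rightarrow> real" where "eta y = 4 * bowl y / bowl_mass TYPE('n)"
definition theta :: "real^'n::finite \<Rightarrow> real" where "theta y = (bowl y)\<^sup>2 / bowl_mass TYPE('n)"

lemma bowl_bounds: "0 \<le> bowl y" "bowl y \<le> 1" "norm y > 1 \<Longrightarrow> bowl y = 0"
proof -
  show "norm y > 1 \<Longrightarrow> bowl y = 0"
    using power_mono[of 1 "norm y" 2] by (simp add: bowl_def dot_square_norm)
qed (auto simp: bowl_def)

lemma continuous_bowl: "continuous_on A bowl"
  unfolding bowl_def[abs_def] by (intro continuous_intros)

lemma bdsupp_bowl: "bdsupp (bowl :: real^'n::finite \<Rightarrow> real)"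
  by (rule bdsuppI[of _ 1 1]) (auto simp: bowl_bounds abs_of_nonneg intro: borel_measurable_continuous_onI continuous_bowl)

lemma bowl_mass_pos: "bowl_mass (TYPE('n::finite)) > 0"
proof -
  note [measurable] = bdsupp_measurable[OF bdsupp_bowl[where 'n = 'n]]
  have int: "integrable lborel (\<lambda>y::real^'n. 4 * bowl y)"
    using locint_bdsupp_integrable[OF locint_const[of 4] bdsupp_bowl] by simp
  have "bowl_mass TYPE('n) \<ge> 0" unfolding bowl_mass_def
    by (rule Bochner_Integration.integral_nonneg) (simp add: bowl_bounds)
  moreover have "bowl_mass TYPE('n) \<noteq> 0"
  proof
    assume "bowl_mass TYPE('n) = 0"
    then have "AE y in lborel. 4 * bowl (y::real^'n) = 0"
      unfolding bowl_mass_def using int by (subst (asm) integral_nonneg_eq_0_iff_AE) (auto simp: bowl_bounds)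
    then have "AE y in lborel. y \<notin> ball (0::real^'n) 1"
    proof eventually_elim
      case (elim y)
      show ?case
      proof
        assume "y \<in> ball 0 1"
        then have "(norm y)\<^sup>2 < 1" by (simp add: abs_square_less_1)
        with elim show False by (simp add: bowl_def dot_square_norm max_def split: if_splits)
      qed
    qed
    then have "ball (0::real^'n) 1 \<in> null_sets lborel" by (subst (asm) AE_iff_null_sets[symmetric]) auto
    then have "negligible (ball (0::real^'n) 1)" by (simp add: negligible_iff_null_sets null_sets_completionI)
    then show False using open_not_negligible[of "ball (0::real^'n) 1"] by auto
  qed
  ultimately show ?thesis by simp
qed

lemma eta_nonneg: "0 \<le> eta y" and theta_nonneg: "0 \<le> theta y"
  using bowl_mass_pos[where 'n = 'a] by (auto simp: eta_def theta_def bowl_bounds)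

text \<open>Because \<open>bowl\<close> is at most 1, its square is at most itself; the 4 is the
  normalizing factor in \<open>eta\<close>. This is half of the origin of the constant 8
  below.\<close>

lemma theta_le_eta: "4 * theta y \<le> eta y"
  using bowl_mass_pos[where 'n = 'a] bowl_bounds[of y]
  by (auto simp: eta_def theta_def power2_eq_square mult_left_le intro!: divide_right_mono)

lemma bdsupp_eta: "bdsupp (eta :: real^'n::finite \<Rightarrow> real)"
  using bdsupp_mult_bounded[OF bdsupp_bowl[where 'n = 'n], of "\<lambda>_. 4 / bowl_mass TYPE('n)" "\<bar>4 / bowl_mass TYPE('n)\<bar>"]
  by (simp add: eta_def[abs_def])

lemma bdsupp_theta: "bdsupp (theta :: real^'n::finite \<Rightarrow> real)"
proof -
  note [measurable] = bdsupp_measurable[OF bdsupp_bowl[where 'n = 'n]]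
  have "bdsupp (\<lambda>y::real^'n. (bowl y / bowl_mass TYPE('n)) * bowl y)"
    by (rule bdsupp_mult_bounded[OF bdsupp_bowl, where C = "1 / bowl_mass TYPE('n)"])
      (use bowl_mass_pos[where 'n = 'n] in \<open>auto simp: divide_right_mono bowl_bounds abs_of_nonneg\<close>)
  then show ?thesis by (simp add: theta_def[abs_def] power2_eq_square)
qed

lemma integral_eta: "(\<integral>y. eta (y::real^'n::finite) \<partial>lborel) = 1"
  using bowl_mass_pos[where 'n = 'n] by (simp add: eta_def bowl_mass_def)

definition eta_measure :: "(real^'n::finite) measure" where "eta_measure = density lborel (\<lambda>y. ennreal (eta y))"
definition theta_measure :: "(real^'n::finite) measure" where "theta_measure = density lborel (\<lambda>y. ennreal (theta y))"

lemma kernel_eta: "kernel eta_measure" and kernel_theta: "kernel theta_measure"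
  unfolding eta_measure_def theta_measure_def
  by (auto intro!: kernel_density simp: bdsupp_eta eta_nonneg bdsupp_theta theta_nonneg)
    (auto simp: eta_def theta_def bowl_bounds)

lemma avg_eta: "u \<in> borel_measurable borel \<Longrightarrow> avg eta_measure e u x = (\<integral>y. eta y * u (x + e *\<^sub>R y) \<partial>lborel)"
  and avg_theta: "u \<in> borel_measurable borel \<Longrightarrow> avg theta_measure e u x = (\<integral>y. theta y * u (x + e *\<^sub>R y) \<partial>lborel)"
  unfolding eta_measure_def theta_measure_def
  by (auto intro!: avg_density simp: bdsupp_measurable[OF bdsupp_eta] bdsupp_measurable[OF bdsupp_theta] eta_nonneg theta_nonneg)

lemma avg_eta_0: "u \<in> borel_measurable borel \<Longrightarrow> avg eta_measure 0 u x = u x"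
  by (simp add: avg_eta integral_eta)

text \<open>\<open>bowl\<close> has a kink on the unit sphere, but the square of a positive part is
  once differentiable everywhere, also at the kink, and one derivative is all that the integration
  by parts requires.\<close>

lemma theta_derivative:
  "((\<lambda>t. theta (y + t *\<^sub>R axis i 1)) has_real_derivative - (y $ i) * eta y) (at 0)"
proof -
  have pos2: "((\<lambda>s::real. (max 0 s)\<^sup>2) has_real_derivative 2 * max 0 s) (at s)" for s
  proof -
    consider "s > 0" | "s < 0" | "s = 0" by linarith
    then show ?thesis
    proof cases
      case 1
      have "\<forall>\<^sub>F t in nhds s. (max 0 t)\<^sup>2 = t\<^sup>2"
        using eventually_nhds_in_open[of "{0<..}" s] 1 by (auto elim!: eventually_mono)
      moreover have "((\<lambda>s. s\<^sup>2) has_real_derivative 2 * max 0 s) (at s)" using 1 by (auto intro!: derivative_eq_intros)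
      ultimately show ?thesis using DERIV_cong_ev[of s s "\<lambda>t. (max 0 t)\<^sup>2" "\<lambda>t. t\<^sup>2"] by blast
    next
      case 2
      have "\<forall>\<^sub>F t in nhds s. (max 0 t)\<^sup>2 = 0"
        using eventually_nhds_in_open[of "{..<0}" s] 2 by (auto elim!: eventually_mono)
      moreover have "((\<lambda>s. 0) has_real_derivative 2 * max 0 s) (at s)" using 2 by auto
      ultimately show ?thesis using DERIV_cong_ev[of s s "\<lambda>t. (max 0 t)\<^sup>2" "\<lambda>t. 0"] by blast
    next
      case 3
      have "((\<lambda>h::real. (max 0 h)\<^sup>2 / h) \<longlongrightarrow> 0) (at 0)"
      proof (rule Lim_null_comparison)
        show "\<forall>\<^sub>F h in at 0. norm ((max 0 h)\<^sup>2 / h) \<le> \<bar>h\<bar>" for h :: real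
          by (auto simp: eventually_at_filter max_def power2_eq_square)
        show "((\<lambda>h. \<bar>h\<bar>) \<longlongrightarrow> 0) (at (0::real))" by (intro tendsto_rabs_zero tendsto_ident_at)
      qed
      then show ?thesis using 3 by (simp add: DERIV_def)
    qed
  qed
  have "((\<lambda>t. 1 - (y + t *\<^sub>R axis i 1) \<bullet> (y + t *\<^sub>R axis i 1)) has_real_derivative - (2 * y $ i)) (at 0)"
  proof -
    have "(\<lambda>t. 1 - (y + t *\<^sub>R axis i 1) \<bullet> (y + t *\<^sub>R axis i 1)) = (\<lambda>t. 1 - (y \<bullet> y + 2 * t * y $ i + t * t))"
      by (rule ext) (simp add: inner_left_distrib inner_right_distrib inner_axis inner_axis' algebra_simps)
    then show ?thesis by (auto intro!: derivative_eq_intros)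
  qed
  from DERIV_chain2[OF pos2 this, THEN DERIV_cdivide, of "bowl_mass TYPE('a)"]
  show ?thesis by (simp add: theta_def bowl_def eta_def field_simps)
qed

text \<open>The derivative in the scale is the integral of eta(y) y \<bullet> grad \<phi>(x + e y).
  As y_i eta = - \<partial>_i theta, integrating by parts puts a second derivative on \<phi>; the
  chain rule contributes the factor \<open>e\<close>.\<close>

lemma eta_scale_derivative:
  fixes \<phi> :: "real^'n::finite \<Rightarrow> real"
  assumes \<phi>: "test_fun \<phi>"
  shows "((\<lambda>e. avg eta_measure e \<phi> x) has_real_derivative e * avg theta_measure e (laplacian \<phi>) x) (at e)"
proof -
  note [measurable] = bdsupp_measurable[OF bdsupp_eta[where 'n = 'n]] bdsupp_measurable[OF bdsupp_theta[where 'n = 'n]]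
  have [measurable]: "pd i \<phi> \<in> borel_measurable borel" for i
    by (intro bdsupp_measurable bdsupp_test test_fun_pd \<phi>)
  have [measurable]: "pd i (pd i \<phi>) \<in> borel_measurable borel" for i
    by (intro bdsupp_measurable bdsupp_test test_fun_pd \<phi>)
  have parts: "integrable lborel (\<lambda>y. eta y * (y $ i * pd i \<phi> (x + e *\<^sub>R y)))"
    "integrable lborel (\<lambda>y. theta y * pd i (pd i \<phi>) (x + e *\<^sub>R y))"
    "(\<integral>y. eta y * (y $ i * pd i \<phi> (x + e *\<^sub>R y)) \<partial>lborel) = e * (\<integral>y. theta y * pd i (pd i \<phi>) (x + e *\<^sub>R y) \<partial>lborel)" for i
  proof -
    obtain B where B: "B > 0" "\<And>x. \<bar>pd i \<phi> x\<bar> \<le> B" using test_fun_bounded[OF test_fun_pd[OF \<phi>]] by metis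
    obtain B' where B': "B' > 0" "\<And>x. \<bar>pd i (pd i \<phi>) x\<bar> \<le> B'" using test_fun_bounded[OF test_fun_pd[OF test_fun_pd[OF \<phi>]]] by metis
    have bF: "bdsupp (\<lambda>y. pd i \<phi> (x + e *\<^sub>R y) * theta y)"
      by (rule bdsupp_mult_bounded[OF bdsupp_theta _ B(2)]) measurable
    have b1: "bdsupp (\<lambda>y. pd i (pd i \<phi>) (x + e *\<^sub>R y) * theta y)"
      by (rule bdsupp_mult_bounded[OF bdsupp_theta _ B'(2)]) measurable
    obtain E R where E: "E > 0" "\<And>y. \<bar>eta (y::real^'n)\<bar> \<le> E" using bdsuppE[OF bdsupp_eta] by metis
    have bdy: "bdsupp (\<lambda>y::real^'n. y $ i * eta y)"
    proof (rule bdsuppI[of _ E 1])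
      show "(\<lambda>y::real^'n. y $ i * eta y) \<in> borel_measurable borel" by measurable
      fix y :: "real^'n"
      show "\<bar>y $ i * eta y\<bar> \<le> E"
      proof (cases "norm y > 1")
        case True then show ?thesis using E by (simp add: eta_def bowl_bounds)
      next
        case False
        then have "\<bar>y $ i\<bar> * \<bar>eta y\<bar> \<le> 1 * E"
          by (intro mult_mono E order_trans[OF component_le_norm_cart]) auto
        then show ?thesis by (simp add: abs_mult)
      qed
    qed (auto simp: eta_def bowl_bounds)
    have b2: "bdsupp (\<lambda>y. pd i \<phi> (x + e *\<^sub>R y) * (y $ i * eta y))"
      by (rule bdsupp_mult_bounded[OF bdy _ B(2)]) measurable
    have b1': "bdsupp (\<lambda>y. e * (pd i (pd i \<phi>) (x + e *\<^sub>R y) * theta y))"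
      by (rule bdsupp_mult_bounded[OF b1, of "\<lambda>_. e" "\<bar>e\<bar>"]) auto
    note int = locint_bdsupp_integrable[OF locint_const[of 1]]
    show i1: "integrable lborel (\<lambda>y. eta y * (y $ i * pd i \<phi> (x + e *\<^sub>R y)))"
      using int[OF b2] by (simp add: mult_ac)
    show i2: "integrable lborel (\<lambda>y. theta y * pd i (pd i \<phi>) (x + e *\<^sub>R y))"
      using int[OF b1] by (simp add: mult_ac)
    \<comment> \<open>The integrand is the i-th partial derivative in \<open>y\<close> of
      \<partial>_i \<phi>(x + e y) theta(y), so its integral vanishes.\<close>
    have "(\<integral>y. e * (pd i (pd i \<phi>) (x + e *\<^sub>R y) * theta y) - pd i \<phi> (x + e *\<^sub>R y) * (y $ i * eta y) \<partial>lborel) = 0"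
    proof (rule integral_directional_derivative_zero[OF bF bdsupp_diff[OF b1' b2], of "axis i 1"])
      fix y :: "real^'n"
      have "pd i \<phi> differentiable at (x + e *\<^sub>R y + (e * 0) *\<^sub>R axis i 1)"
        using test_fun_pd[OF \<phi>, of i] by (simp add: test_fun_def smooth_imp_differentiable)
      then have "((\<lambda>t. pd i \<phi> (x + e *\<^sub>R y + t *\<^sub>R axis i 1)) has_real_derivative pd i (pd i \<phi>) (x + e *\<^sub>R y)) (at (e * 0))"
        using has_real_derivative_pd_axis[of "pd i \<phi>" "x + e *\<^sub>R y" "e * 0" i] by simp
      from DERIV_chain2[of "\<lambda>t. pd i \<phi> (x + e *\<^sub>R y + t *\<^sub>R axis i 1)" _ "\<lambda>t. e * t" 0 e UNIV, OF this]
      have "((\<lambda>t. pd i \<phi> (x + e *\<^sub>R y + (e * t) *\<^sub>R axis i 1)) has_real_derivative pd i (pd i \<phi>) (x + e *\<^sub>R y) * e) (at 0)"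
        by (auto intro!: derivative_eq_intros)
      then have "((\<lambda>t. pd i \<phi> (x + e *\<^sub>R (y + t *\<^sub>R axis i 1))) has_real_derivative pd i (pd i \<phi>) (x + e *\<^sub>R y) * e) (at 0)"
        by (simp add: algebra_simps)
      from DERIV_mult[OF this theta_derivative[of y i]]
      show "((\<lambda>t. pd i \<phi> (x + e *\<^sub>R (y + t *\<^sub>R axis i 1)) * theta (y + t *\<^sub>R axis i 1)) has_real_derivative
          e * (pd i (pd i \<phi>) (x + e *\<^sub>R y) * theta y) - pd i \<phi> (x + e *\<^sub>R y) * (y $ i * eta y)) (at 0)"
        by (simp add: algebra_simps)
    qed
    then show "(\<integral>y. eta y * (y $ i * pd i \<phi> (x + e *\<^sub>R y)) \<partial>lborel) = e * (\<integral>y. theta y * pd i (pd i \<phi>) (x + e *\<^sub>R y) \<partial>lborel)"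
      using i1 i2 by (simp add: mult_ac)
  qed
  have "(\<integral>y. (\<Sum>i\<in>UNIV. y $ i * pd i \<phi> (x + e *\<^sub>R y)) \<partial>eta_measure)
     = (\<integral>y. (\<Sum>i\<in>UNIV. eta y * (y $ i * pd i \<phi> (x + e *\<^sub>R y))) \<partial>lborel)"
    unfolding eta_measure_def by (subst integral_density) (auto simp: eta_nonneg sum_distrib_left)
  also have "\<dots> = (\<Sum>i\<in>UNIV. e * (\<integral>y. theta y * pd i (pd i \<phi>) (x + e *\<^sub>R y) \<partial>lborel))"
    using parts by simp
  also have "\<dots> = e * (\<integral>y. (\<Sum>i\<in>UNIV. theta y * pd i (pd i \<phi>) (x + e *\<^sub>R y)) \<partial>lborel)"
    using parts by (simp add: sum_distrib_left)
  also have "\<dots> = e * avg theta_measure e (laplacian \<phi>) x"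
    by (subst avg_theta) (auto simp: laplacian_def sum_distrib_left \<phi> intro!: bdsupp_measurable bdsupp_laplacian)
  finally show ?thesis using avg_scale_derivative[OF kernel_eta \<phi>, of x e] by simp
qed

subsection \<open>Averaging a kernel over scales\<close>

text \<open>The image of a product measure under (s, y) to s y: a superposition of the dilates of
  \<open>m\<close> with weight \<open>f\<close> on scales in [0, 1]. As an image measure it inherits
  finiteness and support at once, and no formula for its density is called for.\<close>

definition smear :: "(real \<Rightarrow> real) \<Rightarrow> 'a::euclidean_space measure \<Rightarrow> 'a measure" where
  "smear f m = distr (density lborel (\<lambda>s. ennreal (indicator {0..1} s * f s)) \<Otimes>\<^sub>M m) borel (\<lambda>(s, y). s *\<^sub>R y)"

locale smearing = kernel m for m :: "'a::euclidean_space measure" +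
  fixes f :: "real \<Rightarrow> real" and B :: real
  assumes f_measurable [measurable]: "f \<in> borel_measurable borel"
    and f_bounds: "\<And>s. s \<in> {0..1} \<Longrightarrow> 0 \<le> f s \<and> f s \<le> B"
begin

abbreviation "A \<equiv> density lborel (\<lambda>s. ennreal (indicator {0..1} s * f s))"

lemma f_nonneg: "0 \<le> indicator {0..1} s * f s"
  using f_bounds[of s] by (auto simp: indicator_def)

lemma finite_A: "finite_measure A"
proof (rule finite_measureI)
  have "emeasure A (space A) = (\<integral>\<^sup>+ s. ennreal (indicator {0..1} s * f s) \<partial>lborel)"
    by (subst emeasure_density) (auto intro!: nn_integral_cong)
  also have "\<dots> \<le> (\<integral>\<^sup>+ s. ennreal B * indicator {0..1::real} s \<partial>lborel)"
    by (intro nn_integral_mono) (use f_bounds in \<open>auto simp: indicator_def intro!: ennreal_leI\<close>)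
  also have "\<dots> < \<infinity>" by (subst nn_integral_cmult_indicator) (auto simp: ennreal_mult_less_top)
  finally show "emeasure A (space A) \<noteq> \<infinity>" by simp
qed

sublocale A: finite_measure A by (rule finite_A)
sublocale AP: pair_sigma_finite A m ..

lemma kernel_smear: "kernel (smear f m)"
proof (intro kernel.intro finite_measureI kernel_axioms.intro)
  have "emeasure (smear f m) (space (smear f m)) = emeasure (A \<Otimes>\<^sub>M m) (space (A \<Otimes>\<^sub>M m))"
    unfolding smear_def by (subst emeasure_distr) (auto intro!: arg_cong2[where f = emeasure])
  also have "\<dots> = emeasure A (space A) * emeasure m (space m)"
    unfolding space_pair_measure by (rule emeasure_pair_measure_Times) auto
  also have "\<dots> < \<infinity>"
    using A.emeasure_finite[of UNIV] emeasure_finite[of "space m"]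
    by (simp add: ennreal_mult_eq_top_iff less_top[symmetric])
  finally show "emeasure (smear f m) (space (smear f m)) \<noteq> \<infinity>" by simp
  have "AE s in A. s \<in> {0..1}"
    by (subst AE_density) (auto simp: indicator_def)
  then have "AE s in A. AE y in m. norm (s *\<^sub>R y) \<le> 1"
  proof eventually_elim
    case (elim s)
    show ?case using supp
    proof eventually_elim
      case (elim y) with \<open>s \<in> {0..1}\<close> show ?case using mult_mono[of "\<bar>s\<bar>" 1 "norm y" 1] by auto
    qed
  qed
  then have "AE p in A \<Otimes>\<^sub>M m. norm (fst p *\<^sub>R snd p) \<le> 1"
  proof (intro AP.AE_pair_measure)
    have "(\<lambda>p. norm (fst p *\<^sub>R snd p)) \<in> borel_measurable (A \<Otimes>\<^sub>M m)" by measurable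
    then show "{p \<in> space (A \<Otimes>\<^sub>M m). norm (fst p *\<^sub>R snd p) \<le> 1} \<in> sets (A \<Otimes>\<^sub>M m)"
      by (rule borel_measurable_le) simp
  qed simp
  then show "AE y in smear f m. norm y \<le> 1"
    unfolding smear_def by (subst AE_distr_iff) (auto simp: case_prod_beta')
qed (simp add: smear_def)

lemma avg_smear:
  assumes \<psi>: "bdsupp \<psi>"
  shows "avg (smear f m) e \<psi> x = (\<integral>s. indicator {0..1} s *\<^sub>R (f s * avg m (e * s) \<psi> x) \<partial>lborel)"
proof -
  note [measurable] = bdsupp_measurable[OF \<psi>]
  obtain C where C: "\<And>x. \<bar>\<psi> x\<bar> \<le> C" using bdsuppE[OF \<psi>] by metis
  interpret APf: finite_measure "A \<Otimes>\<^sub>M m"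
    by (intro finite_measure_pair_measure finite_measure_axioms A.finite_measure_axioms)
  have int: "integrable (A \<Otimes>\<^sub>M m) (\<lambda>(s, y). \<psi> (x + e *\<^sub>R s *\<^sub>R y))"
    by (rule APf.integrable_const_bound[where B = C]) (auto simp: C)
  have "avg (smear f m) e \<psi> x = (\<integral>(s, y). \<psi> (x + e *\<^sub>R s *\<^sub>R y) \<partial>(A \<Otimes>\<^sub>M m))"
    unfolding avg_def smear_def by (subst integral_distr) (auto simp: case_prod_beta')
  also have "\<dots> = (\<integral>s. \<integral>y. \<psi> (x + e *\<^sub>R s *\<^sub>R y) \<partial>m \<partial>A)"
    using AP.integral_fst'[OF int] by simp
  also have "\<dots> = (\<integral>s. (indicator {0..1} s * f s) *\<^sub>R (\<integral>y. \<psi> (x + e *\<^sub>R s *\<^sub>R y) \<partial>m) \<partial>lborel)"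
    by (rule integral_density) (use f_nonneg in auto)
  finally show ?thesis by (simp add: avg_def mult.assoc)
qed

text \<open>The version for nonnegative functions allows kernels to be compared as measures, before
  any integrability is known.\<close>

lemma nn_integral_smear:
  assumes [measurable]: "F \<in> borel_measurable borel"
  shows "(\<integral>\<^sup>+ z. F z \<partial>smear f m) = (\<integral>\<^sup>+ s. ennreal (indicator {0..1} s * f s) * (\<integral>\<^sup>+ y. F (s *\<^sub>R y) \<partial>m) \<partial>lborel)"
proof -
  have "(\<integral>\<^sup>+ z. F z \<partial>smear f m) = (\<integral>\<^sup>+ p. F (fst p *\<^sub>R snd p) \<partial>(A \<Otimes>\<^sub>M m))"
    unfolding smear_def by (subst nn_integral_distr) (auto simp: case_prod_beta')
  also have "\<dots> = (\<integral>\<^sup>+ s. \<integral>\<^sup>+ y. F (s *\<^sub>R y) \<partial>m \<partial>A)"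
    by (subst nn_integral_fst[symmetric]) auto
  also have "\<dots> = (\<integral>\<^sup>+ s. ennreal (indicator {0..1} s * f s) * (\<integral>\<^sup>+ y. F (s *\<^sub>R y) \<partial>m) \<partial>lborel)"
    by (subst nn_integral_density) auto
  finally show ?thesis .
qed

end

subsection \<open>Mean value identities\<close>

text \<open>Stated pointwise for test functions; duality through \<open>avg_adjoint\<close>
  transfers it to locally integrable functions.\<close>

definition mvpair :: "(real^'n::finite) measure \<Rightarrow> (real^'n) measure \<Rightarrow> bool" where
  "mvpair m k \<longleftrightarrow> kernel m \<and> kernel k \<and>
    (\<forall>\<phi> x e. test_fun \<phi> \<longrightarrow> avg m e \<phi> x - \<phi> x = e\<^sup>2 * avg k e (laplacian \<phi>) x)"

text \<open>The pair \<open>(eta_measure, ball_k)\<close> has a mean with bounded density, as needed for local bounds; averaging over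
  scales gives the pair \<open>(sm_m, sm_k)\<close>, whose mean is singular at the origin but dominates \<open>8 sm_k\<close>.\<close>
definition ball_k :: "(real^'n::finite) measure" where "ball_k = smear (\<lambda>s. s) theta_measure"
definition sm_m :: "(real^'n::finite) measure" where "sm_m = smear (\<lambda>s. 2 * s) eta_measure"
definition sm_k :: "(real^'n::finite) measure" where "sm_k = smear (\<lambda>s. s * (1 - s\<^sup>2)) theta_measure"

lemma smearing_ball_k: "smearing (theta_measure :: (real^'n::finite) measure) (\<lambda>s. s) 1"
  by (intro smearing.intro smearing_axioms.intro kernel_theta) auto

lemma smearing_sm_m: "smearing (eta_measure :: (real^'n::finite) measure) (\<lambda>s. 2 * s) 2"
  by (intro smearing.intro smearing_axioms.intro kernel_eta) auto

lemma smearing_sm_k: "smearing (theta_measure :: (real^'n::finite) measure) (\<lambda>s. s * (1 - s\<^sup>2)) 1"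
  by (intro smearing.intro smearing_axioms.intro kernel_theta)
    (auto simp: mult_le_one power_le_one)

lemmas kernel_ball_k = smearing.kernel_smear[OF smearing_ball_k, folded ball_k_def]
lemmas kernel_sm_m = smearing.kernel_smear[OF smearing_sm_m, folded sm_m_def]
lemmas kernel_sm_k = smearing.kernel_smear[OF smearing_sm_k, folded sm_k_def]

lemma continuous_avg_scale:
  fixes m :: "(real^'n::finite) measure"
  assumes "kernel m" "test_fun \<phi>"
  shows "continuous_on A (\<lambda>s. avg m (e * s) \<phi> x)"
proof -
  have "continuous_on UNIV (\<lambda>s. avg m s \<phi> x)"
    by (intro continuous_at_imp_continuous_on ballI DERIV_isCont) (use avg_scale_derivative[OF assms] in blast)
  then show ?thesis
    by (rule continuous_on_compose2[of _ _ _ "\<lambda>s. e * s"]) (auto intro!: continuous_intros)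
qed

lemma eta_scale_derivative':
  assumes \<phi>: "test_fun \<phi>"
  shows "((\<lambda>s. avg eta_measure (e * s) \<phi> x) has_real_derivative
      e\<^sup>2 * (s * avg theta_measure (e * s) (laplacian \<phi>) x)) (at s)"
proof -
  have "((\<lambda>s. e * s) has_real_derivative e) (at s)" by (auto intro!: derivative_eq_intros)
  from DERIV_chain2[OF eta_scale_derivative[OF \<phi>] this]
  show ?thesis by (simp add: power2_eq_square mult_ac)
qed

text \<open>The fundamental theorem of calculus in the scale variable: at scale 0 the average is
  \<phi>(x) itself, because \<open>eta\<close> has integral 1.\<close>

lemma mvpair_ball: "mvpair eta_measure (ball_k :: (real^'n::finite) measure)"
  unfolding mvpair_def
proof (intro conjI kernel_eta kernel_ball_k allI impI)
  fix \<phi> :: "real^'n \<Rightarrow> real" and x e assume \<phi>: "test_fun \<phi>"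
  let ?T = "\<lambda>s. avg theta_measure (e * s) (laplacian \<phi>) x"
  have "(\<integral>s. indicator {0..1} s *\<^sub>R (e\<^sup>2 * (s * ?T s)) \<partial>lborel) = avg eta_measure (e * 1) \<phi> x - avg eta_measure (e * 0) \<phi> x"
  proof (rule integral_FTC_Icc)
    show "continuous_on {0..1} (\<lambda>s. e\<^sup>2 * (s * ?T s))"
      by (intro continuous_intros continuous_avg_scale kernel_theta test_fun_laplacian \<phi>)
  qed (use eta_scale_derivative'[OF \<phi>] in \<open>auto simp: has_real_derivative_iff_has_vector_derivative[symmetric] intro: DERIV_subset\<close>)
  moreover have "(\<integral>s. indicator {0..1} s *\<^sub>R (e\<^sup>2 * (s * ?T s)) \<partial>lborel) = e\<^sup>2 * avg ball_k e (laplacian \<phi>) x"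
    unfolding ball_k_def smearing.avg_smear[OF smearing_ball_k bdsupp_laplacian[OF \<phi>]]
    by (subst integral_mult_right_zero[symmetric]) (simp add: mult_ac)
  ultimately show "avg eta_measure e \<phi> x - \<phi> x = e\<^sup>2 * avg ball_k e (laplacian \<phi>) x"
    using bdsupp_measurable[OF bdsupp_test[OF \<phi>]] by (simp add: avg_eta_0)
qed

text \<open>Integrate the derivative of (s^2 - 1) E(s) over [0, 1], where E(s) is the eta-average at
  scale e s. The factor vanishes at s = 1 and equals -1 at s = 0, so the boundary terms leave
  \<phi>(x); differentiating the factor gives the weight 2 s of \<open>sm_m\<close>, differentiating
  E gives the weight s (1 - s^2) of \<open>sm_k\<close>.\<close>

lemma mvpair_sm: "mvpair sm_m (sm_k :: (real^'n::finite) measure)"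
  unfolding mvpair_def
proof (intro conjI kernel_sm_m kernel_sm_k allI impI)
  fix \<phi> :: "real^'n \<Rightarrow> real" and x e assume \<phi>: "test_fun \<phi>"
  let ?T = "\<lambda>s. avg theta_measure (e * s) (laplacian \<phi>) x"
  let ?E = "\<lambda>s. avg eta_measure (e * s) \<phi> x"
  define a where "a s = 2 * s * ?E s" for s
  define b where "b s = e\<^sup>2 * (s * (1 - s\<^sup>2) * ?T s)" for s
  have ca: "continuous_on {0..1} a" unfolding a_def
    by (intro continuous_intros continuous_avg_scale kernel_eta \<phi>)
  have cb: "continuous_on {0..1} b" unfolding b_def
    by (intro continuous_intros continuous_avg_scale kernel_theta test_fun_laplacian \<phi>)
  have "(\<integral>s. indicator {0..1} s *\<^sub>R (a s - b s) \<partial>lborel) = (1\<^sup>2 - 1) * ?E 1 - (0\<^sup>2 - 1) * ?E 0"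
  proof (rule integral_FTC_Icc)
    show "continuous_on {0..1} (\<lambda>s. a s - b s)" by (intro continuous_intros ca cb)
    fix s :: real
    have "((\<lambda>s. s\<^sup>2 - 1) has_real_derivative 2 * s) (at s)" by (auto intro!: derivative_eq_intros)
    from DERIV_mult[OF this eta_scale_derivative'[OF \<phi>]]
    have "((\<lambda>s. (s\<^sup>2 - 1) * ?E s) has_real_derivative a s - b s) (at s)"
      by (rule back_subst[where P = "\<lambda>d. (_ has_real_derivative d) _"]) (simp add: a_def b_def algebra_simps)
    then show "((\<lambda>s. (s\<^sup>2 - 1) * ?E s) has_vector_derivative a s - b s) (at s within {0..1})"
      by (auto simp: has_real_derivative_iff_has_vector_derivative[symmetric] intro: DERIV_subset)
  qed simp
  also have "\<dots> = \<phi> x" using bdsupp_measurable[OF bdsupp_test[OF \<phi>]] by (simp add: avg_eta_0)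
  finally have 1: "(\<integral>s. indicator {0..1} s *\<^sub>R (a s - b s) \<partial>lborel) = \<phi> x" .
  have ia: "integrable lborel (\<lambda>s. indicator {0..1} s *\<^sub>R a s)" and ib: "integrable lborel (\<lambda>s. indicator {0..1} s *\<^sub>R b s)"
    using borel_integrable_compact[OF compact_Icc ca] borel_integrable_compact[OF compact_Icc cb]
    by (auto simp: indicator_scaleR_eq_if)
  have "(\<integral>s. indicator {0..1} s *\<^sub>R a s \<partial>lborel) = avg sm_m e \<phi> x"
    unfolding sm_m_def smearing.avg_smear[OF smearing_sm_m bdsupp_test[OF \<phi>]] a_def by (simp add: mult_ac)
  moreover have "(\<integral>s. indicator {0..1} s *\<^sub>R b s \<partial>lborel) = e\<^sup>2 * avg sm_k e (laplacian \<phi>) x"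
    unfolding sm_k_def smearing.avg_smear[OF smearing_sm_k bdsupp_laplacian[OF \<phi>]] b_def
    by (subst integral_mult_right_zero[symmetric]) (simp add: mult_ac)
  moreover have "(\<integral>s. indicator {0..1} s *\<^sub>R (a s - b s) \<partial>lborel)
      = (\<integral>s. indicator {0..1} s *\<^sub>R a s \<partial>lborel) - (\<integral>s. indicator {0..1} s *\<^sub>R b s \<partial>lborel)"
    unfolding scaleR_diff_right by (rule Bochner_Integration.integral_diff[OF ia ib])
  ultimately show "avg sm_m e \<phi> x - \<phi> x = e\<^sup>2 * avg sm_k e (laplacian \<phi>) x" using 1 by simp
qed

text \<open>This comparison makes the fixed point map below monotone for Lipschitz nonlinearities.\<close>
lemma sm_k_le_sm_m_at:
  fixes v :: "real^'n::finite \<Rightarrow> real"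
  assumes v [measurable]: "v \<in> borel_measurable borel"
    and elim: "AE y in sm_m. 0 \<le> v (x + e *\<^sub>R y)" "AE y in sm_k. 0 \<le> v (x + e *\<^sub>R y)"
      "integrable sm_m (\<lambda>y. v (x + e *\<^sub>R y))" "integrable sm_k (\<lambda>y. v (x + e *\<^sub>R y))"
  shows "8 * avg sm_k e v x \<le> avg sm_m e v x"
proof -
  note [measurable] = bdsupp_measurable[OF bdsupp_eta[where 'n = 'n]]
    bdsupp_measurable[OF bdsupp_theta[where 'n = 'n]]
  interpret m: kernel "sm_m :: (real^'n) measure" by (rule kernel_sm_m)
  interpret k: kernel "sm_k :: (real^'n) measure" by (rule kernel_sm_k)
  have nn: "8 * (\<integral>\<^sup>+ z. F z \<partial>sm_k) \<le> (\<integral>\<^sup>+ z. F z \<partial>sm_m)" if F[measurable]: "F \<in> borel_measurable borel"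
    for F :: "real^'n \<Rightarrow> ennreal"
  proof -
    have te: "4 * (\<integral>\<^sup>+ y. F (s *\<^sub>R y) \<partial>theta_measure) \<le> (\<integral>\<^sup>+ y. F (s *\<^sub>R y) \<partial>eta_measure)" for s
    proof -
      have "4 * (\<integral>\<^sup>+ y. F (s *\<^sub>R y) \<partial>theta_measure) = (\<integral>\<^sup>+ y. ennreal (4 * theta y) * F (s *\<^sub>R y) \<partial>lborel)"
        unfolding theta_measure_def
        by (subst nn_integral_density) (auto simp: nn_integral_cmult[symmetric] ennreal_mult theta_nonneg mult.assoc)
      also have "\<dots> \<le> (\<integral>\<^sup>+ y. ennreal (eta y) * F (s *\<^sub>R y) \<partial>lborel)"
        by (intro nn_integral_mono mult_right_mono ennreal_leI theta_le_eta) auto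
      also have "\<dots> = (\<integral>\<^sup>+ y. F (s *\<^sub>R y) \<partial>eta_measure)"
        unfolding eta_measure_def by (subst nn_integral_density) auto
      finally show ?thesis .
    qed
    have [measurable_cong]: "sets (theta_measure :: (real^'n) measure) = sets borel"
      "sets (eta_measure :: (real^'n) measure) = sets borel"
      by (auto simp: theta_measure_def eta_measure_def)
    interpret th: kernel "theta_measure :: (real^'n) measure" by (rule kernel_theta)
    have "8 * (\<integral>\<^sup>+ z. F z \<partial>sm_k)
        = (\<integral>\<^sup>+ s. 8 * (ennreal (indicator {0..1} s * (s * (1 - s\<^sup>2))) * (\<integral>\<^sup>+ y. F (s *\<^sub>R y) \<partial>theta_measure)) \<partial>lborel)"
      unfolding sm_k_def smearing.nn_integral_smear[OF smearing_sm_k F]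
      by (subst nn_integral_cmult) auto
    also have "\<dots> \<le> (\<integral>\<^sup>+ s. ennreal (indicator {0..1} s * (2 * s)) * (\<integral>\<^sup>+ y. F (s *\<^sub>R y) \<partial>eta_measure) \<partial>lborel)"
    proof (rule nn_integral_mono)
      fix s :: real
      define p where "p = indicator {0..1} s * (s * (1 - s\<^sup>2))"
      define q where "q = indicator {0..1} s * (2 * s)"
      \<comment> \<open>The constant 8 is 2 times 4: a factor 2 from s (1 - s^2) \<le> s, and the
        factor 4 of \<open>te\<close>.\<close>
      have p: "0 \<le> p" "2 * p \<le> q"
        by (auto simp: p_def q_def indicator_def power_le_one mult_left_le)
      have "8 * (ennreal p * (\<integral>\<^sup>+ y. F (s *\<^sub>R y) \<partial>theta_measure)) = ennreal (2 * p) * (4 * (\<integral>\<^sup>+ y. F (s *\<^sub>R y) \<partial>theta_measure))"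
      proof -
        have "(8::ennreal) = 2 * 4" by simp
        then show ?thesis using p by (simp add: ennreal_mult mult_ac)
      qed
      also have "\<dots> \<le> ennreal q * (\<integral>\<^sup>+ y. F (s *\<^sub>R y) \<partial>eta_measure)"
        by (intro mult_mono ennreal_leI p te) auto
      finally show "8 * (ennreal (indicator {0..1} s * (s * (1 - s\<^sup>2))) * (\<integral>\<^sup>+ y. F (s *\<^sub>R y) \<partial>theta_measure))
          \<le> ennreal (indicator {0..1} s * (2 * s)) * (\<integral>\<^sup>+ y. F (s *\<^sub>R y) \<partial>eta_measure)"
        by (simp only: p_def q_def)
    qed
    also have "\<dots> = (\<integral>\<^sup>+ z. F z \<partial>sm_m)"
      unfolding sm_m_def smearing.nn_integral_smear[OF smearing_sm_m F] ..
    finally show ?thesis .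
  qed
  have "ennreal (8 * avg sm_k e v x) = 8 * (\<integral>\<^sup>+ y. ennreal (v (x + e *\<^sub>R y)) \<partial>sm_k)"
    using elim by (subst nn_integral_eq_integral) (auto simp: avg_def ennreal_mult integral_nonneg_AE)
  also have "\<dots> \<le> (\<integral>\<^sup>+ y. ennreal (v (x + e *\<^sub>R y)) \<partial>sm_m)" by (rule nn) measurable
  also have "\<dots> = ennreal (avg sm_m e v x)"
    using elim by (subst nn_integral_eq_integral) (auto simp: avg_def)
  finally show ?thesis using elim by (subst (asm) ennreal_le_iff) (auto simp: avg_def intro: integral_nonneg_AE)
qed

lemma sm_k_le_sm_m:
  fixes v :: "real^'n::finite \<Rightarrow> real"
  assumes v: "locint v" and nonneg: "AE x in lborel. 0 \<le> v x"
  shows "AE x in lborel. 8 * avg sm_k e v x \<le> avg sm_m e v x"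
proof -
  interpret m: kernel "sm_m :: (real^'n) measure" by (rule kernel_sm_m)
  interpret k: kernel "sm_k :: (real^'n) measure" by (rule kernel_sm_k)
  show ?thesis
    using m.AE_translate[OF nonneg, of e] k.AE_translate[OF nonneg, of e] m.AE_integrable[OF v, of e] k.AE_integrable[OF v, of e]
    by eventually_elim (rule sm_k_le_sm_m_at[OF locint_measurable[OF v]])
qed

section \<open>Distributional differential inequalities\<close>

text \<open>\<open>wsub z h\<close> means that \<open>- \<Delta> z \<le> h\<close> in the sense of distributions.\<close>
definition wsub :: "(real^'n::finite \<Rightarrow> real) \<Rightarrow> (real^'n \<Rightarrow> real) \<Rightarrow> bool" where
  "wsub z h \<longleftrightarrow> locint z \<and> locint h \<and> (\<forall>\<phi>. test_fun \<phi> \<longrightarrow> (\<forall>x. 0 \<le> \<phi> x) \<longrightarrow>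
     0 \<le> (\<integral>x. z x * laplacian \<phi> x \<partial>lborel) + (\<integral>x. h x * \<phi> x \<partial>lborel))"

lemma wsub_locint: "wsub z h \<Longrightarrow> locint z" "wsub z h \<Longrightarrow> locint h"
  by (auto simp: wsub_def)

lemma wsubD:
  "wsub z h \<Longrightarrow> test_fun \<phi> \<Longrightarrow> (\<And>x. 0 \<le> \<phi> x) \<Longrightarrow>
    0 \<le> (\<integral>x. z x * laplacian \<phi> x \<partial>lborel) + (\<integral>x. h x * \<phi> x \<partial>lborel)"
  by (simp add: wsub_def)

lemma wsub_mono:
  assumes "wsub z h" "locint h'" "AE x in lborel. h x \<le> h' x" shows "wsub z h'"
  unfolding wsub_def
proof (intro conjI allI impI)
  fix \<phi> :: "real^'a \<Rightarrow> real" assume \<phi>: "test_fun \<phi>" and nn: "\<forall>x. 0 \<le> \<phi> x"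
  have "(\<integral>x. h x * \<phi> x \<partial>lborel) \<le> (\<integral>x. h' x * \<phi> x \<partial>lborel)"
    by (intro integral_mono_AE locint_bdsupp_integrable bdsupp_test \<phi> assms wsub_locint(2)[OF assms(1)])
      (use assms(3) in \<open>eventually_elim, use nn in \<open>auto intro: mult_right_mono\<close>\<close>)
  then show "0 \<le> (\<integral>x. z x * laplacian \<phi> x \<partial>lborel) + (\<integral>x. h' x * \<phi> x \<partial>lborel)"
    using wsubD[OF assms(1) \<phi>] nn by fastforce
qed (use assms wsub_locint in auto)

lemma wsub_cong_AE:
  assumes "wsub z h" "locint z'" "AE x in lborel. z x = z' x" shows "wsub z' h"
  unfolding wsub_def
proof (intro conjI allI impI)
  fix \<phi> :: "real^'a \<Rightarrow> real" assume \<phi>: "test_fun \<phi>" and nn: "\<forall>x. 0 \<le> \<phi> x"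
  have "(\<integral>x. z x * laplacian \<phi> x \<partial>lborel) = (\<integral>x. z' x * laplacian \<phi> x \<partial>lborel)"
  proof (rule integral_cong_AE)
    show "AE x in lborel. z x * laplacian \<phi> x = z' x * laplacian \<phi> x" using assms(3) by eventually_elim simp
    have "laplacian \<phi> \<in> borel_measurable borel" by (intro bdsupp_measurable bdsupp_laplacian \<phi>)
    then show "(\<lambda>x. z x * laplacian \<phi> x) \<in> borel_measurable lborel" "(\<lambda>x. z' x * laplacian \<phi> x) \<in> borel_measurable lborel"
      using locint_measurable[OF wsub_locint(1)[OF assms(1)]] locint_measurable[OF assms(2)] by measurable
  qed
  then show "0 \<le> (\<integral>x. z' x * laplacian \<phi> x \<partial>lborel) + (\<integral>x. h x * \<phi> x \<partial>lborel)"
    using wsubD[OF assms(1) \<phi>] nn by simp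
qed (use assms wsub_locint in auto)

lemma wsub_add:
  assumes "wsub z h" "wsub z' h'" shows "wsub (\<lambda>x. z x + z' x) (\<lambda>x. h x + h' x)"
  unfolding wsub_def
proof (intro conjI allI impI locint_add)
  fix \<phi> :: "real^'a \<Rightarrow> real" assume \<phi>: "test_fun \<phi>" and nn: "\<forall>x. 0 \<le> \<phi> x"
  note i = locint_bdsupp_integrable[OF _ bdsupp_laplacian[OF \<phi>]] locint_bdsupp_integrable[OF _ bdsupp_test[OF \<phi>]]
  show "0 \<le> (\<integral>x. (z x + z' x) * laplacian \<phi> x \<partial>lborel) + (\<integral>x. (h x + h' x) * \<phi> x \<partial>lborel)"
    using wsubD[OF assms(1) \<phi>] wsubD[OF assms(2) \<phi>] nn
      i(1)[OF wsub_locint(1)[OF assms(1)]] i(1)[OF wsub_locint(1)[OF assms(2)]]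
      i(2)[OF wsub_locint(2)[OF assms(1)]] i(2)[OF wsub_locint(2)[OF assms(2)]]
    by (simp add: distrib_right)
qed (use assms wsub_locint in auto)

text \<open>With q the quadratic, the integrals of the i-th derivatives of q \<partial>_i \<phi> -
  (\<partial>_i q) \<phi> vanish; the mixed first order terms cancel, which is both integrations by
  parts at once.\<close>

lemma integral_quadratic_laplacian:
  fixes \<phi> :: "real^'n::finite \<Rightarrow> real" and a b :: real
  assumes \<phi>: "test_fun \<phi>"
  shows "(\<integral>x. (a + b * ((x - y) \<bullet> (x - y))) * laplacian \<phi> x \<partial>lborel) = (\<integral>x. (2 * real CARD('n) * b) * \<phi> x \<partial>lborel)"
proof -
  define q where "q x = a + b * ((x - y) \<bullet> (x - y))" for x
  have cq: "continuous_on UNIV q" unfolding q_def[abs_def] by (intro continuous_intros)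
  have cont_bd: "bdsupp (\<lambda>x. p x * \<psi> x)" if p: "continuous_on UNIV p" and \<psi>: "test_fun \<psi>" for p \<psi> :: "real^'n \<Rightarrow> real"
  proof -
    obtain B R where B: "B > 0" "\<And>x. \<bar>\<psi> x\<bar> \<le> B" "\<And>x. norm x > R \<Longrightarrow> \<psi> x = 0"
      using bdsuppE[OF bdsupp_test[OF \<psi>]] by metis
    have "compact (p ` cball 0 R)" by (intro compact_continuous_image continuous_on_subset[OF p]) auto
    then obtain C where C: "\<And>x. x \<in> cball 0 R \<Longrightarrow> norm (p x) \<le> C"
      by (metis bounded_iff compact_imp_bounded imageI)
    have [measurable]: "p \<in> borel_measurable borel" by (rule borel_measurable_continuous_onI[OF p])
    show ?thesis
    proof (rule bdsuppI[of _ "\<bar>C\<bar> * B" R])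
      show "(\<lambda>x. p x * \<psi> x) \<in> borel_measurable borel"
        using bdsupp_measurable[OF bdsupp_test[OF \<psi>]] by measurable
      fix x :: "real^'n"
      show "\<bar>p x * \<psi> x\<bar> \<le> \<bar>C\<bar> * B"
      proof (cases "norm x > R")
        case False
        then show ?thesis unfolding abs_mult using C[of x] B by (intro mult_mono) auto
      qed (use B in auto)
    qed (use B in auto)
  qed
  have i: "integrable lborel (\<lambda>x. q x * pd i (pd i \<phi>) x)" "integrable lborel (\<lambda>x. 2 * b * \<phi> x)"
    and eq: "(\<integral>x. q x * pd i (pd i \<phi>) x \<partial>lborel) = (\<integral>x. 2 * b * \<phi> x \<partial>lborel)" for i
  proof -
    note t = test_fun_pd[OF \<phi>, of i]
    note t2 = test_fun_pd[OF t, of i]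
    have b1: "bdsupp (\<lambda>x. q x * pd i \<phi> x)" by (rule cont_bd[OF cq t])
    have b2: "bdsupp (\<lambda>x. (2 * b * (x - y) $ i) * \<phi> x)" by (rule cont_bd[OF _ \<phi>]) (intro continuous_intros)
    have b3: "bdsupp (\<lambda>x. q x * pd i (pd i \<phi>) x)" by (rule cont_bd[OF cq t2])
    have b4: "bdsupp (\<lambda>x. (2 * b) * \<phi> x)" by (rule cont_bd[OF _ \<phi>]) (intro continuous_intros)
    show i1: "integrable lborel (\<lambda>x. q x * pd i (pd i \<phi>) x)" and i2: "integrable lborel (\<lambda>x. 2 * b * \<phi> x)"
      using locint_bdsupp_integrable[OF locint_const[of 1] b3] locint_bdsupp_integrable[OF locint_const[of 1] b4] by simp_all
    have "(\<integral>x. q x * pd i (pd i \<phi>) x - 2 * b * \<phi> x \<partial>lborel) = 0"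
    proof (rule integral_directional_derivative_zero[OF bdsupp_diff[OF b1 b2] bdsupp_diff[OF b3 b4], of "axis i 1"])
      fix x :: "real^'n"
      have d\<phi>: "((\<lambda>t. \<phi> (x + t *\<^sub>R axis i 1)) has_real_derivative pd i \<phi> x) (at 0)"
        using has_real_derivative_pd_axis[of \<phi> x 0 i] \<phi> by (simp add: test_fun_def smooth_imp_differentiable)
      have dd\<phi>: "((\<lambda>t. pd i \<phi> (x + t *\<^sub>R axis i 1)) has_real_derivative pd i (pd i \<phi>) x) (at 0)"
        using has_real_derivative_pd_axis[of "pd i \<phi>" x 0 i] t by (simp add: test_fun_def smooth_imp_differentiable)
      have qe: "q (x + t *\<^sub>R axis i 1) = q x + b * (2 * t * (x - y) $ i + t * t)" for t
      proof -
        have "x + t *\<^sub>R axis i 1 - y = (x - y) + t *\<^sub>R axis i 1" by simp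
        then show ?thesis unfolding q_def
          by (simp only: inner_left_distrib inner_right_distrib) (simp add: inner_axis inner_axis' algebra_simps)
      qed
      have dq: "((\<lambda>t. q (x + t *\<^sub>R axis i 1)) has_real_derivative 2 * b * (x - y) $ i) (at 0)"
        unfolding qe by (auto intro!: derivative_eq_intros)
      have dl: "((\<lambda>t. 2 * b * (x + t *\<^sub>R axis i 1 - y) $ i) has_real_derivative 2 * b) (at 0)"
        by (auto intro!: derivative_eq_intros simp: algebra_simps)
      show "((\<lambda>t. q (x + t *\<^sub>R axis i 1) * pd i \<phi> (x + t *\<^sub>R axis i 1)
            - 2 * b * (x + t *\<^sub>R axis i 1 - y) $ i * \<phi> (x + t *\<^sub>R axis i 1)) has_real_derivative
          q x * pd i (pd i \<phi>) x - 2 * b * \<phi> x) (at 0)"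
        by (rule back_subst[where P = "\<lambda>d. (_ has_real_derivative d) _", OF DERIV_diff[OF DERIV_mult[OF dq dd\<phi>] DERIV_mult[OF dl d\<phi>]]])
          simp
    qed
    then show "(\<integral>x. q x * pd i (pd i \<phi>) x \<partial>lborel) = (\<integral>x. 2 * b * \<phi> x \<partial>lborel)" using i1 i2 by simp
  qed
  have "(\<integral>x. q x * laplacian \<phi> x \<partial>lborel) = (\<Sum>i\<in>UNIV. \<integral>x. q x * pd i (pd i \<phi>) x \<partial>lborel)"
    unfolding laplacian_def sum_distrib_left using i by (subst Bochner_Integration.integral_sum) auto
  also have "\<dots> = (\<Sum>i\<in>(UNIV::'n set). \<integral>x. 2 * b * \<phi> x \<partial>lborel)" by (simp only: eq)
  also have "\<dots> = (\<integral>x. (2 * real CARD('n) * b) * \<phi> x \<partial>lborel)" by simp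
  finally show ?thesis by (simp add: q_def)
qed

lemma locint_continuous:
  assumes "continuous_on UNIV (u :: 'a::euclidean_space \<Rightarrow> real)" shows "locint u"
proof (rule locintI)
  show "u \<in> borel_measurable borel" by (rule borel_measurable_continuous_onI[OF assms])
  show "integrable lborel (\<lambda>x. indicator (cball 0 R) x * u x)" for R
    using borel_integrable_compact[of "cball 0 R" u] continuous_on_subset[OF assms]
    by (auto simp: indicator_scaleR_eq_if indicator_def if_distrib cong: if_cong)
qed

lemma wsub_quadratic:
  fixes y :: "real^'n::finite" and a b :: real
  shows "wsub (\<lambda>x. a + b * ((x - y) \<bullet> (x - y))) (\<lambda>x. - (2 * real CARD('n) * b))"
  unfolding wsub_def
proof (intro conjI allI impI)
  show "locint (\<lambda>x. a + b * ((x - y) \<bullet> (x - y)))" by (intro locint_continuous continuous_intros)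
  fix \<phi> :: "real^'n \<Rightarrow> real" assume \<phi>: "test_fun \<phi>"
  show "0 \<le> (\<integral>x. (a + b * ((x - y) \<bullet> (x - y))) * laplacian \<phi> x \<partial>lborel) + (\<integral>x. - (2 * real CARD('n) * b) * \<phi> x \<partial>lborel)"
    unfolding integral_quadratic_laplacian[OF \<phi>] by simp
qed (rule locint_const)

lemma wsub_const: "wsub (\<lambda>x. c) (\<lambda>x. 0)"
  using wsub_quadratic[of c 0] by simp

text \<open>Test the weak inequality with the averaged function k_(-e) * \<psi>, again a nonnegative
  test function. The pair identity rewrites e^2 times its Laplacian as m_(-e) * \<psi> - \<psi>, and
  the adjoints carry the averages over to \<open>z\<close> and \<open>h\<close>.\<close>

lemma mean_inequality:
  fixes z :: "real^'n::finite \<Rightarrow> real"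
  assumes mk: "mvpair m k" and z: "wsub z h"
  shows "AE x in lborel. z x \<le> avg m e z x + e\<^sup>2 * avg k e h x"
proof -
  interpret m: kernel m using mk by (simp add: mvpair_def)
  interpret k: kernel k using mk by (simp add: mvpair_def)
  note l = wsub_locint[OF z]
  have "AE x in lborel. 0 \<le> (1 * avg m e z x + e\<^sup>2 * avg k e h x) - z x"
  proof (rule nonneg_of_test_fun)
    show "locint (\<lambda>x. (1 * avg m e z x + e\<^sup>2 * avg k e h x) - z x)"
      by (intro locint_diff locint_lincomb m.locint_avg k.locint_avg l)
    fix \<psi> :: "real^'n \<Rightarrow> real" assume \<psi>: "test_fun \<psi>" and nn: "\<And>x. 0 \<le> \<psi> x"
    note b = bdsupp_test[OF \<psi>] and bl = bdsupp_laplacian[OF \<psi>]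
    note int = locint_bdsupp_integrable
    have t: "test_fun (avg k (-e) \<psi>)" by (rule test_fun_avg[OF k.kernel_axioms \<psi>])
    have "0 \<le> e\<^sup>2 * ((\<integral>x. z x * laplacian (avg k (-e) \<psi>) x \<partial>lborel) + (\<integral>x. h x * avg k (-e) \<psi> x \<partial>lborel))"
      by (intro mult_nonneg_nonneg wsubD[OF z t] k.avg_nonneg nn) auto
    also have "\<dots> = (\<integral>x. z x * (e\<^sup>2 * avg k (-e) (laplacian \<psi>) x) \<partial>lborel) + e\<^sup>2 * (\<integral>x. h x * avg k (-e) \<psi> x \<partial>lborel)"
      by (simp add: laplacian_avg[OF k.kernel_axioms \<psi>] distrib_left integral_mult_right_zero[symmetric] mult_ac
          del: integral_mult_right_zero)
    also have "(\<lambda>x. e\<^sup>2 * avg k (-e) (laplacian \<psi>) x) = (\<lambda>x. avg m (-e) \<psi> x - \<psi> x)"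
      using mk \<psi> by (simp add: mvpair_def)
    also have "(\<integral>x. z x * (avg m (-e) \<psi> x - \<psi> x) \<partial>lborel) = (\<integral>x. z x * avg m (-e) \<psi> x \<partial>lborel) - (\<integral>x. z x * \<psi> x \<partial>lborel)"
      using int[OF l(1) m.avg_bdsupp[OF b]] int[OF l(1) b] by (simp add: right_diff_distrib)
    also have "\<dots> + e\<^sup>2 * (\<integral>x. h x * avg k (-e) \<psi> x \<partial>lborel) =
        (\<integral>x. avg m e z x * \<psi> x \<partial>lborel) - (\<integral>x. z x * \<psi> x \<partial>lborel) + e\<^sup>2 * (\<integral>x. avg k e h x * \<psi> x \<partial>lborel)"
      by (simp add: m.avg_adjoint[OF l(1) b] k.avg_adjoint[OF l(2) b])
    also have "\<dots> = (\<integral>x. ((1 * avg m e z x + e\<^sup>2 * avg k e h x) - z x) * \<psi> x \<partial>lborel)"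
    proof -
      have "(\<integral>x. ((1 * avg m e z x + e\<^sup>2 * avg k e h x) - z x) * \<psi> x \<partial>lborel)
          = (\<integral>x. avg m e z x * \<psi> x + e\<^sup>2 * (avg k e h x * \<psi> x) - z x * \<psi> x \<partial>lborel)"
        by (simp add: algebra_simps)
      then show ?thesis
        using int[OF m.locint_avg[OF l(1)] b, of e] int[OF k.locint_avg[OF l(2)] b, of e] int[OF l(1) b] by simp
    qed
    finally show "0 \<le> (\<integral>x. ((1 * avg m e z x + e\<^sup>2 * avg k e h x) - z x) * \<psi> x \<partial>lborel)" .
  qed
  then show ?thesis by eventually_elim simp
qed

lemma measure_theta_pos: "emeasure (theta_measure :: (real^'n::finite) measure) (space theta_measure) \<noteq> 0"
proof
  note [measurable] = bdsupp_measurable[OF bdsupp_theta[where 'n = 'n]]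
  assume "emeasure (theta_measure :: (real^'n) measure) (space theta_measure) = 0"
  then have "(\<integral>\<^sup>+ x. ennreal (theta (x::real^'n)) \<partial>lborel) = 0"
    unfolding theta_measure_def by (subst (asm) emeasure_density) auto
  then have "AE x in lborel. ennreal (theta (x::real^'n)) = 0" by (subst (asm) nn_integral_0_iff_AE) auto
  then have "AE x in lborel. 4 * bowl (x::real^'n) = 0"
  proof eventually_elim
    case (elim x)
    then have "theta x = 0" using theta_nonneg[of x] by (simp add: ennreal_eq_0_iff)
    then show ?case using bowl_mass_pos[where 'n = 'n] by (simp add: theta_def)
  qed
  then have "bowl_mass TYPE('n) = 0" unfolding bowl_mass_def by (rule integral_eq_zero_AE)
  then show False using bowl_mass_pos[where 'n = 'n] by simp
qed

text \<open>The mass of \<open>k\<close> multiplies every term when the scale tends to 0, and it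
  bounds averages of cutoffs from below; positivity allows division by it.\<close>

lemma (in smearing) measure_smear_pos:
  assumes "emeasure m (space m) \<noteq> 0" and "\<And>s. 0 < s \<Longrightarrow> s < 1 \<Longrightarrow> f s > 0"
  shows "measure (smear f m) (space (smear f m)) > 0"
proof -
  interpret S: kernel "smear f m" by (rule kernel_smear)
  have "(\<integral>\<^sup>+ z. 1 \<partial>smear f m) \<noteq> 0"
  proof
    assume "(\<integral>\<^sup>+ z. 1 \<partial>smear f m) = 0"
    then have "(\<integral>\<^sup>+ s. ennreal (indicator {0..1} s * f s) * emeasure m (space m) \<partial>lborel) = 0"
      by (subst (asm) nn_integral_smear) auto
    then have "AE s in lborel. ennreal (indicator {0..1} s * f s) * emeasure m (space m) = 0"
      by (subst (asm) nn_integral_0_iff_AE) auto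
    then have "AE s in lborel. s \<notin> {0<..<1::real}"
    proof eventually_elim
      case (elim s)
      then have "indicator {0..1} s * f s \<le> 0" using assms(1) by (simp add: ennreal_eq_0_iff)
      then show ?case using assms(2)[of s] by (auto simp: indicator_def)
    qed
    then have "{0<..<1::real} \<in> null_sets lborel" by (subst (asm) AE_iff_null_sets[symmetric]) auto
    then show False by (simp add: null_sets_def)
  qed
  then have "emeasure (smear f m) (space (smear f m)) \<noteq> 0" by simp
  then show ?thesis using S.emeasure_eq_measure[of "space (smear f m)"] by (simp add: zero_less_measure_iff)
qed

lemma measure_ball_k_pos: "measure (ball_k :: (real^'n::finite) measure) (space ball_k) > 0"
  unfolding ball_k_def by (rule smearing.measure_smear_pos[OF smearing_ball_k measure_theta_pos]) auto

lemma measure_sm_k_pos: "measure (sm_k :: (real^'n::finite) measure) (space sm_k) > 0"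
  unfolding sm_k_def
  by (rule smearing.measure_smear_pos[OF smearing_sm_k measure_theta_pos])
    (auto simp: power_less_one_iff intro!: mult_pos_pos)

text \<open>Kato's inequality: the maximum satisfies the mean value inequality with the right-hand side
  frozen at the centre, and the radius tends to zero.\<close>
lemma wsub_max:
  fixes z1 z2 :: "real^'n::finite \<Rightarrow> real"
  assumes w1: "wsub z1 h1" and w2: "wsub z2 h2"
  shows "wsub (\<lambda>x. max (z1 x) (z2 x)) (\<lambda>x. if z1 x > z2 x then h1 x else h2 x)"
proof -
  let ?m = "eta_measure :: (real^'n) measure" and ?k = "ball_k :: (real^'n) measure"
  interpret m: kernel ?m by (rule kernel_eta)
  interpret k: kernel ?k by (rule kernel_ball_k)
  note l = wsub_locint[OF w1] wsub_locint[OF w2]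
  note [measurable] = l[THEN locint_measurable]
  define Z where "Z x = max (z1 x) (z2 x)" for x
  define P where "P = {x. z1 x > z2 x}"
  have [measurable]: "P \<in> sets borel" unfolding P_def by measurable
  have Z: "locint Z" unfolding Z_def by (intro locint_max l)
  have H: "locint (\<lambda>x. if z1 x > z2 x then h1 x else h2 x)" by (intro locint_if l) measurable
  have zZ: "AE x in lborel. z1 x \<le> Z x" "AE x in lborel. z2 x \<le> Z x" by (auto simp: Z_def)
  show ?thesis unfolding wsub_def
  proof (intro conjI allI impI)
    fix \<phi> :: "real^'n \<Rightarrow> real" assume \<phi>: "test_fun \<phi>" and nn: "\<forall>x. 0 \<le> \<phi> x"
    note b = bdsupp_test[OF \<phi>] and bl = bdsupp_laplacian[OF \<phi>]
    have b1: "bdsupp (\<lambda>x. indicator P x * \<phi> x)"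
      by (rule bdsupp_mult_bounded[OF b, where C = 1]) (auto simp: indicator_def)
    have b2: "bdsupp (\<lambda>x. indicator (-P) x * \<phi> x)"
      by (rule bdsupp_mult_bounded[OF b, where C = 1]) (auto simp: indicator_def)
    note int = locint_bdsupp_integrable
    \<comment> \<open>The set \<open>P\<close> is where \<open>z1\<close> realizes the maximum at
      the centre. There the mean of \<open>z1\<close> is only enlarged when replaced by the mean of
      \<open>Z\<close>, while the averaged right-hand side stays \<open>h1\<close>; the same with
      \<open>h2\<close> off \<open>P\<close>.\<close>
    have step: "0 \<le> (\<integral>x. avg ?k e Z x * laplacian \<phi> x \<partial>lborel)
       + ((\<integral>x. avg ?k e h1 x * (indicator P x * \<phi> x) \<partial>lborel) + (\<integral>x. avg ?k e h2 x * (indicator (-P) x * \<phi> x) \<partial>lborel))"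
      if e: "e > 0" for e
    proof -
      define Q where "Q x = avg ?k e h1 x * (indicator P x * \<phi> x) + avg ?k e h2 x * (indicator (-P) x * \<phi> x)" for x
      have iQ: "integrable lborel (\<lambda>x. avg ?k e h1 x * (indicator P x * \<phi> x))" "integrable lborel (\<lambda>x. avg ?k e h2 x * (indicator (-P) x * \<phi> x))"
        by (intro int k.locint_avg l b1 b2)+
      have "AE x in lborel. Z x * \<phi> x \<le> avg ?m e Z x * \<phi> x + e\<^sup>2 * Q x"
        using mean_inequality[OF mvpair_ball w1, of e] mean_inequality[OF mvpair_ball w2, of e]
          m.avg_mono_AE[OF l(1) Z zZ(1), of e] m.avg_mono_AE[OF l(3) Z zZ(2), of e]
      proof eventually_elim
        case (elim x)
        have m1: "avg ?m e z1 x \<le> avg ?m e Z x" and m2: "avg ?m e z2 x \<le> avg ?m e Z x"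
          using elim(3,4) by auto
        show ?case
        proof (cases "x \<in> P")
          case True
          then have "Z x \<le> avg ?m e Z x + e\<^sup>2 * avg ?k e h1 x" using elim(1) m1 by (simp add: Z_def P_def)
          from mult_right_mono[OF this, of "\<phi> x"] True nn show ?thesis by (simp add: Q_def algebra_simps)
        next
          case False
          then have "Z x \<le> avg ?m e Z x + e\<^sup>2 * avg ?k e h2 x" using elim(2) m2 by (simp add: Z_def P_def)
          from mult_right_mono[OF this, of "\<phi> x"] False nn show ?thesis by (simp add: Q_def algebra_simps)
        qed
      qed
      then have "(\<integral>x. Z x * \<phi> x \<partial>lborel) \<le> (\<integral>x. avg ?m e Z x * \<phi> x + e\<^sup>2 * Q x \<partial>lborel)"
        using int[OF Z b] int[OF m.locint_avg[OF Z] b, of e] iQ by (intro integral_mono_AE) (auto simp: Q_def)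
      also have "\<dots> = (\<integral>x. Z x * avg ?m (-e) \<phi> x \<partial>lborel) + e\<^sup>2 * integral\<^sup>L lborel Q"
        using int[OF m.locint_avg[OF Z] b, of e] iQ m.avg_adjoint[OF Z b, of e] by (simp add: Q_def[abs_def])
      \<comment> \<open>After transposition the pair identity is applied to \<phi>: the terms with Z
        \<phi> cancel, and what is left has the common factor e^2.\<close>
      also have "avg ?m (-e) \<phi> = (\<lambda>x. \<phi> x + e\<^sup>2 * avg ?k (-e) (laplacian \<phi>) x)"
      proof
        fix x
        have "avg ?m (-e) \<phi> x - \<phi> x = (-e)\<^sup>2 * avg ?k (-e) (laplacian \<phi>) x"
          using mvpair_ball \<phi> unfolding mvpair_def by blast
        then show "avg ?m (-e) \<phi> x = \<phi> x + e\<^sup>2 * avg ?k (-e) (laplacian \<phi>) x" by simp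
      qed
      also have "(\<integral>x. Z x * (\<phi> x + e\<^sup>2 * avg ?k (-e) (laplacian \<phi>) x) \<partial>lborel)
         = (\<integral>x. Z x * \<phi> x + e\<^sup>2 * (Z x * avg ?k (-e) (laplacian \<phi>) x) \<partial>lborel)" by (simp add: algebra_simps)
      also have "\<dots> = (\<integral>x. Z x * \<phi> x \<partial>lborel) + e\<^sup>2 * (\<integral>x. avg ?k e Z x * laplacian \<phi> x \<partial>lborel)"
        using int[OF Z b] int[OF Z k.avg_bdsupp[OF bl], of "-e"] k.avg_adjoint[OF Z bl, of e] by simp
      finally have "0 \<le> e\<^sup>2 * ((\<integral>x. avg ?k e Z x * laplacian \<phi> x \<partial>lborel) + integral\<^sup>L lborel Q)"
        by (simp add: algebra_simps)
      moreover have "e\<^sup>2 > 0" using e by simp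
      ultimately have "0 \<le> (\<integral>x. avg ?k e Z x * laplacian \<phi> x \<partial>lborel) + integral\<^sup>L lborel Q"
        by (simp add: zero_le_mult_iff)
      then show ?thesis using iQ by (simp add: Q_def[abs_def])
    qed
    define c where "c = measure ?k (space ?k)"
    have c: "c > 0" unfolding c_def by (rule measure_ball_k_pos)
    let ?e = "\<lambda>n. inverse (real (Suc n))"
    have e: "?e \<longlonglongrightarrow> 0" "\<And>n. \<bar>?e n\<bar> \<le> 1" by (rule LIMSEQ_inverse_real_of_nat) (auto simp: field_simps)
    have "0 \<le> c * (\<integral>x. Z x * laplacian \<phi> x \<partial>lborel)
       + (c * (\<integral>x. h1 x * (indicator P x * \<phi> x) \<partial>lborel) + c * (\<integral>x. h2 x * (indicator (-P) x * \<phi> x) \<partial>lborel))"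
    proof (rule LIMSEQ_le_const)
      show "(\<lambda>n. (\<integral>x. avg ?k (?e n) Z x * laplacian \<phi> x \<partial>lborel)
       + ((\<integral>x. avg ?k (?e n) h1 x * (indicator P x * \<phi> x) \<partial>lborel) + (\<integral>x. avg ?k (?e n) h2 x * (indicator (-P) x * \<phi> x) \<partial>lborel)))
       \<longlonglongrightarrow> c * (\<integral>x. Z x * laplacian \<phi> x \<partial>lborel)
       + (c * (\<integral>x. h1 x * (indicator P x * \<phi> x) \<partial>lborel) + c * (\<integral>x. h2 x * (indicator (-P) x * \<phi> x) \<partial>lborel))"
        unfolding c_def by (intro tendsto_add k.avg_tendsto Z l bl b1 b2 e)
      show "\<exists>N. \<forall>n\<ge>N. 0 \<le> (\<integral>x. avg ?k (?e n) Z x * laplacian \<phi> x \<partial>lborel)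
       + ((\<integral>x. avg ?k (?e n) h1 x * (indicator P x * \<phi> x) \<partial>lborel) + (\<integral>x. avg ?k (?e n) h2 x * (indicator (-P) x * \<phi> x) \<partial>lborel))"
        by (intro exI[of _ 0] allI impI step) simp
    qed
    also have "\<dots> = c * ((\<integral>x. Z x * laplacian \<phi> x \<partial>lborel)
       + ((\<integral>x. h1 x * (indicator P x * \<phi> x) \<partial>lborel) + (\<integral>x. h2 x * (indicator (-P) x * \<phi> x) \<partial>lborel)))"
      by (simp add: algebra_simps)
    finally have "0 \<le> (\<integral>x. Z x * laplacian \<phi> x \<partial>lborel)
       + ((\<integral>x. h1 x * (indicator P x * \<phi> x) \<partial>lborel) + (\<integral>x. h2 x * (indicator (-P) x * \<phi> x) \<partial>lborel))"
      using c by (simp add: zero_le_mult_iff)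
    moreover have "(\<integral>x. h1 x * (indicator P x * \<phi> x) \<partial>lborel) + (\<integral>x. h2 x * (indicator (-P) x * \<phi> x) \<partial>lborel)
       = (\<integral>x. (if z1 x > z2 x then h1 x else h2 x) * \<phi> x \<partial>lborel)"
    proof -
      have "(\<integral>x. h1 x * (indicator P x * \<phi> x) \<partial>lborel) + (\<integral>x. h2 x * (indicator (-P) x * \<phi> x) \<partial>lborel)
          = (\<integral>x. h1 x * (indicator P x * \<phi> x) + h2 x * (indicator (-P) x * \<phi> x) \<partial>lborel)"
        using int[OF l(2) b1] int[OF l(4) b2] by simp
      also have "\<dots> = (\<integral>x. (if z1 x > z2 x then h1 x else h2 x) * \<phi> x \<partial>lborel)"
        by (intro Bochner_Integration.integral_cong) (auto simp: P_def)
      finally show ?thesis .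
    qed
    ultimately show "0 \<le> (\<integral>x. max (z1 x) (z2 x) * laplacian \<phi> x \<partial>lborel) +
        (\<integral>x. (if z1 x > z2 x then h1 x else h2 x) * \<phi> x \<partial>lborel)"
      by (simp add: Z_def)
  qed (use Z H in \<open>auto simp: Z_def[abs_def]\<close>)
qed

section \<open>Local maximum principle and Keller--Osserman bounds\<close>

lemma ball_borel [measurable]: "ball (x::'a::euclidean_space) r \<in> sets borel" by simp

text \<open>\<open>eta\<close> is even, so the linear term integrates to zero: averaging a downward
  paraboloid lowers it by the constant e^2 v. This strict loss drives the maximum principle.\<close>

lemma eta_moments:
  fixes a :: "real^'n::finite"
  obtains v where "v > 0"
    "\<And>x e L. avg eta_measure e (\<lambda>x. L - (x - a) \<bullet> (x - a)) x = L - (x - a) \<bullet> (x - a) - e\<^sup>2 * v"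
proof -
  note [measurable] = bdsupp_measurable[OF bdsupp_eta[where 'n = 'n]]
  interpret kernel "eta_measure :: (real^'n) measure" by (rule kernel_eta)
  define v where "v = (\<integral>y. eta y * (y \<bullet> y) \<partial>(lborel :: (real^'n) measure))"
  obtain E where E: "E > 0" "\<And>y. \<bar>eta (y::real^'n)\<bar> \<le> E" using bdsuppE[OF bdsupp_eta] by metis
  have int_eta: "integrable lborel (eta :: real^'n \<Rightarrow> real)"
    using locint_bdsupp_integrable[OF locint_const[of 1] bdsupp_eta] by simp
  have int: "integrable lborel (\<lambda>y. p y * eta y)" if "continuous_on UNIV p" for p :: "real^'n \<Rightarrow> real"
    by (rule locint_bdsupp_integrable[OF locint_continuous[OF that] bdsupp_eta])
  have iv: "integrable lborel (\<lambda>y::real^'n. eta y * (y \<bullet> y))"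
    using int[of "\<lambda>y. y \<bullet> y"] by (simp add: mult.commute continuous_intros)
  have iw: "integrable lborel (\<lambda>y::real^'n. eta y * (w \<bullet> y))" for w
    using int[of "\<lambda>y. w \<bullet> y"] by (simp add: mult.commute continuous_intros)
  have odd: "(\<integral>y. eta y * (w \<bullet> y) \<partial>lborel) = 0" for w :: "real^'n"
  proof -
    have "(\<integral>y. eta y * (w \<bullet> y) \<partial>lborel) = (\<integral>y. eta (- y) * (w \<bullet> (- y)) \<partial>lborel)"
      using integral_rescale[of "\<lambda>y::real^'n. eta y * (w \<bullet> y)" "-1" 0] by simp
    also have "\<dots> = - (\<integral>y. eta y * (w \<bullet> y) \<partial>lborel)" by (simp add: eta_def bowl_def)
    finally show ?thesis by simp
  qed
  have nn: "AE y in lborel. 0 \<le> eta y * (y \<bullet> (y::real^'n))" by (simp add: eta_nonneg)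
  have "v \<noteq> 0"
  proof
    assume "v = 0"
    then have "AE y in lborel. eta y * (y \<bullet> (y::real^'n)) = 0"
      unfolding v_def using iv nn by (subst (asm) integral_nonneg_eq_0_iff_AE) auto
    moreover have "AE y in lborel. y \<noteq> (0::real^'n)" by (rule AE_lborel_singleton)
    ultimately have "AE y in lborel. eta (y::real^'n) = 0" by eventually_elim simp
    then have "(\<integral>y. eta (y::real^'n) \<partial>lborel) = 0" by (rule integral_eq_zero_AE)
    then show False by (simp add: integral_eta)
  qed
  moreover have "v \<ge> 0" unfolding v_def by (rule integral_nonneg_AE[OF nn])
  ultimately have "v > 0" by simp
  moreover have "avg eta_measure e (\<lambda>x. L - (x - a) \<bullet> (x - a)) x = L - (x - a) \<bullet> (x - a) - e\<^sup>2 * v" for x e L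
  proof -
    let ?c = "L - (x - a) \<bullet> (x - a)"
    have eq: "eta y * (L - (x + e *\<^sub>R y - a) \<bullet> (x + e *\<^sub>R y - a))
        = ?c * eta y - (2 * e) * (eta y * ((x - a) \<bullet> y)) - e\<^sup>2 * (eta y * (y \<bullet> y))" for y
      by (simp add: algebra_simps inner_commute power2_eq_square)
    have "avg eta_measure e (\<lambda>x. L - (x - a) \<bullet> (x - a)) x
       = (\<integral>y. ?c * eta y - (2 * e) * (eta y * ((x - a) \<bullet> y)) - e\<^sup>2 * (eta y * (y \<bullet> y)) \<partial>lborel)"
      by (subst avg_eta) (auto simp: eq intro!: borel_measurable_continuous_onI continuous_intros)
    also have "\<dots> = ?c * 1 - (2 * e) * 0 - e\<^sup>2 * v"
      using int_eta iv iw[of "x - a"] by (simp add: integral_eta odd v_def)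
    finally show ?thesis by simp
  qed
  ultimately show ?thesis using that by blast
qed

text \<open>As \<open>z\<close> vanishes near the boundary, its truncation \<open>zt\<close> to the
  ball satisfies zt \<le> m_e * zt at one fixed scale on the whole space. Pairing with a paraboloid
  and transposing the average bounds the integral of zt p by itself minus e^2 v times the integral
  of zt, so the latter is zero.\<close>

lemma local_max_principle:
  fixes z :: "real^'n::finite \<Rightarrow> real"
  assumes z: "wsub z h" and nn: "\<And>x. 0 \<le> z x" and r: "0 < r'" "r' < r"
    and h: "AE x in lborel. x \<in> ball a r \<longrightarrow> h x \<le> 0"
    and bd: "AE x in lborel. x \<in> ball a r - ball a r' \<longrightarrow> z x = 0"
  shows "AE x in lborel. x \<in> ball a r \<longrightarrow> z x = 0"
proof -
  interpret m: kernel "eta_measure :: (real^'n) measure" by (rule kernel_eta)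
  interpret k: kernel "ball_k :: (real^'n) measure" by (rule kernel_ball_k)
  note l = wsub_locint[OF z]
  note [measurable] = l[THEN locint_measurable]
  \<comment> \<open>Small enough that averages centred in the inner ball do not leave the outer
    ball.\<close>
  define e where "e = (r - r') / 2"
  have e: "e > 0" "r' + e < r" using r by (auto simp: e_def field_simps)
  obtain v where v: "v > 0"
    "\<And>x e L. avg eta_measure e (\<lambda>x. L - (x - a) \<bullet> (x - a)) x = L - (x - a) \<bullet> (x - a) - e\<^sup>2 * v"
    by (rule eta_moments[of a]) blast
  \<comment> \<open>With this height the positive part in \<open>p\<close> is inactive on the
    e-neighbourhood of the ball, so the exact formula for averages of paraboloids holds at all its
    points.\<close>
  define L where "L = (r + e)\<^sup>2"
  define zt where "zt x = indicator (ball a r) x * z x" for x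
  have ztm[measurable]: "zt \<in> borel_measurable borel" unfolding zt_def[abs_def] by measurable
  have zt: "locint zt" by (rule locint_bound[OF l(1) ztm]) (auto simp: zt_def indicator_def nn)
  have near: "x + e *\<^sub>R y \<in> ball a r" if "x \<in> ball a r'" "norm y \<le> 1" for x y
  proof -
    have "norm (e *\<^sub>R y) \<le> e" using that(2) e by simp
    moreover have "norm (x - a) < r'" using that(1) by (simp add: dist_norm norm_minus_commute)
    ultimately have "norm ((x - a) + e *\<^sub>R y) < r" using norm_triangle_ineq[of "x - a" "e *\<^sub>R y"] e(2) by linarith
    then show ?thesis by (simp add: dist_norm norm_minus_commute algebra_simps)
  qed
  have le: "AE x in lborel. zt x \<le> avg eta_measure e zt x"
    using mean_inequality[OF mvpair_ball z, of e] k.AE_translate[OF h, of e] bd k.AE_integrable[OF l(2), of e]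
  proof eventually_elim
    case (elim x)
    show ?case
    proof (cases "x \<in> ball a r'")
      case True
      have 1: "avg eta_measure e z x = avg eta_measure e zt x" unfolding avg_def
      proof (rule integral_cong_AE)
        show "AE y in eta_measure. z (x + e *\<^sub>R y) = zt (x + e *\<^sub>R y)" using m.supp
          by eventually_elim (use near[OF True] in \<open>simp add: zt_def\<close>)
      qed measurable
      have "AE y in ball_k. h (x + e *\<^sub>R y) \<le> 0" using elim(2) k.supp
        by eventually_elim (use near[OF True] in simp)
      then have "AE y in ball_k. 0 \<le> - h (x + e *\<^sub>R y)" by eventually_elim simp
      from integral_nonneg_AE[OF this] have 2: "avg ball_k e h x \<le> 0" by (simp add: avg_def)
      have "e\<^sup>2 * avg ball_k e h x \<le> 0" by (rule mult_nonneg_nonpos[OF _ 2]) simp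
      moreover have "zt x \<le> z x" using nn[of x] by (simp add: zt_def indicator_def)
      ultimately show ?thesis using elim(1) 1 by linarith
    next
      case False
      then have "zt x = 0" using elim(3) by (auto simp: zt_def indicator_def)
      moreover have "0 \<le> avg eta_measure e zt x" by (rule m.avg_nonneg) (simp add: zt_def nn)
      ultimately show ?thesis by simp
    qed
  qed
  define p where "p x = max 0 (L - (x - a) \<bullet> (x - a))" for x
  have pm[measurable]: "p \<in> borel_measurable borel"
    unfolding p_def by (intro borel_measurable_continuous_onI continuous_intros)
  have p: "bdsupp p"
  proof (rule bdsuppI[OF pm, of L "norm a + (r + e)"])
    fix x
    show "\<bar>p x\<bar> \<le> L" by (auto simp: p_def L_def max_def)
    assume "norm a + (r + e) < norm x"
    then have "norm (x - a) > r + e" using norm_triangle_ineq2[of x a] by linarith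
    then have "(r + e)\<^sup>2 \<le> (norm (x - a))\<^sup>2" using r e by (intro power_mono) auto
    then show "p x = 0" by (simp add: p_def L_def dot_square_norm)
  qed
  have avp: "avg eta_measure (-e) p x = L - (x - a) \<bullet> (x - a) - e\<^sup>2 * v" if x: "x \<in> ball a r" for x
  proof -
    have "avg eta_measure (-e) p x = avg eta_measure (-e) (\<lambda>x. L - (x - a) \<bullet> (x - a)) x"
      unfolding avg_def
    proof (rule integral_cong_AE)
      show "AE y in eta_measure. p (x + (-e) *\<^sub>R y) = L - (x + (-e) *\<^sub>R y - a) \<bullet> (x + (-e) *\<^sub>R y - a)"
        using m.supp
      proof eventually_elim
        case (elim y)
        have "norm (e *\<^sub>R y) \<le> e" using elim e by simp
        moreover have "norm (x - a) < r" using x by (simp add: dist_norm norm_minus_commute)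
        moreover have "norm (x + (-e) *\<^sub>R y - a) \<le> norm (x - a) + norm (e *\<^sub>R y)"
          using norm_triangle_ineq4[of "x - a" "e *\<^sub>R y"] by (simp add: algebra_simps)
        ultimately have "norm (x + (-e) *\<^sub>R y - a) \<le> r + e" by linarith
        then have "(norm (x + (-e) *\<^sub>R y - a))\<^sup>2 \<le> L" unfolding L_def by (intro power_mono) auto
        then show ?case by (simp add: p_def dot_square_norm)
      qed
    qed measurable
    then show ?thesis by (simp add: v(2))
  qed
  have int: "integrable lborel zt"
  proof -
    have "integrable lborel (\<lambda>x. zt x * indicator (cball 0 (norm a + r)) x)"
      by (rule locint_bdsupp_integrable[OF zt bdsupp_indicator])
    moreover have "zt x * indicator (cball 0 (norm a + r)) x = zt x" for x
      using norm_triangle_ineq2[of x a] by (auto simp: zt_def indicator_def dist_norm norm_minus_commute)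
    ultimately show ?thesis by simp
  qed
  have "(\<integral>x. zt x * p x \<partial>lborel) \<le> (\<integral>x. avg eta_measure e zt x * p x \<partial>lborel)"
    by (intro integral_mono_AE locint_bdsupp_integrable zt p m.locint_avg)
      (use le in \<open>eventually_elim, auto intro!: mult_right_mono simp: p_def\<close>)
  also have "\<dots> = (\<integral>x. zt x * avg eta_measure (-e) p x \<partial>lborel)" by (rule m.avg_adjoint[OF zt p])
  also have "\<dots> = (\<integral>x. zt x * p x - e\<^sup>2 * v * zt x \<partial>lborel)"
  proof (rule Bochner_Integration.integral_cong)
    fix x
    show "zt x * avg eta_measure (-e) p x = zt x * p x - e\<^sup>2 * v * zt x"
    proof (cases "x \<in> ball a r")
      case True
      then have "norm (x - a) \<le> r + e" using e by (simp add: dist_norm norm_minus_commute)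
      then have "(norm (x - a))\<^sup>2 \<le> L" unfolding L_def by (intro power_mono) auto
      then have eq: "avg eta_measure (-e) p x = p x - e\<^sup>2 * v" using avp[OF True] by (simp add: p_def dot_square_norm)
      show ?thesis unfolding eq by (simp add: algebra_simps)
    qed (simp add: zt_def)
  qed simp
  also have "\<dots> = (\<integral>x. zt x * p x \<partial>lborel) - e\<^sup>2 * v * (\<integral>x. zt x \<partial>lborel)"
    using locint_bdsupp_integrable[OF zt p] int by simp
  finally have "e\<^sup>2 * v * (\<integral>x. zt x \<partial>lborel) \<le> 0" by simp
  moreover have "e\<^sup>2 * v > 0" using e v by simp
  ultimately have "(\<integral>x. zt x \<partial>lborel) \<le> 0" by (metis mult_pos_pos not_less)
  moreover have nnt: "AE x in lborel. 0 \<le> zt x" by (simp add: zt_def nn)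
  ultimately have "(\<integral>x. zt x \<partial>lborel) = 0" using integral_nonneg_AE[OF nnt] by simp
  then have "AE x in lborel. zt x = 0" using int nnt by (subst (asm) integral_nonneg_eq_0_iff_AE) auto
  then show ?thesis by eventually_elim (auto simp: zt_def indicator_def)
qed

text \<open>The positive part of \<open>v\<close> obeys the mean value inequality with right-hand
  side at most \<open>C\<close>; since \<open>eta\<close> is bounded, its mean over a ball is
  controlled by the L1 norm on the larger ball. The resulting bound is merely qualitative.\<close>

lemma local_bounded_above:
  fixes v :: "real^'n::finite \<Rightarrow> real"
  assumes v: "wsub v h" and h: "AE x in lborel. x \<in> ball 0 R \<longrightarrow> v x > 0 \<longrightarrow> h x \<le> C" and C: "C \<ge> 0" and \<rho>: "\<rho> < R"
  obtains B where "AE x in lborel. x \<in> ball 0 \<rho> \<longrightarrow> v x \<le> B"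
proof -
  interpret m: kernel "eta_measure :: (real^'n) measure" by (rule kernel_eta)
  interpret k: kernel "ball_k :: (real^'n) measure" by (rule kernel_ball_k)
  define z where "z x = max (v x) 0" for x
  define H where "H x = (if v x > 0 then h x else 0)" for x
  have zH: "wsub z H" unfolding z_def[abs_def] H_def[abs_def] by (rule wsub_max[OF v wsub_const])
  note l = wsub_locint[OF zH]
  note [measurable] = l[THEN locint_measurable] bdsupp_measurable[OF bdsupp_eta[where 'n = 'n]]
  define e where "e = R - \<rho>"
  have e: "e > 0" using \<rho> by (simp add: e_def)
  obtain E where E: "E > 0" "\<And>y. \<bar>eta (y::real^'n)\<bar> \<le> E" using bdsuppE[OF bdsupp_eta] by metis
  define I where "I = (\<integral>x. E * (indicator (cball 0 R) x * \<bar>z x\<bar>) \<partial>lborel)"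
  have AEH: "AE x in lborel. x \<in> ball 0 R \<longrightarrow> H x \<le> C" using h C by (auto simp: H_def elim!: eventually_mono)
  have near: "x + e *\<^sub>R y \<in> ball 0 R" if "x \<in> ball 0 \<rho>" "norm y \<le> 1" for x y :: "real^'n"
  proof -
    have "norm (e *\<^sub>R y) \<le> e" using that(2) e by simp
    then show ?thesis using that(1) norm_triangle_ineq[of x "e *\<^sub>R y"] by (simp add: e_def)
  qed
  have "AE x in lborel. x \<in> ball 0 \<rho> \<longrightarrow> v x \<le> I / e ^ DIM(real^'n) + e\<^sup>2 * (C * measure ball_k (space (ball_k :: (real^'n) measure)))"
    using mean_inequality[OF mvpair_ball zH, of e] k.AE_translate[OF AEH, of e] k.AE_integrable[OF l(2), of e]
  proof eventually_elim
    case (elim x)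
    show ?case
    proof
      assume x: "x \<in> ball 0 \<rho>"
      have "AE y in ball_k. H (x + e *\<^sub>R y) \<le> C" using elim(2) k.supp
        by eventually_elim (use near[OF x] in simp)
      then have "avg ball_k e H x \<le> (\<integral>y. C \<partial>(ball_k :: (real^'n) measure))" unfolding avg_def
        using elim(3) by (intro integral_mono_AE) auto
      then have 1: "e\<^sup>2 * avg ball_k e H x \<le> e\<^sup>2 * (C * measure ball_k (space (ball_k :: (real^'n) measure)))"
        by (intro mult_left_mono) (auto simp: mult.commute)
      have bu: "bdsupp (\<lambda>u. eta ((1 / e) *\<^sub>R (u - x)))"
      proof (rule bdsuppI[of _ E "norm x + e"])
        fix u :: "real^'n" assume "norm x + e < norm u"
        then have "norm (u - x) > e" using norm_triangle_ineq2[of u x] by linarith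
        then have "norm ((1 / e) *\<^sub>R (u - x)) > 1" unfolding norm_scaleR using e by (simp add: field_simps)
        then show "eta ((1 / e) *\<^sub>R (u - x)) = 0" by (simp add: eta_def bowl_bounds)
      qed (use E in auto)
      \<comment> \<open>Rescaling exhibits the average as an integral over the ball of radius
        \<open>e\<close> around \<open>x\<close>, which lies in the ball of radius \<open>R\<close>
        since e = R - \<rho>.\<close>
      have "e ^ DIM(real^'n) * avg eta_measure e z x = (\<integral>u. eta ((1 / e) *\<^sub>R (u - x)) * z u \<partial>lborel)"
        using integral_rescale[of "\<lambda>u. eta ((1 / e) *\<^sub>R (u - x)) * z u" e x] e by (simp add: avg_eta)
      also have "\<dots> \<le> I" unfolding I_def
      proof (rule Bochner_Integration.integral_mono)
        show "integrable lborel (\<lambda>u. eta ((1 / e) *\<^sub>R (u - x)) * z u)"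
          using locint_bdsupp_integrable[OF l(1) bu] by (simp add: mult.commute)
        show "integrable lborel (\<lambda>x. E * (indicator (cball 0 R) x * \<bar>z x\<bar>))"
          by (intro integrable_mult_right locint_integral_abs_mono l)
        fix u
        show "eta ((1 / e) *\<^sub>R (u - x)) * z u \<le> E * (indicator (cball 0 R) u * \<bar>z u\<bar>)"
        proof (cases "norm (u - x) > e")
          case True
          then have "norm ((1 / e) *\<^sub>R (u - x)) > 1" unfolding norm_scaleR using e by (simp add: field_simps)
          then have "eta ((1 / e) *\<^sub>R (u - x)) = 0" by (simp add: eta_def bowl_bounds)
          then show ?thesis using E by simp
        next
          case False
          then have "norm u \<le> R" using norm_triangle_ineq2[of u x] x by (simp add: e_def)
          then show ?thesis using E(2)[of "(1 / e) *\<^sub>R (u - x)"] eta_nonneg[of "(1 / e) *\<^sub>R (u - x)"]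
            by (auto simp: z_def intro!: mult_mono)
        qed
      qed
      finally have "avg eta_measure e z x \<le> I / e ^ DIM(real^'n)" using e by (simp add: field_simps)
      then show "v x \<le> I / e ^ DIM(real^'n) + e\<^sup>2 * (C * measure ball_k (space (ball_k :: (real^'n) measure)))"
        using elim(1) 1 by (simp add: z_def)
    qed
  qed
  then show ?thesis using that by blast
qed

text \<open>Comparison with the paraboloid \<open>t/2 + \<beta> |x - a|\<^sup>2\<close> halves an upper bound at the price of shrinking the ball.\<close>
lemma halving_step:
  fixes v :: "real^'n::finite \<Rightarrow> real" and g :: "real \<Rightarrow> real" and C t \<beta> r :: real
  assumes v: "wsub v h" and h: "AE x in lborel. x \<in> ball 0 R \<longrightarrow> v x > 0 \<longrightarrow> h x \<le> C - g (v x)" and g: "mono g"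
    and t: "t > 0" and \<beta>: "\<beta> > 0" "2 * real CARD('n) * \<beta> \<le> g (t / 2) - C" and r: "r > 0" "3 * t \<le> \<beta> * r\<^sup>2"
    and \<rho>: "\<rho> + r \<le> R" and le: "AE x in lborel. x \<in> ball 0 (\<rho> + r) \<longrightarrow> v x \<le> 2 * t"
  shows "AE x in lborel. x \<in> ball 0 \<rho> \<longrightarrow> v x \<le> t"
proof -
  have local: "AE x in lborel. x \<in> ball a r \<longrightarrow> v x \<le> t / 2 + \<beta> * (norm (x - a))\<^sup>2" if a: "a \<in> ball 0 \<rho>" for a
  proof -
    have sub: "ball a r \<subseteq> ball 0 (\<rho> + r)"
    proof
      fix x assume "x \<in> ball a r"
      then show "x \<in> ball 0 (\<rho> + r)" using a norm_triangle_ineq2[of x a] by (simp add: dist_norm norm_minus_commute)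
    qed
    define zz where "zz x = v x + (- (t / 2) + (- \<beta>) * ((x - a) \<bullet> (x - a)))" for x
    define hh where "hh x = h x + 2 * real CARD('n) * \<beta>" for x
    have w: "wsub zz hh" using wsub_add[OF v wsub_quadratic[of "- (t / 2)" "- \<beta>" a]]
      unfolding zz_def[abs_def] hh_def[abs_def] by simp
    define z where "z x = max (zz x) 0" for x
    define H where "H x = (if zz x > 0 then hh x else 0)" for x
    have zH: "wsub z H" unfolding z_def[abs_def] H_def[abs_def] by (rule wsub_max[OF w wsub_const])
    have "AE x in lborel. x \<in> ball a r \<longrightarrow> z x = 0"
    \<comment> \<open>Beyond distance 3r/4 the paraboloid exceeds t/2 + (9/16) 3t, which is above
      2t, so \<open>z\<close> vanishes on the outer shell. Where \<open>zz\<close> is positive,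
      \<open>v\<close> exceeds t/2 and the choice of \<beta> makes the right-hand side
      nonpositive.\<close>
    proof (rule local_max_principle[OF zH, of "3 / 4 * r"])
      show "AE x in lborel. x \<in> ball a r \<longrightarrow> H x \<le> 0" using h
      proof eventually_elim
        case (elim x)
        show ?case
        proof
          assume x: "x \<in> ball a r"
          show "H x \<le> 0"
          proof (cases "zz x > 0")
            case True
            have "0 \<le> \<beta> * ((x - a) \<bullet> (x - a))" using \<beta> by simp
            then have vt: "v x > t / 2" using True by (simp add: zz_def)
            then have "g (t / 2) \<le> g (v x)" by (intro monoD[OF g]) simp
            moreover have "h x \<le> C - g (v x)" using elim x sub \<rho> vt t by (auto dest!: subsetD)
            ultimately show ?thesis using \<beta>(2) by (simp add: H_def hh_def)
          qed (simp add: H_def)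
        qed
      qed
      show "AE x in lborel. x \<in> ball a r - ball a (3 / 4 * r) \<longrightarrow> z x = 0" using le
      proof eventually_elim
        case (elim x)
        show ?case
        proof
          assume x: "x \<in> ball a r - ball a (3 / 4 * r)"
          then have v2: "v x \<le> 2 * t" using elim sub by auto
          have "3 / 4 * r \<le> norm (x - a)" using x by (simp add: dist_norm norm_minus_commute not_less)
          then have "(3 / 4 * r)\<^sup>2 \<le> (norm (x - a))\<^sup>2" using r by (intro power_mono) auto
          then have "\<beta> * (9 / 16 * r\<^sup>2) \<le> \<beta> * ((x - a) \<bullet> (x - a))" using \<beta>(1)
            by (intro mult_left_mono) (auto simp: dot_square_norm power_mult_distrib power2_eq_square)
          then have "zz x \<le> 0" using v2 r(2) t by (simp add: zz_def)
          then show "z x = 0" by (simp add: z_def)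
        qed
      qed
    qed (use r in \<open>auto simp: z_def\<close>)
    then show ?thesis by eventually_elim (auto simp: z_def zz_def max_def dot_square_norm split: if_splits)
  qed
  \<comment> \<open>Within distance \<open>s\<close> of a centre the paraboloid is still at most
    \<open>t\<close>.\<close>
  define s where "s = min r (sqrt (t / (2 * \<beta>)))"
  have s: "s > 0" using r t \<beta> by (simp add: s_def)
  have \<beta>s: "\<beta> * s\<^sup>2 \<le> t / 2"
  proof -
    have "s\<^sup>2 \<le> (sqrt (t / (2 * \<beta>)))\<^sup>2" using s by (intro power_mono) (auto simp: s_def)
    then have "s\<^sup>2 \<le> t / (2 * \<beta>)" using t \<beta> by simp
    then have "\<beta> * s\<^sup>2 \<le> \<beta> * (t / (2 * \<beta>))" using \<beta> by (intro mult_left_mono) auto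
    then show ?thesis using \<beta> by simp
  qed
  \<comment> \<open>The local estimate has an exceptional null set for each centre; a countable
    dense set of centres leaves a single null set, and every point of the ball is
    \<open>s\<close>-close to one of them.\<close>
  obtain D :: "(real^'n) set" where D: "countable D" "\<And>U. open U \<Longrightarrow> U \<noteq> {} \<Longrightarrow> \<exists>d\<in>D. d \<in> U"
    using countable_dense_setE by metis
  have "AE x in lborel. \<forall>a\<in>D \<inter> ball 0 \<rho>. x \<in> ball a r \<longrightarrow> v x \<le> t / 2 + \<beta> * (norm (x - a))\<^sup>2"
    by (subst AE_ball_countable) (use D local in \<open>auto simp: countable_Int1\<close>)
  then show ?thesis
  proof eventually_elim
    case (elim x)
    show ?case
    proof
      assume x: "x \<in> ball 0 \<rho>"
      have "open (ball 0 \<rho> \<inter> ball x s)" "ball 0 \<rho> \<inter> ball x s \<noteq> {}" using x s by auto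
      then obtain d where d: "d \<in> D" "d \<in> ball 0 \<rho>" "d \<in> ball x s" using D(2) by (metis IntE)
      have n: "norm (x - d) < s" using d(3) by (simp add: dist_norm)
      then have "x \<in> ball d r" by (simp add: s_def dist_norm norm_minus_commute)
      then have "v x \<le> t / 2 + \<beta> * (norm (x - d))\<^sup>2" using elim d by auto
      also have "\<dots> \<le> t / 2 + \<beta> * s\<^sup>2" using n \<beta> by (intro add_left_mono mult_left_mono power_mono) auto
      also have "\<dots> \<le> t" using \<beta>s by simp
      finally show "v x \<le> t" .
    qed
  qed
qed

text \<open>The qualitative bound \<open>B\<close> only decides at which power of 2 the descent
  starts and does not enter the conclusion. Each halving costs one radius, and the partial sums of
  radii stay below \<open>R'\<close>.\<close>

lemma keller_osserman_bound:
  fixes v :: "real^'n::finite \<Rightarrow> real" and g :: "real \<Rightarrow> real" and C t :: real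
  assumes v: "wsub v h" and h: "AE x in lborel. x \<in> ball 0 R \<longrightarrow> v x > 0 \<longrightarrow> h x \<le> C - g (v x)" and g: "mono g"
    and g0: "g 0 \<ge> 0" and C: "C \<ge> 0" and t: "t > 0" and gt: "g (t / 2) > 0" "g (t / 2) \<ge> 2 * C"
    and sum: "\<And>K::nat. \<rho> + (\<Sum>k<K. sqrt (12 * real CARD('n) * (2 ^ k * t) / g (2 ^ k * t / 2))) \<le> R'" and R': "R' < R"
  shows "AE x in lborel. x \<in> ball 0 \<rho> \<longrightarrow> v x \<le> t"
proof -
  define r where "r k = sqrt (12 * real CARD('n) * (2 ^ k * t) / g (2 ^ k * t / 2))" for k :: nat
  have gk: "g (t / 2) \<le> g (2 ^ k * t / 2)" for k :: nat
    using t by (intro monoD[OF g] divide_right_mono) (auto simp: mult_le_cancel_right1)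
  have "AE x in lborel. x \<in> ball 0 R \<longrightarrow> v x > 0 \<longrightarrow> h x \<le> C" using h
  proof eventually_elim
    case (elim x)
    then show ?case using monoD[OF g, of 0 "v x"] g0 by auto
  qed
  then obtain B where B: "AE x in lborel. x \<in> ball 0 R' \<longrightarrow> v x \<le> B"
    using local_bounded_above[OF v _ C R'] by metis
  obtain K :: nat where K: "B / t < 2 ^ K" using real_arch_pow[of 2 "B / t"] by auto
  have "AE x in lborel. x \<in> ball 0 (\<rho> + (\<Sum>k<j. r k)) \<longrightarrow> v x \<le> 2 ^ j * t" if "j \<le> K" for j
    using that
  \<comment> \<open>Downward induction from \<open>K\<close>: the level 2^j t decreases while the
    ball shrinks by the j-th radius.\<close>
  proof (induction rule: inc_induct)
    case base
    have "\<rho> + (\<Sum>k<K. r k) \<le> R'" using sum[of K] by (simp add: r_def)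
    then have "ball (0::real^'n) (\<rho> + (\<Sum>k<K. r k)) \<subseteq> ball 0 R'" by (rule subset_ball)
    moreover have "B \<le> 2 ^ K * t" using K t by (simp add: field_simps)
    ultimately show ?case using B by (auto elim!: eventually_mono)
  next
    case (step j)
    show ?case
    \<comment> \<open>Half of the absorption is spent on \<open>C\<close>: as C \<le> g(t/2)/2, the
      admissible curvature is \<beta> = g/(4N). The condition 3 t \<le> \<beta> r^2 at level 2^j t
      then dictates r^2 = 12 N 2^j t / g.\<close>
    proof (rule halving_step[OF v h g, of _ "g (2 ^ j * t / 2) / (4 * CARD('n))" "r j"])
      have pos: "0 < g (2 ^ j * t / 2)" using gk[of j] gt by linarith
      show "0 < 2 ^ j * t" using t by simp
      show "0 < g (2 ^ j * t / 2) / (4 * CARD('n))" using pos by simp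
      show "2 * real CARD('n) * (g (2 ^ j * t / 2) / (4 * CARD('n))) \<le> g (2 ^ j * t / 2) - C"
        using gk[of j] gt(2) by simp
      have arg: "0 < 12 * real CARD('n) * (2 ^ j * t) / g (2 ^ j * t / 2)" using pos t by simp
      show "0 < r j" unfolding r_def using arg by (rule real_sqrt_gt_zero)
      have "(r j)\<^sup>2 = 12 * real CARD('n) * (2 ^ j * t) / g (2 ^ j * t / 2)" unfolding r_def using arg by simp
      then show "3 * (2 ^ j * t) \<le> g (2 ^ j * t / 2) / (4 * CARD('n)) * (r j)\<^sup>2" using pos by simp
      show "\<rho> + (\<Sum>k<j. r k) + r j \<le> R" using sum[of "Suc j"] R' by (simp add: r_def add.assoc)
      show "AE x in lborel. x \<in> ball 0 (\<rho> + (\<Sum>k<j. r k) + r j) \<longrightarrow> v x \<le> 2 * (2 ^ j * t)"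
        using step by (simp add: add.assoc mult.assoc)
    qed
  qed
  from this[of 0] show ?thesis by simp
qed

section \<open>Solutions for Lipschitz nonlinearities\<close>

text \<open>Equality as two one-sided statements, so that every fact on \<open>wsub\<close> serves
  both directions; the identity for test functions of arbitrary sign is recovered in
  \<open>weq_test\<close>.\<close>

definition weq :: "(real^'n::finite \<Rightarrow> real) \<Rightarrow> (real^'n \<Rightarrow> real) \<Rightarrow> bool" where
  "weq z h \<longleftrightarrow> wsub z h \<and> wsub (\<lambda>x. - z x) (\<lambda>x. - h x)"

section \<open>Dominated limits of weak inequalities and equations\<close>

lemma dominated_pairing:
  assumes u: "\<And>n. u n \<in> borel_measurable borel" and U: "U \<in> borel_measurable borel" and b: "locint b"
    and bd: "\<And>n. AE x in lborel. \<bar>u n x\<bar> \<le> b x" and lim: "AE x in lborel. (\<lambda>n. u n x) \<longlonglongrightarrow> U x"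
    and \<psi>: "bdsupp \<psi>"
  shows "(\<lambda>n. \<integral>x. u n x * \<psi> x \<partial>lborel) \<longlonglongrightarrow> (\<integral>x. U x * \<psi> x \<partial>lborel)"
proof (rule integral_dominated_convergence[where w = "\<lambda>x. \<bar>b x * \<psi> x\<bar>"])
  note [measurable] = u U bdsupp_measurable[OF \<psi>]
  show "(\<lambda>x. U x * \<psi> x) \<in> borel_measurable lborel" "(\<lambda>x. u n x * \<psi> x) \<in> borel_measurable lborel" for n by measurable
  show "integrable lborel (\<lambda>x. \<bar>b x * \<psi> x\<bar>)" by (intro integrable_abs locint_bdsupp_integrable b \<psi>)
  show "AE x in lborel. (\<lambda>n. u n x * \<psi> x) \<longlonglongrightarrow> U x * \<psi> x"
    using lim by eventually_elim (intro tendsto_mult tendsto_const)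
  show "AE x in lborel. norm (u n x * \<psi> x) \<le> \<bar>b x * \<psi> x\<bar>" for n
    using bd[of n] by eventually_elim (auto simp: abs_mult intro!: mult_right_mono)
qed

lemma locint_dominated_limit:
  assumes "\<And>n. u n \<in> borel_measurable borel" and U: "U \<in> borel_measurable borel" and b: "locint b"
    and bd: "\<And>n. AE x in lborel. \<bar>u n x\<bar> \<le> b x" and lim: "AE x in lborel. (\<lambda>n. u n x) \<longlonglongrightarrow> U x"
  shows "locint U"
proof (rule locint_bound[OF b U])
  have "AE x in lborel. \<forall>n. \<bar>u n x\<bar> \<le> b x" using bd by (simp add: AE_all_countable)
  then show "AE x in lborel. \<bar>U x\<bar> \<le> b x" using lim
    by eventually_elim (rule LIMSEQ_le_const2[OF tendsto_rabs], auto)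
qed

lemma wsub_limit:
  assumes w: "\<And>n::nat. wsub (u n) (h n)"
    and U: "U \<in> borel_measurable borel" and b: "locint b"
    and bd: "\<And>n. AE x in lborel. \<bar>u n x\<bar> \<le> b x" and lim: "AE x in lborel. (\<lambda>n. u n x) \<longlonglongrightarrow> U x"
    and H: "H \<in> borel_measurable borel" and c: "locint c"
    and bdh: "\<And>n. AE x in lborel. \<bar>h n x\<bar> \<le> c x" and limh: "AE x in lborel. (\<lambda>n. h n x) \<longlonglongrightarrow> H x"
  shows "wsub U H"
  unfolding wsub_def
proof (intro conjI allI impI)
  have mu: "u n \<in> borel_measurable borel" "h n \<in> borel_measurable borel" for n
    using wsub_locint[OF w[of n]] by (auto dest: locint_measurable)
  show "locint U" by (rule locint_dominated_limit[OF mu(1) U b bd lim])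
  show "locint H" by (rule locint_dominated_limit[OF mu(2) H c bdh limh])
  fix \<phi> :: "real^'a \<Rightarrow> real" assume \<phi>: "test_fun \<phi>" and nn: "\<forall>x. 0 \<le> \<phi> x"
  have "(\<lambda>n. (\<integral>x. u n x * laplacian \<phi> x \<partial>lborel) + (\<integral>x. h n x * \<phi> x \<partial>lborel))
     \<longlonglongrightarrow> (\<integral>x. U x * laplacian \<phi> x \<partial>lborel) + (\<integral>x. H x * \<phi> x \<partial>lborel)"
    by (intro tendsto_add dominated_pairing[OF mu(1) U b bd lim] dominated_pairing[OF mu(2) H c bdh limh]
        bdsupp_laplacian bdsupp_test \<phi>)
  moreover have "0 \<le> (\<integral>x. u n x * laplacian \<phi> x \<partial>lborel) + (\<integral>x. h n x * \<phi> x \<partial>lborel)" for n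
    using wsubD[OF w \<phi>] nn by blast
  ultimately show "0 \<le> (\<integral>x. U x * laplacian \<phi> x \<partial>lborel) + (\<integral>x. H x * \<phi> x \<partial>lborel)"
    by (intro LIMSEQ_le_const) auto
qed

lemma weq_limit:
  assumes w: "\<And>n::nat. weq (u n) (h n)"
    and U: "U \<in> borel_measurable borel" and b: "locint b"
    and bd: "\<And>n. AE x in lborel. \<bar>u n x\<bar> \<le> b x" and lim: "AE x in lborel. (\<lambda>n. u n x) \<longlonglongrightarrow> U x"
    and H: "H \<in> borel_measurable borel" and c: "locint c"
    and bdh: "\<And>n. AE x in lborel. \<bar>h n x\<bar> \<le> c x" and limh: "AE x in lborel. (\<lambda>n. h n x) \<longlonglongrightarrow> H x"
  shows "weq U H"
  unfolding weq_def
proof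
  show "wsub U H" by (rule wsub_limit[OF _ U b bd lim H c bdh limh]) (use w in \<open>auto simp: weq_def\<close>)
  show "wsub (\<lambda>x. - U x) (\<lambda>x. - H x)"
  proof (rule wsub_limit[OF _ _ b _ _ _ c])
    show "wsub (\<lambda>x. - u n x) (\<lambda>x. - h n x)" for n using w by (auto simp: weq_def)
    show "AE x in lborel. (\<lambda>n. - u n x) \<longlonglongrightarrow> - U x" using lim by eventually_elim (rule tendsto_minus)
    show "AE x in lborel. (\<lambda>n. - h n x) \<longlonglongrightarrow> - H x" using limh by eventually_elim (rule tendsto_minus)
  qed (use U H bd bdh in auto)
qed

text \<open>The bound 8 on e^2 lam matches the comparison 8 sm_k \<le> sm_m: the decrease caused by
  \<open>H\<close> is then outweighed by the averaging term.\<close>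

locale lipschitz_problem =
  fixes H :: "real \<Rightarrow> real" and lam e :: real and f :: "real^'n::finite \<Rightarrow> real"
  assumes H_mono: "mono H" and H_lip: "\<And>s t. s \<le> t \<Longrightarrow> H t - H s \<le> lam * (t - s)"
    and lam: "lam \<ge> 0" and e: "e > 0" "e\<^sup>2 * lam \<le> 8" and f: "locint f"
begin

sublocale m: kernel "sm_m :: (real^'n) measure" by (rule kernel_sm_m)
sublocale k: kernel "sm_k :: (real^'n) measure" by (rule kernel_sm_k)

definition T :: "(real^'n \<Rightarrow> real) \<Rightarrow> real^'n \<Rightarrow> real" where
  "T u x = avg sm_m e u x + e\<^sup>2 * avg sm_k e (\<lambda>x. f x - H (u x)) x"

lemma H_measurable [measurable]: "H \<in> borel_measurable borel"
  by (rule borel_measurable_mono[OF H_mono])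

lemma H_bound: "\<bar>H s\<bar> \<le> \<bar>H 0\<bar> + lam * \<bar>s\<bar>"
proof (cases "s \<ge> 0")
  case True
  then show ?thesis using H_lip[of 0 s] monoD[OF H_mono, of 0 s] by auto
next
  case False
  then show ?thesis using H_lip[of s 0] monoD[OF H_mono, of s 0] by auto
qed

lemma locint_H: assumes "locint u" shows "locint (\<lambda>x. H (u x))"
proof (rule locint_bound)
  show "locint (\<lambda>x. \<bar>H 0\<bar> + lam * \<bar>u x\<bar>)" by (intro locint_add locint_const locint_cmult locint_abs assms)
  show "(\<lambda>x. H (u x)) \<in> borel_measurable borel" using locint_measurable[OF assms] by measurable
qed (use H_bound in auto)

lemma locint_rhs: "locint u \<Longrightarrow> locint (\<lambda>x. f x - H (u x))"
  by (intro locint_diff f locint_H)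

lemma locint_T: "locint u \<Longrightarrow> locint (T u)"
  unfolding T_def[abs_def] by (intro locint_add locint_cmult m.locint_avg k.locint_avg locint_rhs)

text \<open>For w = v - u \<ge> 0 the increment T v - T u is at least m_e * w - e^2 lam k_e * w,
  which is nonnegative by the choice of \<open>e\<close>.\<close>

lemma T_mono:
  assumes u: "locint u" and v: "locint v" and le: "AE x in lborel. u x \<le> v x"
  shows "AE x in lborel. T u x \<le> T v x"
proof -
  let ?w = "\<lambda>x. 1 * v x + (-1) * u x"
  have w: "locint ?w" by (rule locint_lincomb[OF v u])
  have nn: "AE x in lborel. 0 \<le> ?w x" using le by eventually_elim simp
  have diff: "AE x in lborel. 1 * (f x - H (u x)) + (-1) * (f x - H (v x)) \<le> lam * ?w x"
    using le by eventually_elim (use H_lip in simp)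
  have d: "locint (\<lambda>x. 1 * (f x - H (u x)) + (-1) * (f x - H (v x)))"
    by (rule locint_lincomb[OF locint_rhs[OF u] locint_rhs[OF v]])
  show ?thesis
    using m.avg_lincomb[OF v u, of e 1 "-1"] k.avg_lincomb[OF locint_rhs[OF u] locint_rhs[OF v], of e 1 "-1"]
      k.avg_mono_AE[OF d locint_cmult[OF w, of lam] diff, of e] k.avg_mono_AE[OF locint_const[of 0] w nn, of e]
      sm_k_le_sm_m[OF w nn, of e]
  proof eventually_elim
    case (elim x)
    have "avg sm_k e (\<lambda>x. lam * ?w x) x = lam * avg sm_k e ?w x" by (simp add: avg_def)
    then have "avg sm_k e (\<lambda>x. f x - H (u x)) x - avg sm_k e (\<lambda>x. f x - H (v x)) x \<le> lam * avg sm_k e ?w x"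
      using elim(2,3) by simp
    then have "e\<^sup>2 * (avg sm_k e (\<lambda>x. f x - H (u x)) x - avg sm_k e (\<lambda>x. f x - H (v x)) x) \<le> e\<^sup>2 * (lam * avg sm_k e ?w x)"
      by (rule mult_left_mono) simp
    also have "\<dots> = (e\<^sup>2 * lam) * avg sm_k e ?w x" by simp
    also have "\<dots> \<le> 8 * avg sm_k e ?w x"
      using elim(4) by (intro mult_right_mono e) (simp add: avg_def)
    also have "\<dots> \<le> avg sm_m e v x - avg sm_m e u x" using elim(1,5) by simp
    finally show ?case by (simp add: T_def algebra_simps)
  qed
qed

lemma le_T: "wsub u (\<lambda>x. f x - H (u x)) \<Longrightarrow> AE x in lborel. u x \<le> T u x"
  unfolding T_def by (rule mean_inequality[OF mvpair_sm])

lemma T_le: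
  assumes "wsub (\<lambda>x. - u x) (\<lambda>x. H (u x) - f x)" shows "AE x in lborel. T u x \<le> u x"
  using mean_inequality[OF mvpair_sm assms, of e]
proof eventually_elim
  case (elim x)
  have "avg sm_k e (\<lambda>x. H (u x) - f x) x = - avg sm_k e (\<lambda>x. f x - H (u x)) x"
    unfolding avg_def by (subst Bochner_Integration.integral_minus[symmetric]) simp
  moreover have "avg sm_m e (\<lambda>x. - u x) x = - avg sm_m e u x" by (simp add: avg_def)
  ultimately show ?case using elim by (simp add: T_def)
qed

lemma T_pairing:
  assumes u: "locint u" and \<psi>: "bdsupp \<psi>"
  shows "(\<integral>x. T u x * \<psi> x \<partial>lborel)
    = (\<integral>x. u x * avg sm_m (-e) \<psi> x \<partial>lborel) + e\<^sup>2 * (\<integral>x. (f x - H (u x)) * avg sm_k (-e) \<psi> x \<partial>lborel)"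
proof -
  note r = locint_rhs[OF u]
  have "(\<integral>x. T u x * \<psi> x \<partial>lborel)
      = (\<integral>x. avg sm_m e u x * \<psi> x + e\<^sup>2 * (avg sm_k e (\<lambda>x. f x - H (u x)) x * \<psi> x) \<partial>lborel)"
    by (simp add: T_def algebra_simps)
  also have "\<dots> = (\<integral>x. avg sm_m e u x * \<psi> x \<partial>lborel) + e\<^sup>2 * (\<integral>x. avg sm_k e (\<lambda>x. f x - H (u x)) x * \<psi> x \<partial>lborel)"
    using locint_bdsupp_integrable[OF m.locint_avg[OF u] \<psi>, of e] locint_bdsupp_integrable[OF k.locint_avg[OF r] \<psi>, of e]
    by simp
  finally show ?thesis by (simp add: m.avg_adjoint[OF u \<psi>] k.avg_adjoint[OF r \<psi>])
qed

lemma mv_test: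
  fixes \<phi> :: "real^'n \<Rightarrow> real"
  assumes "test_fun \<phi>" shows "avg sm_m (-e) \<phi> x = \<phi> x + e\<^sup>2 * laplacian (avg sm_k (-e) \<phi>) x"
proof -
  have "avg sm_m (-e) \<phi> x - \<phi> x = (-e)\<^sup>2 * avg sm_k (-e) (laplacian \<phi>) x"
    using mvpair_sm assms unfolding mvpair_def by blast
  then show ?thesis using laplacian_avg[OF k.kernel_axioms assms] by simp
qed

text \<open>Here \<open>sm_m - e\<^sup>2 lam sm_k \<ge> 0\<close> is used to test the inequality for \<open>u\<close>.\<close>
lemma wsub_T:
  assumes w: "wsub u (\<lambda>x. f x - H (u x))"
  shows "wsub (T u) (\<lambda>x. f x - H (T u x))"
proof -
  note u = wsub_locint(1)[OF w]
  note Tu = locint_T[OF u]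
  define h where "h x = f x - H (u x)" for x
  have h: "locint h" unfolding h_def by (rule locint_rhs[OF u])
  \<comment> \<open>For this right-hand side, testing T u with \<phi> is exactly testing
    \<open>u\<close> with the function \<psi> below. It lies under the desired one because
    \<open>H\<close> is Lipschitz and u \<le> T u.\<close>
  have "wsub (T u) (\<lambda>x. h x + (lam * u x + (- lam) * T u x))"
    unfolding wsub_def
  proof (intro conjI Tu locint_add[OF h locint_lincomb[OF u Tu]] allI impI)
    fix \<phi> :: "real^'n \<Rightarrow> real" assume \<phi>: "test_fun \<phi>" and nn: "\<forall>x. 0 \<le> \<phi> x"
    note b = bdsupp_test[OF \<phi>] and bl = bdsupp_laplacian[OF \<phi>]
    let ?M = "avg sm_m (-e) \<phi>" and ?K = "avg sm_k (-e) \<phi>"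
    have tM: "test_fun ?M" and tK: "test_fun ?K"
      by (intro test_fun_avg m.kernel_axioms k.kernel_axioms \<phi>)+
    \<comment> \<open>This is (m_(-e) - e^2 lam k_(-e)) * \<phi>, nonnegative by the comparison of
      the kernels.\<close>
    define \<psi> where "\<psi> x = 1 * ?M x + (- (e\<^sup>2 * lam)) * ?K x" for x
    have t\<psi>: "test_fun \<psi>" unfolding \<psi>_def by (rule test_fun_lincomb[OF tM tK])
    have nn\<psi>: "0 \<le> \<psi> x" for x
    proof -
      have "8 * ?K x \<le> ?M x"
        by (rule sm_k_le_sm_m_at) (use nn bdsupp_measurable[OF b] m.integrable_bdsupp[OF b, of x "-e"]
            k.integrable_bdsupp[OF b, of x "-e"] in auto)
      moreover have "0 \<le> ?K x" using nn by (intro k.avg_nonneg) auto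
      moreover from this have "e\<^sup>2 * lam * ?K x \<le> 8 * ?K x" by (intro mult_right_mono e)
      ultimately show ?thesis by (simp add: \<psi>_def)
    qed
    note int = locint_bdsupp_integrable
    define A where "A = (\<integral>x. u x * laplacian ?M x \<partial>lborel)"
    define B where "B = (\<integral>x. u x * laplacian ?K x \<partial>lborel)"
    define P where "P = (\<integral>x. h x * ?M x \<partial>lborel)"
    define Q where "Q = (\<integral>x. h x * ?K x \<partial>lborel)"
    define F where "F = (\<integral>x. h x * \<phi> x \<partial>lborel)"
    define G where "G = (\<integral>x. h x * laplacian ?K x \<partial>lborel)"
    define L where "L = (\<integral>x. u x * \<phi> x \<partial>lborel)"
    define S where "S = (\<integral>x. u x * ?M x \<partial>lborel)"
    have sm: "smooth ?M" "smooth ?K" using tM tK by (auto simp: test_fun_def)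
    have "0 \<le> (\<integral>x. u x * laplacian \<psi> x \<partial>lborel) + (\<integral>x. h x * \<psi> x \<partial>lborel)"
      using wsubD[OF w t\<psi> nn\<psi>] by (simp add: h_def)
    also have "(\<integral>x. u x * laplacian \<psi> x \<partial>lborel) = (\<integral>x. u x * laplacian ?M x - (e\<^sup>2 * lam) * (u x * laplacian ?K x) \<partial>lborel)"
      unfolding \<psi>_def[abs_def] laplacian_lincomb[OF sm] by (simp add: algebra_simps)
    also have "\<dots> = A - e\<^sup>2 * lam * B"
      using int[OF u bdsupp_laplacian[OF tM]] int[OF u bdsupp_laplacian[OF tK]] by (simp add: A_def B_def)
    also have "(\<integral>x. h x * \<psi> x \<partial>lborel) = (\<integral>x. h x * ?M x - (e\<^sup>2 * lam) * (h x * ?K x) \<partial>lborel)"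
      unfolding \<psi>_def[abs_def] by (simp add: algebra_simps)
    also have "\<dots> = P - e\<^sup>2 * lam * Q"
      using int[OF h bdsupp_test[OF tM]] int[OF h bdsupp_test[OF tK]] by (simp add: P_def Q_def)
    finally have ineq: "0 \<le> A - e\<^sup>2 * lam * B + (P - e\<^sup>2 * lam * Q)" .
    have SB: "S = L + e\<^sup>2 * B"
    proof -
      have "S = (\<integral>x. u x * \<phi> x + e\<^sup>2 * (u x * laplacian ?K x) \<partial>lborel)"
        unfolding S_def mv_test[OF \<phi>] by (simp add: algebra_simps)
      then show ?thesis using int[OF u b] int[OF u bdsupp_laplacian[OF tK]] by (simp add: L_def B_def)
    qed
    have PG: "P = F + e\<^sup>2 * G"
    proof -
      have "P = (\<integral>x. h x * \<phi> x + e\<^sup>2 * (h x * laplacian ?K x) \<partial>lborel)"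
        unfolding P_def mv_test[OF \<phi>] by (simp add: algebra_simps)
      then show ?thesis using int[OF h b] int[OF h bdsupp_laplacian[OF tK]] by (simp add: F_def G_def)
    qed
    have TL: "(\<integral>x. T u x * laplacian \<phi> x \<partial>lborel) = A + e\<^sup>2 * G"
      unfolding T_pairing[OF u bl] A_def G_def h_def
      by (simp add: laplacian_avg[OF m.kernel_axioms \<phi>] laplacian_avg[OF k.kernel_axioms \<phi>])
    have T\<phi>: "(\<integral>x. T u x * \<phi> x \<partial>lborel) = S + e\<^sup>2 * Q"
      unfolding T_pairing[OF u b] S_def Q_def h_def ..
    have "(\<integral>x. (h x + (lam * u x + (- lam) * T u x)) * \<phi> x \<partial>lborel)
        = (\<integral>x. h x * \<phi> x + (lam * (u x * \<phi> x) - lam * (T u x * \<phi> x)) \<partial>lborel)" by (simp add: algebra_simps)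
    also have "\<dots> = F + (lam * L - lam * (S + e\<^sup>2 * Q))"
      using int[OF h b] int[OF u b] int[OF Tu b] by (simp add: F_def L_def T\<phi>)
    finally have "(\<integral>x. T u x * laplacian \<phi> x \<partial>lborel) + (\<integral>x. (h x + (lam * u x + (- lam) * T u x)) * \<phi> x \<partial>lborel)
       = A + e\<^sup>2 * G + (F + (lam * L - lam * (S + e\<^sup>2 * Q)))" by (simp add: TL)
    also have "\<dots> = A - e\<^sup>2 * lam * B + (P - e\<^sup>2 * lam * Q)" by (simp add: SB PG algebra_simps)
    finally show "0 \<le> (\<integral>x. T u x * laplacian \<phi> x \<partial>lborel) + (\<integral>x. (h x + (lam * u x + (- lam) * T u x)) * \<phi> x \<partial>lborel)"
      using ineq by simp
  qed
  then show ?thesis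
  proof (rule wsub_mono)
    show "locint (\<lambda>x. f x - H (T u x))" by (rule locint_rhs[OF Tu])
    show "AE x in lborel. h x + (lam * u x + (- lam) * T u x) \<le> f x - H (T u x)"
      using le_T[OF w]
    proof eventually_elim
      case (elim x)
      then show ?case using H_lip[of "u x" "T u x"] by (simp add: h_def algebra_simps)
    qed
  qed
qed

end

text \<open>A bump positive at the origin, dilated until it is nearly constant on the ball. It
  serves as majorant: a large multiple of it added to a test function supported in that ball gives a
  nonnegative one.\<close>

lemma test_fun_positive_on_ball:
  obtains \<phi> :: "real^'n::finite \<Rightarrow> real" where "test_fun \<phi>" "\<And>x. 0 \<le> \<phi> x" "\<And>x. norm x \<le> R \<Longrightarrow> 1 \<le> \<phi> x"
proof -
  have "isCont (bump :: real^'n \<Rightarrow> real) 0"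
    using continuous_test_fun[OF test_fun_bump[where 'n = 'n], of UNIV] by (simp add: continuous_on_eq_continuous_at)
  then have "\<forall>\<^sub>F x in at 0. bump (x :: real^'n) > bump (0 :: real^'n) / 2"
    unfolding isCont_def by (rule order_tendstoD) (use bump_pos[where 'a = 'n] in simp)
  then obtain d where d: "d > 0" "\<And>x::real^'n. x \<noteq> 0 \<Longrightarrow> dist x 0 < d \<Longrightarrow> bump x > bump (0 :: real^'n) / 2"
    unfolding eventually_at by blast
  have b: "bump x \<ge> bump (0 :: real^'n) / 2" if "norm x < d" for x :: "real^'n"
    using d(2)[of x] that bump_nonneg[of "0 :: real^'n"] by (cases "x = 0") (auto simp: dist_norm)
  define c where "c = d / (2 * (\<bar>R\<bar> + 1))"
  have c: "c > 0" using d by (simp add: c_def)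
  define b0 where "b0 = bump (0 :: real^'n)"
  have b0: "b0 > 0" using bump_pos by (simp add: b0_def)
  \<comment> \<open>The vanishing second summand puts the multiple into the shape of
    \<open>test_fun_lincomb\<close>.\<close>
  define \<phi> :: "real^'n \<Rightarrow> real" where "\<phi> x = (2 / b0) * bump (c *\<^sub>R x + 0) + 0 * bump (c *\<^sub>R x + 0)" for x
  have "test_fun \<phi>" unfolding \<phi>_def using c by (intro test_fun_lincomb test_fun_affine test_fun_bump) auto
  moreover have "0 \<le> \<phi> x" for x using b0 bump_nonneg[of "c *\<^sub>R x"] by (simp add: \<phi>_def)
  moreover have "1 \<le> \<phi> x" if "norm x \<le> R" for x
  proof -
    have "norm (c *\<^sub>R x) \<le> c * \<bar>R\<bar>" using that c by (auto intro: mult_left_mono)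
    also have "\<dots> < c * (2 * (\<bar>R\<bar> + 1))" using c by (intro mult_strict_left_mono) auto
    also have "\<dots> = d" by (simp add: c_def)
    finally have "b0 / 2 \<le> bump (c *\<^sub>R x)" using b unfolding b0_def by blast
    then show ?thesis using b0 by (simp add: \<phi>_def field_simps)
  qed
  ultimately show ?thesis using that by blast
qed

context lipschitz_problem
begin

text \<open>The iterates of \<open>T\<close> from \<open>W\<close> increase and stay below every
  supersolution above \<open>W\<close>, which gives the limit and its minimality. The limit is a
  subsolution because all iterates are; the opposite inequality is obtained from the fixed point
  identity by domination.\<close>

lemma minimal_solution_exists:
  assumes W: "wsub W (\<lambda>x. f x - H (W x))" and Z: "wsub (\<lambda>x. - Z x) (\<lambda>x. H (Z x) - f x)"
    and WZ: "AE x in lborel. W x \<le> Z x"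
  shows "\<exists>u. weq u (\<lambda>x. f x - H (u x)) \<and> (AE x in lborel. W x \<le> u x) \<and>
    (\<forall>Y. wsub (\<lambda>x. - Y x) (\<lambda>x. H (Y x) - f x) \<longrightarrow> (AE x in lborel. W x \<le> Y x) \<longrightarrow> (AE x in lborel. u x \<le> Y x))"
proof -
  define w where "w n = (T ^^ n) W" for n
  have w0: "w 0 = W" and wS: "w (Suc n) = T (w n)" for n by (auto simp: w_def)
  have wsubw: "wsub (w n) (\<lambda>x. f x - H (w n x))" for n
    by (induction n) (auto simp: w0 wS W intro: wsub_T)
  note lw = wsub_locint(1)[OF wsubw]
  have inc: "AE x in lborel. w n x \<le> w (Suc n) x" for n unfolding wS by (rule le_T[OF wsubw])
  have upper: "AE x in lborel. w n x \<le> Y x"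
    if Y: "wsub (\<lambda>x. - Y x) (\<lambda>x. H (Y x) - f x)" "AE x in lborel. W x \<le> Y x" for Y n
  proof (induction n)
    case 0 then show ?case using Y by (simp add: w0)
  next
    case (Suc n)
    have "locint Y" using locint_uminus[OF wsub_locint(1)[OF Y(1)]] by simp
    from T_mono[OF lw this Suc] T_le[OF Y(1)] show ?case unfolding wS by eventually_elim simp
  qed
  have Zl: "locint Z" using locint_uminus[OF wsub_locint(1)[OF Z]] by simp
  have incA: "AE x in lborel. \<forall>n. w n x \<le> w (Suc n) x" using inc by (simp add: AE_all_countable)
  have uppA: "AE x in lborel. \<forall>n. w n x \<le> Z x" using upper[OF Z WZ] by (simp add: AE_all_countable)
  define u where "u x = lim (\<lambda>n. w n x)" for x
  have [measurable]: "w n \<in> borel_measurable borel" for n using lw by (rule locint_measurable)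
  have um[measurable]: "u \<in> borel_measurable borel" unfolding u_def by measurable
  have lim: "AE x in lborel. (\<lambda>n. w n x) \<longlonglongrightarrow> u x" and Wle: "AE x in lborel. \<forall>n. W x \<le> w n x"
  proof -
    have "AE x in lborel. (\<lambda>n. w n x) \<longlonglongrightarrow> u x \<and> (\<forall>n. W x \<le> w n x)" using incA uppA
    proof eventually_elim
      case (elim x)
      have i: "incseq (\<lambda>n. w n x)" using elim by (intro incseq_SucI) auto
      have "convergent (\<lambda>n. w n x)"
        using incseq_convergent[OF i, of "Z x"] elim by (metis convergentI)
      moreover have "\<forall>n. W x \<le> w n x" using incseqD[OF i, of 0] by (simp add: w0)
      ultimately show ?case by (simp add: u_def convergent_LIMSEQ_iff)
    qed
    then show "AE x in lborel. (\<lambda>n. w n x) \<longlonglongrightarrow> u x" "AE x in lborel. \<forall>n. W x \<le> w n x" by auto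
  qed
  define b where "b x = \<bar>W x\<bar> + \<bar>Z x\<bar>" for x
  have b: "locint b" unfolding b_def by (intro locint_add locint_abs Zl wsub_locint(1)[OF W])
  have bd: "AE x in lborel. \<bar>w n x\<bar> \<le> b x" for n using uppA Wle
  proof eventually_elim
    case (elim x)
    then have "W x \<le> w n x" "w n x \<le> Z x" by auto
    then show ?case by (auto simp: b_def)
  qed
  define c where "c x = \<bar>f x\<bar> + (\<bar>H 0\<bar> + lam * b x)" for x
  have c: "locint c" unfolding c_def by (intro locint_add locint_abs locint_const locint_cmult f b)
  have bdh: "AE x in lborel. \<bar>f x - H (w n x)\<bar> \<le> c x" for n using bd[of n]
  proof eventually_elim
    case (elim x)
    have "lam * \<bar>w n x\<bar> \<le> lam * b x" using elim by (rule mult_left_mono[OF _ lam])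
    then show ?case using H_bound[of "w n x"] by (simp add: c_def)
  qed
  have contH: "isCont H s" for s
  proof -
    have "\<bar>H t - H s\<bar> \<le> lam * \<bar>t - s\<bar>" for t
      using H_lip[of s t] H_lip[of t s] monoD[OF H_mono, of s t] monoD[OF H_mono, of t s] by (cases "s \<le> t") auto
    then have "\<forall>\<^sub>F t in at s. norm (H t - H s) \<le> lam * \<bar>t - s\<bar>" by simp
    moreover have "((\<lambda>t. lam * \<bar>t - s\<bar>) \<longlongrightarrow> 0) (at s)"
      by (intro tendsto_mult_right_zero tendsto_rabs_zero) (simp add: LIM_zero)
    ultimately have "((\<lambda>t. H t - H s) \<longlongrightarrow> 0) (at s)" by (rule Lim_null_comparison)
    then show ?thesis unfolding isCont_def by (rule LIM_zero_cancel)
  qed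
  have limh: "AE x in lborel. (\<lambda>n. f x - H (w n x)) \<longlonglongrightarrow> f x - H (u x)"
    using lim by eventually_elim (intro tendsto_diff tendsto_const isCont_tendsto_compose[OF contH])
  have fm[measurable]: "f \<in> borel_measurable borel" by (rule locint_measurable[OF f])
  have hm: "(\<lambda>x. f x - H (u x)) \<in> borel_measurable borel" "(\<lambda>x. f x - H (w n x)) \<in> borel_measurable borel" for n by measurable
  have su: "wsub u (\<lambda>x. f x - H (u x))" by (rule wsub_limit[OF wsubw um b bd lim hm(1) c bdh limh])
  note ul = wsub_locint(1)[OF su]
  define \<Lambda> where "\<Lambda> \<psi> = (\<integral>x. u x * laplacian \<psi> x \<partial>lborel) + (\<integral>x. (f x - H (u x)) * \<psi> x \<partial>lborel)" for \<psi>
  \<comment> \<open>Passing to the limit in w (n+1) = T (w n) and inserting the mean value identity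
    for \<phi> leaves the functional evaluated at an averaged test function only.\<close>
  have fixK: "\<Lambda> (avg sm_k (-e) \<phi>) = 0" if \<phi>: "test_fun \<phi>" for \<phi>
  proof -
    note bp = bdsupp_test[OF \<phi>]
    note tK = test_fun_avg[OF k.kernel_axioms \<phi>, of "-e"]
    have "(\<lambda>n. \<integral>x. w (Suc n) x * \<phi> x \<partial>lborel) \<longlonglongrightarrow> (\<integral>x. u x * \<phi> x \<partial>lborel)"
      by (rule LIMSEQ_Suc, rule dominated_pairing[OF _ um b bd lim bp]) measurable
    moreover have "(\<lambda>n. \<integral>x. w (Suc n) x * \<phi> x \<partial>lborel) \<longlonglongrightarrow>
      (\<integral>x. u x * avg sm_m (-e) \<phi> x \<partial>lborel) + e\<^sup>2 * (\<integral>x. (f x - H (u x)) * avg sm_k (-e) \<phi> x \<partial>lborel)"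
      unfolding wS T_pairing[OF lw bp]
      by (intro tendsto_add tendsto_mult tendsto_const dominated_pairing[OF _ um b bd lim]
          dominated_pairing[OF hm(2) hm(1) c bdh limh] m.avg_bdsupp k.avg_bdsupp bp) measurable
    ultimately have "(\<integral>x. u x * \<phi> x \<partial>lborel) = (\<integral>x. u x * avg sm_m (-e) \<phi> x \<partial>lborel)
        + e\<^sup>2 * (\<integral>x. (f x - H (u x)) * avg sm_k (-e) \<phi> x \<partial>lborel)"
      by (rule LIMSEQ_unique)
    also have "(\<integral>x. u x * avg sm_m (-e) \<phi> x \<partial>lborel)
      = (\<integral>x. u x * \<phi> x + e\<^sup>2 * (u x * laplacian (avg sm_k (-e) \<phi>) x) \<partial>lborel)"
      unfolding mv_test[OF \<phi>] by (simp add: algebra_simps)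
    also have "\<dots> = (\<integral>x. u x * \<phi> x \<partial>lborel) + e\<^sup>2 * (\<integral>x. u x * laplacian (avg sm_k (-e) \<phi>) x \<partial>lborel)"
      using locint_bdsupp_integrable[OF ul bp] locint_bdsupp_integrable[OF ul bdsupp_laplacian[OF tK]] by simp
    finally have "e\<^sup>2 * \<Lambda> (avg sm_k (-e) \<phi>) = 0" by (simp add: \<Lambda>_def algebra_simps)
    then show ?thesis using e by simp
  qed
  have "wsub (\<lambda>x. - u x) (\<lambda>x. - (f x - H (u x)))"
    unfolding wsub_def
  proof (intro conjI locint_uminus ul locint_rhs allI impI)
    fix \<psi> :: "real^'n \<Rightarrow> real" assume \<psi>: "test_fun \<psi>" and nn: "\<forall>x. 0 \<le> \<psi> x"
    obtain B R where B: "B > 0" "R > 0" "\<And>x. \<bar>\<psi> x\<bar> \<le> B" "\<And>x. norm x > R \<Longrightarrow> \<psi> x = 0"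
      using bdsuppE[OF bdsupp_test[OF \<psi>]] by metis
    obtain \<phi> :: "real^'n \<Rightarrow> real" where \<phi>: "test_fun \<phi>" "\<And>x. 0 \<le> \<phi> x" "\<And>x. norm x \<le> R + e \<Longrightarrow> 1 \<le> \<phi> x"
      using test_fun_positive_on_ball[of "R + e"] by metis
    let ?K = "avg sm_k (-e) \<phi>"
    define \<kappa> where "\<kappa> = measure sm_k (space (sm_k :: (real^'n) measure))"
    have \<kappa>: "\<kappa> > 0" unfolding \<kappa>_def by (rule measure_sm_k_pos)
    have Knn: "0 \<le> ?K x" for x by (intro k.avg_nonneg \<phi>)
    have K1: "\<kappa> \<le> ?K x" if x: "norm x \<le> R" for x
    proof -
      have "(\<integral>y. 1 \<partial>(sm_k :: (real^'n) measure)) \<le> ?K x" unfolding avg_def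
      proof (rule integral_mono_AE)
        show "AE y in sm_k. 1 \<le> \<phi> (x + (-e) *\<^sub>R y)" using k.supp
        proof eventually_elim
          case (elim y)
          have "norm (e *\<^sub>R y) \<le> e" using elim e by simp
          then show ?case using norm_triangle_ineq4[of x "e *\<^sub>R y"] x by (intro \<phi>(3)) simp
        qed
      qed (use k.integrable_bdsupp[OF bdsupp_test[OF \<phi>(1)], of x "-e"] in auto)
      then show ?thesis by (simp add: \<kappa>_def)
    qed
    define C where "C = B / \<kappa>"
    \<comment> \<open>The average of a cutoff is at least \<kappa> on the support of \<psi>, so
      \<omega> is nonnegative and 0 \<le> \<Lambda> \<omega> = C \<Lambda> K - \<Lambda> \<psi> = -
      \<Lambda> \<psi>.\<close>
    define \<omega> where "\<omega> x = C * ?K x + (-1) * \<psi> x" for x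
    have tK: "test_fun ?K" by (rule test_fun_avg[OF k.kernel_axioms \<phi>(1)])
    have t\<omega>: "test_fun \<omega>" unfolding \<omega>_def by (rule test_fun_lincomb[OF tK \<psi>])
    have \<omega>nn: "0 \<le> \<omega> x" for x
    proof (cases "norm x \<le> R")
      case True
      have "B \<le> C * ?K x" using K1[OF True] B \<kappa> by (simp add: C_def field_simps)
      then show ?thesis using B(3)[of x] by (simp add: \<omega>_def)
    next
      case False
      then show ?thesis using B \<kappa> Knn[of x] by (simp add: \<omega>_def C_def)
    qed
    have sm: "smooth ?K" "smooth \<psi>" using tK \<psi> by (auto simp: test_fun_def)
    note int = locint_bdsupp_integrable
    note i = int[OF ul bdsupp_laplacian[OF tK]] int[OF ul bdsupp_laplacian[OF \<psi>]]
      int[OF locint_rhs[OF ul] bdsupp_test[OF tK]] int[OF locint_rhs[OF ul] bdsupp_test[OF \<psi>]]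
    have "0 \<le> \<Lambda> \<omega>" unfolding \<Lambda>_def by (rule wsubD[OF su t\<omega> \<omega>nn])
    also have "\<Lambda> \<omega> = (\<integral>x. C * (u x * laplacian ?K x) - u x * laplacian \<psi> x \<partial>lborel)
        + (\<integral>x. C * ((f x - H (u x)) * ?K x) - (f x - H (u x)) * \<psi> x \<partial>lborel)"
      unfolding \<Lambda>_def \<omega>_def[abs_def] laplacian_lincomb[OF sm] by (simp add: algebra_simps)
    also have "\<dots> = C * \<Lambda> ?K - \<Lambda> \<psi>" using i by (simp add: \<Lambda>_def distrib_left)
    finally have "\<Lambda> \<psi> \<le> 0" using fixK[OF \<phi>(1)] by simp
    moreover have "(\<integral>x. - u x * laplacian \<psi> x \<partial>lborel) + (\<integral>x. - (f x - H (u x)) * \<psi> x \<partial>lborel) = - \<Lambda> \<psi>"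
      unfolding \<Lambda>_def mult_minus_left Bochner_Integration.integral_minus by simp
    ultimately show "0 \<le> (\<integral>x. - u x * laplacian \<psi> x \<partial>lborel) + (\<integral>x. - (f x - H (u x)) * \<psi> x \<partial>lborel)" by simp
  qed
  with su have "weq u (\<lambda>x. f x - H (u x))" by (simp add: weq_def)
  moreover have "AE x in lborel. W x \<le> u x" using Wle lim
    by eventually_elim (rule LIMSEQ_le_const, auto)
  moreover have "AE x in lborel. u x \<le> Y x"
    if Y: "wsub (\<lambda>x. - Y x) (\<lambda>x. H (Y x) - f x)" "AE x in lborel. W x \<le> Y x" for Y
  proof -
    have "AE x in lborel. \<forall>n. w n x \<le> Y x" using upper[OF Y] by (simp add: AE_all_countable)
    then show ?thesis using lim by eventually_elim (rule LIMSEQ_le_const2, auto)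
  qed
  ultimately show ?thesis by blast
qed

end

lemma lipschitz_minimal_solution:
  fixes f :: "real^'n::finite \<Rightarrow> real"
  assumes "mono H" "\<And>s t. s \<le> t \<Longrightarrow> H t - H s \<le> lam * (t - s)" "locint f"
    and "wsub W (\<lambda>x. f x - H (W x))" "wsub (\<lambda>x. - Z x) (\<lambda>x. H (Z x) - f x)"
    and "AE x in lborel. W x \<le> Z x"
  shows "\<exists>u. weq u (\<lambda>x. f x - H (u x)) \<and> (AE x in lborel. W x \<le> u x) \<and>
    (\<forall>Y. wsub (\<lambda>x. - Y x) (\<lambda>x. H (Y x) - f x) \<longrightarrow> (AE x in lborel. W x \<le> Y x) \<longrightarrow> (AE x in lborel. u x \<le> Y x))"
proof -
  \<comment> \<open>The absolute value and the 1 keep the scale well defined for any sign of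
    \<open>lam\<close>, and e^2 \<bar>lam\<bar> stays below 8.\<close>
  define e where "e = sqrt (8 / (\<bar>lam\<bar> + 1))"
  have "lipschitz_problem H \<bar>lam\<bar> e f"
  proof
    fix s t :: real assume "s \<le> t"
    then have "lam * (t - s) \<le> \<bar>lam\<bar> * (t - s)" by (intro mult_right_mono) auto
    then show "H t - H s \<le> \<bar>lam\<bar> * (t - s)" using assms(2)[OF \<open>s \<le> t\<close>] by simp
  qed (use assms in \<open>auto simp: e_def field_simps\<close>)
  then show ?thesis by (rule lipschitz_problem.minimal_solution_exists) (use assms in auto)
qed

section \<open>Lipschitz approximation by infimal convolution\<close>

text \<open>The largest j-Lipschitz function below \<open>g\<close>, when \<open>g\<close> is
  bounded below (the Pasch-Hausdorff envelope).\<close>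

definition infconv :: "(real \<Rightarrow> real) \<Rightarrow> real \<Rightarrow> real \<Rightarrow> real" where
  "infconv g j s = (INF t. g t + j * \<bar>s - t\<bar>)"

locale bounded_below =
  fixes g :: "real \<Rightarrow> real" and b :: real
  assumes g_cont: "continuous_on UNIV g" and g_mono: "mono g" and g_lower: "\<And>s. - b \<le> g s" and b_nonneg: "0 \<le> b"
begin

lemma infconv_bdd: "0 \<le> j \<Longrightarrow> bdd_below (range (\<lambda>t. g t + j * \<bar>s - t\<bar>))"
  by (rule bdd_belowI[of _ "- b"]) (use g_lower in \<open>auto intro: add_increasing2\<close>)

lemma infconv_le: "0 \<le> j \<Longrightarrow> infconv g j s \<le> g t + j * \<bar>s - t\<bar>"
  unfolding infconv_def by (rule cINF_lower[OF infconv_bdd]) auto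

lemma infconv_le_self: "0 \<le> j \<Longrightarrow> infconv g j s \<le> g s"
  using infconv_le[of j s s] by simp

lemma infconv_greatest: "(\<And>t. c \<le> g t + j * \<bar>s - t\<bar>) \<Longrightarrow> c \<le> infconv g j s"
  unfolding infconv_def by (rule cINF_greatest) auto

lemma infconv_lower: "0 \<le> j \<Longrightarrow> - b \<le> infconv g j s"
  by (rule infconv_greatest) (use g_lower in \<open>auto intro: add_increasing2\<close>)

lemma infconv_slope_mono:
  assumes "0 \<le> j" "j \<le> j'" shows "infconv g j s \<le> infconv g j' s"
proof (rule infconv_greatest)
  fix t
  have "j * \<bar>s - t\<bar> \<le> j' * \<bar>s - t\<bar>" by (intro mult_right_mono assms) auto
  then show "infconv g j s \<le> g t + j' * \<bar>s - t\<bar>" using infconv_le[OF assms(1), of s t] by linarith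
qed

text \<open>A competitor for the larger point, shifted left by the difference of the points, keeps
  its distance and does not increase \<open>g\<close>.\<close>

lemma infconv_mono: assumes "0 \<le> j" shows "mono (infconv g j)"
proof (rule monoI)
  fix s s' :: real assume le: "s \<le> s'"
  show "infconv g j s \<le> infconv g j s'"
  proof (rule infconv_greatest)
    fix t
    have "infconv g j s \<le> g (t - (s' - s)) + j * \<bar>s - (t - (s' - s))\<bar>" by (rule infconv_le[OF assms])
    also have "\<bar>s - (t - (s' - s))\<bar> = \<bar>s' - t\<bar>" by simp
    also have "g (t - (s' - s)) \<le> g t" using le by (intro monoD[OF g_mono]) simp
    finally show "infconv g j s \<le> g t + j * \<bar>s' - t\<bar>" by simp
  qed
qed

lemma infconv_lipschitz:
  assumes "0 \<le> j" "s \<le> s'" shows "infconv g j s' - infconv g j s \<le> j * (s' - s)"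
proof -
  have "infconv g j s' - j * (s' - s) \<le> infconv g j s"
  proof (rule infconv_greatest)
    fix t
    have "j * \<bar>s' - t\<bar> \<le> j * (\<bar>s - t\<bar> + (s' - s))" using assms by (intro mult_left_mono) auto
    then show "infconv g j s' - j * (s' - s) \<le> g t + j * \<bar>s - t\<bar>"
      using infconv_le[OF assms(1), of s' t] by (simp add: algebra_simps)
  qed
  then show ?thesis by simp
qed

text \<open>Competitors right of s - \<delta> lose at most r/2 by continuity and monotonicity; those
  farther left pay at least j \<delta>, which exceeds g s + b for large \<open>j\<close>.\<close>

lemma infconv_tendsto: "(\<lambda>j. infconv g (real (Suc j)) s) \<longlonglongrightarrow> g s"
proof (rule LIMSEQ_I)
  fix r :: real assume r: "r > 0"
  have "isCont g s" using g_cont by (simp add: continuous_on_eq_continuous_at)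
  then obtain d where d: "d > 0" "\<And>t. dist t s < d \<Longrightarrow> dist (g t) (g s) < r / 2"
    unfolding continuous_at_eps_delta using r by (metis half_gt_zero)
  define \<delta> where "\<delta> = d / 2"
  have \<delta>: "\<delta> > 0" "g s - r / 2 \<le> g (s - \<delta>)"
  proof -
    show "\<delta> > 0" using d by (simp add: \<delta>_def)
    have "dist (g (s - \<delta>)) (g s) < r / 2" using d by (intro d(2)) (simp add: \<delta>_def dist_real_def)
    then show "g s - r / 2 \<le> g (s - \<delta>)" by (auto simp: dist_real_def abs_if split: if_splits)
  qed
  obtain N :: nat where N: "(g s + b) / \<delta> \<le> N" using real_arch_simple by blast
  have "norm (infconv g (real (Suc j)) s - g s) < r" if "N \<le> j" for j
  proof -
    have "g s - r / 2 \<le> infconv g (real (Suc j)) s"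
    proof (rule infconv_greatest)
      fix t
      show "g s - r / 2 \<le> g t + real (Suc j) * \<bar>s - t\<bar>"
      proof (cases "s - \<delta> \<le> t")
        case True
        then have "g (s - \<delta>) \<le> g t" by (rule monoD[OF g_mono])
        then show ?thesis using \<delta>(2) by (simp add: add_increasing2)
      next
        case False
        have "(g s + b) / \<delta> \<le> real (Suc j)" using N that by linarith
        then have "g s + b \<le> real (Suc j) * \<delta>" using \<delta>(1) by (simp add: field_simps)
        also have "\<dots> \<le> real (Suc j) * \<bar>s - t\<bar>" using False by (intro mult_left_mono) auto
        finally show ?thesis using g_lower[of t] r by linarith
      qed
    qed
    then show ?thesis using infconv_le_self[of "real (Suc j)" s] r by simp
  qed
  then show "\<exists>no. \<forall>n\<ge>no. norm (infconv g (real (Suc n)) s - g s) < r" by blast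
qed

text \<open>The approximate solutions decrease in the slope parameter, so only limits from above
  matter; monotonicity squeezes the value between the envelope at the limit and \<open>g\<close> at
  the moving point.\<close>

lemma infconv_tendsto_from_above:
  assumes s: "s \<longlonglongrightarrow> s0" and le: "\<And>j. s0 \<le> s j"
  shows "(\<lambda>j. infconv g (real (Suc j)) (s j)) \<longlonglongrightarrow> g s0"
proof (rule tendsto_sandwich[OF _ _ infconv_tendsto[of s0]])
  show "\<forall>\<^sub>F j in sequentially. infconv g (real (Suc j)) s0 \<le> infconv g (real (Suc j)) (s j)"
    by (intro always_eventually allI monoD[OF infconv_mono] le) simp
  show "\<forall>\<^sub>F j in sequentially. infconv g (real (Suc j)) (s j) \<le> g (s j)"
    by (intro always_eventually allI infconv_le_self) simp
  have "isCont g s0" using g_cont by (simp add: continuous_on_eq_continuous_at)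
  then show "(\<lambda>j. g (s j)) \<longlonglongrightarrow> g s0" using s by (rule isCont_tendsto_compose)
qed

text \<open>The point \<open>M\<close> is the same for all slopes \<ge> 1; it provides a constant
  supersolution uniform in the approximation.\<close>

lemma infconv_large:
  assumes unb: "C \<le> g t" and "1 \<le> j" and M: "\<bar>t\<bar> + \<bar>C\<bar> + b \<le> M" shows "C \<le> infconv g j M"
proof (rule infconv_greatest)
  fix x
  show "C \<le> g x + j * \<bar>M - x\<bar>"
  proof (cases "t \<le> x")
    case True
    then show ?thesis using monoD[OF g_mono True] unb assms(2) by (simp add: add_increasing2)
  next
    case False
    have "1 * (\<bar>C\<bar> + b) \<le> j * \<bar>M - x\<bar>" using False M assms(2) b_nonneg by (intro mult_mono) auto
    then have "\<bar>C\<bar> + b \<le> j * \<bar>M - x\<bar>" by simp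
    then show ?thesis using g_lower[of x] abs_ge_self[of C] by linarith
  qed
qed

end

section \<open>Consequences of the Keller--Osserman condition\<close>

text \<open>The dyadic form of the integral condition: up to a constant factor the terms are the
  radii consumed by successive halvings.\<close>

definition ko_summable :: "(real \<Rightarrow> real) \<Rightarrow> bool" where
  "ko_summable g \<longleftrightarrow> (\<forall>t>0. 0 < g t) \<and> (\<forall>a>0. summable (\<lambda>k. sqrt (2 ^ k * a / g (2 ^ k * a))))"

text \<open>If g t were not positive, \<open>g\<close> and its primitive would vanish on [0, t], and
  the integrand, which is infinite where the primitive is zero, would have infinite integral over
  [t/2, t].\<close>

lemma keller_osserman_pos:
  assumes ko: "keller_osserman g" and mono: "mono g" and g0: "0 \<le> g 0" and t: "t > 0"
  shows "0 < g t"
proof (rule ccontr)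
  assume "\<not> 0 < g t"
  then have z: "g s = 0" if "0 \<le> s" "s \<le> t" for s
    using monoD[OF mono, of 0 s] monoD[OF mono, of s t] g0 that by linarith
  have G: "integral {0..s} g = 0" if "0 \<le> s" "s \<le> t" for s
  proof -
    have "integral {0..s} g = integral {0..s} (\<lambda>_. 0::real)"
      by (rule Henstock_Kurzweil_Integration.integral_cong) (use z that in auto)
    then show ?thesis by simp
  qed
  have "(\<integral>\<^sup>+ s. \<infinity> * indicator {t/2..t} s \<partial>lborel)
      \<le> (\<integral>\<^sup>+ s. indicator {t/2..} s * inverse (ennreal (sqrt (integral {0..s} g))) \<partial>lborel)"
    by (intro nn_integral_mono) (use t G in \<open>auto simp: indicator_def\<close>)
  also have "\<dots> < \<infinity>" using ko t unfolding keller_osserman_def by (metis half_gt_zero)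
  finally have "(\<integral>\<^sup>+ s. \<infinity> * indicator {t/2..t} s \<partial>lborel) < \<infinity>" .
  moreover have "(\<integral>\<^sup>+ s. \<infinity> * indicator {t/2..t} s \<partial>lborel) = \<infinity> * emeasure lborel {t/2..t}"
    by (rule nn_integral_cmult_indicator) simp
  ultimately show False using t by (simp add: ennreal_top_mult)
qed

text \<open>On the dyadic interval from s_k to s_(k+1) the primitive is at most s_(k+1) g(s_(k+1)).
  The interval has length s_(k+1)/2, so it contributes at least half of the (k+1)-st term to the
  integral.\<close>

lemma keller_osserman_summable:
  assumes ko: "keller_osserman g" and cont: "continuous_on UNIV g" and mono: "mono g" and g0: "0 \<le> g 0"
  shows "ko_summable g"
  unfolding ko_summable_def
proof (intro conjI allI impI)
  show "0 < g t" if "0 < t" for t by (rule keller_osserman_pos[OF ko mono g0 that])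
  note pos = this
  fix a :: real assume a: "a > 0"
  define s where "s k = 2 ^ k * a" for k :: nat
  have s: "0 < s k" "s (Suc k) = 2 * s k" "a \<le> s k" for k using a by (auto simp: s_def mult_le_cancel_right1)
  \<comment> \<open>The shift by one bounds the primitive by the right endpoint; the missing first
    term does not affect summability.\<close>
  define c where "c k = sqrt (s (Suc k) / g (s (Suc k)))" for k
  have c0: "0 \<le> c k" for k unfolding c_def using s pos[of "s (Suc k)"] by (simp add: less_imp_le)
  let ?F = "\<lambda>t. inverse (ennreal (sqrt (integral {0..t} g)))"
  have low: "ennreal (c k / s (Suc k)) \<le> ?F t" if t: "s k \<le> t" "t < s (Suc k)" for k t
  proof -
    have t0: "0 < t" using s(1)[of k] t by linarith
    have "integral {0..t} g \<le> integral {0..t} (\<lambda>_. g (s (Suc k)))"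
    proof (rule integral_le)
      show "g integrable_on {0..t}" by (intro integrable_continuous_interval continuous_on_subset[OF cont]) auto
      show "(\<lambda>_. g (s (Suc k))) integrable_on {0..t}" by (intro integrable_continuous_interval) auto
    qed (use t in \<open>auto intro!: monoD[OF mono]\<close>)
    also have "\<dots> = t * g (s (Suc k))" using t0 by simp
    also have "\<dots> \<le> s (Suc k) * g (s (Suc k))"
      using t pos[of "s (Suc k)"] s(1)[of "Suc k"] by (intro mult_right_mono) auto
    finally have "sqrt (integral {0..t} g) \<le> sqrt (s (Suc k) * g (s (Suc k)))" by simp
    then have "inverse (ennreal (sqrt (s (Suc k) * g (s (Suc k))))) \<le> ?F t"
    proof (cases "sqrt (integral {0..t} g) \<le> 0")
      case True
      then have "ennreal (sqrt (integral {0..t} g)) = 0" by (rule ennreal_neg)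
      then show ?thesis by simp
    next
      case False
      assume le: "sqrt (integral {0..t} g) \<le> sqrt (s (Suc k) * g (s (Suc k)))"
      with False show ?thesis
        by (simp only: inverse_ennreal not_le) (intro ennreal_leI le_imp_inverse_le, auto)
    qed
    moreover have "inverse (ennreal (sqrt (s (Suc k) * g (s (Suc k))))) = ennreal (c k / s (Suc k))"
    proof -
      let ?x = "s (Suc k)" and ?y = "g (s (Suc k))"
      have xy: "?x > 0" "?y > 0" using s pos by auto
      have "inverse (sqrt (?x * ?y)) = sqrt (?x / ?y) / ?x"
        using xy by (simp add: real_sqrt_mult real_sqrt_divide field_simps)
      then show ?thesis using xy by (simp add: inverse_ennreal c_def)
    qed
    ultimately show ?thesis by simp
  qed
  define I where "I = (\<integral>\<^sup>+ t. indicator {a..} t * ?F t \<partial>lborel)"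
  have I: "I < \<infinity>" using ko a unfolding keller_osserman_def I_def by blast
  have disj: "k = l" if "s k \<le> t" "t < s (Suc k)" "s l \<le> t" "t < s (Suc l)" for k l t
  proof (rule ccontr)
    have sm: "s i \<le> s j" if "i \<le> j" for i j unfolding s_def using a that by (intro mult_right_mono power_increasing) auto
    assume "k \<noteq> l"
    then consider "Suc k \<le> l" | "Suc l \<le> k" by linarith
    then show False using sm[of "Suc k" l] sm[of "Suc l" k] that by cases linarith+
  qed
  have part: "(\<Sum>k<K. c k) \<le> 2 * enn2real I" for K
  proof -
    have "ennreal (\<Sum>k<K. c k / 2) = (\<Sum>k<K. ennreal (c k / 2))" using c0 by (subst sum_ennreal) auto
    also have "\<dots> = (\<Sum>k<K. \<integral>\<^sup>+ t. ennreal (c k / s (Suc k)) * indicator {s k..<s (Suc k)} t \<partial>lborel)"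
    proof (rule sum.cong[OF refl])
      fix k
      have "c k / s (Suc k) * (s (Suc k) - s k) = c k / 2" using s(1)[of k] by (simp add: s(2))
      then show "ennreal (c k / 2) = (\<integral>\<^sup>+ t. ennreal (c k / s (Suc k)) * indicator {s k..<s (Suc k)} t \<partial>lborel)"
        using c0[of k] s(1)[of k] s(1)[of "Suc k"]
        by (subst nn_integral_cmult_indicator) (auto simp: s(2) ennreal_mult[symmetric])
    qed
    also have "\<dots> = (\<integral>\<^sup>+ t. (\<Sum>k<K. ennreal (c k / s (Suc k)) * indicator {s k..<s (Suc k)} t) \<partial>lborel)"
      by (rule nn_integral_sum[symmetric]) auto
    also have "\<dots> \<le> I" unfolding I_def
    proof (rule nn_integral_mono)
      fix t :: real
      show "(\<Sum>k<K. ennreal (c k / s (Suc k)) * indicator {s k..<s (Suc k)} t) \<le> indicator {a..} t * ?F t"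
      proof (cases "\<exists>k<K. t \<in> {s k..<s (Suc k)}")
        case True
        then obtain k where k: "k < K" "s k \<le> t" "t < s (Suc k)" by auto
        have "(\<Sum>l<K. ennreal (c l / s (Suc l)) * indicator {s l..<s (Suc l)} t) = (\<Sum>l\<in>{k}. ennreal (c l / s (Suc l)) * indicator {s l..<s (Suc l)} t)"
          by (rule sum.mono_neutral_right) (use k disj in \<open>auto simp: indicator_def\<close>)
        also have "\<dots> \<le> ?F t" using low[OF k(2,3)] k by simp
        also have "\<dots> = indicator {a..} t * ?F t" using k s(3)[of k] by (simp add: indicator_def)
        finally show ?thesis .
      next
        case False
        then have "(\<Sum>l<K. ennreal (c l / s (Suc l)) * indicator {s l..<s (Suc l)} t) = 0"
          by (intro sum.neutral) (auto simp: indicator_def)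
        then show ?thesis by simp
      qed
    qed
    also have "\<dots> = ennreal (enn2real I)" using I by simp
    finally have "(\<Sum>k<K. c k / 2) \<le> enn2real I" by (subst (asm) ennreal_le_iff) auto
    then show ?thesis by (simp add: sum_divide_distrib[symmetric])
  qed
  have "summable c" by (rule summableI_nonneg_bounded[OF c0 part])
  then show "summable (\<lambda>k. sqrt (2 ^ k * a / g (2 ^ k * a)))"
    unfolding c_def s_def by (subst summable_Suc_iff[symmetric])
qed

text \<open>The terms of the convergent series tend to zero, so eventually g(2^k) > 2^k.\<close>

lemma ko_unbounded:
  assumes ko: "ko_summable g" shows "\<exists>s\<ge>1. C \<le> g s"
proof -
  have "(\<lambda>k. sqrt (2 ^ k * 1 / g (2 ^ k * 1))) \<longlonglongrightarrow> 0"
    using ko unfolding ko_summable_def by (intro summable_LIMSEQ_zero) (metis zero_less_one)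
  then have "\<forall>\<^sub>F k in sequentially. sqrt (2 ^ k * 1 / g (2 ^ k * 1)) < 1" by (rule order_tendstoD) simp
  moreover obtain N :: nat where N: "C < 2 ^ N" using real_arch_pow[of 2 C] by auto
  ultimately obtain k where k: "N \<le> k" "sqrt (2 ^ k * 1 / g (2 ^ k * 1)) < 1"
    unfolding eventually_sequentially by (metis nle_le)
  have "0 < g (2 ^ k)" using ko by (simp add: ko_summable_def)
  then have "2 ^ k < g (2 ^ k)" using k(2) by simp
  moreover have "(2::real) ^ N \<le> 2 ^ k" using k(1) by (intro power_increasing) auto
  ultimately have "C \<le> g (2 ^ k)" using N by linarith
  then show ?thesis by (intro exI[of _ "2 ^ k"]) auto
qed

lemma ko_radius:
  fixes n :: real
  shows "sqrt (12 * n * (2 ^ k * t) / g (2 ^ k * t / 2)) = sqrt (24 * n) * sqrt (2 ^ k * (t / 2) / g (2 ^ k * (t / 2)))"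
  by (simp add: real_sqrt_mult[symmetric])

lemma subsolution_nonpos:
  fixes V :: "real^'n::finite \<Rightarrow> real"
  assumes ko: "ko_summable g" and mono: "mono g" and g0: "0 \<le> g 0" and V: "wsub V (\<lambda>x. - g (V x))"
  shows "AE x in lborel. V x \<le> 0"
proof -
  have le: "AE x in lborel. x \<in> ball 0 \<rho> \<longrightarrow> V x \<le> t" if t: "t > 0" for t \<rho> :: real
  proof -
    define r where "r k = sqrt (12 * real CARD('n) * (2 ^ k * t) / g (2 ^ k * t / 2))" for k :: nat
    have r: "r = (\<lambda>k. sqrt (24 * real CARD('n)) * sqrt (2 ^ k * (t / 2) / g (2 ^ k * (t / 2))))"
      unfolding r_def by (rule ext) (rule ko_radius)
    have "summable (\<lambda>k. sqrt (2 ^ k * (t / 2) / g (2 ^ k * (t / 2))))"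
      using ko t unfolding ko_summable_def by (metis half_gt_zero)
    then have sr: "summable r" unfolding r by (rule summable_mult)
    have r0: "0 \<le> r k" for k using ko t by (auto simp: r_def ko_summable_def less_imp_le)
    show ?thesis
    \<comment> \<open>With C = 0 every t > 0 satisfies the size condition, and \<open>R\<close> may
      exceed \<rho> plus the total of the radii, however large that is.\<close>
    proof (rule keller_osserman_bound[OF V _ mono g0 order_refl t, of "\<rho> + suminf r + 1" \<rho> "\<rho> + suminf r"])
      show "0 < g (t / 2)" "2 * 0 \<le> g (t / 2)" using ko t by (auto simp: ko_summable_def less_imp_le)
      show "\<rho> + (\<Sum>k<K. sqrt (12 * real CARD('n) * (2 ^ k * t) / g (2 ^ k * t / 2))) \<le> \<rho> + suminf r" for K
        using sum_le_suminf[OF sr, of "{..<K}"] r0 by (simp add: r_def)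
    qed auto
  qed
  have "AE x in lborel. \<forall>n m::nat. x \<in> ball 0 (real n) \<longrightarrow> V x \<le> inverse (real (Suc m))"
    unfolding AE_all_countable using le by (simp add: AE_all_countable)
  then show ?thesis
  proof eventually_elim
    case (elim x)
    obtain n :: nat where n: "norm x < n" using reals_Archimedean2 by blast
    have "\<forall>m::nat. V x \<le> inverse (real (Suc m))" using elim n by auto
    then show ?case using LIMSEQ_le_const[OF LIMSEQ_inverse_real_of_nat] by blast
  qed
qed

text \<open>The pair identity read by duality: e^2 k_e * q is a potential of \<open>q\<close> up to
  the averaged term m_e * q, which is bounded once \<open>m\<close> has bounded density and
  \<open>q\<close> is integrable. It replaces convolution with the fundamental solution.\<close>

lemma wsub_potential:
  fixes q :: "real^'n::finite \<Rightarrow> real"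
  assumes mk: "mvpair m k" and q: "locint q"
  shows "wsub (\<lambda>x. - (e\<^sup>2 * avg k e q x)) (\<lambda>x. avg m e q x - q x)"
proof -
  interpret m: kernel m using mk by (simp add: mvpair_def)
  interpret k: kernel k using mk by (simp add: mvpair_def)
  show ?thesis unfolding wsub_def
  proof (intro conjI allI impI)
    show "locint (\<lambda>x. - (e\<^sup>2 * avg k e q x))" "locint (\<lambda>x. avg m e q x - q x)"
      by (intro locint_uminus locint_cmult locint_diff m.locint_avg k.locint_avg q)+
    fix \<phi> :: "real^'n \<Rightarrow> real" assume \<phi>: "test_fun \<phi>"
    note b = bdsupp_test[OF \<phi>] and bl = bdsupp_laplacian[OF \<phi>]
    have mv: "e\<^sup>2 * avg k (-e) (laplacian \<phi>) x = avg m (-e) \<phi> x - \<phi> x" for x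
      using mk \<phi> unfolding mvpair_def by (metis power2_minus)
    have "(\<integral>x. - (e\<^sup>2 * avg k e q x) * laplacian \<phi> x \<partial>lborel) = - (e\<^sup>2 * (\<integral>x. avg k e q x * laplacian \<phi> x \<partial>lborel))"
      by (simp add: mult.assoc)
    also have "\<dots> = - (\<integral>x. q x * (e\<^sup>2 * avg k (-e) (laplacian \<phi>) x) \<partial>lborel)"
      unfolding k.avg_adjoint[OF q bl] by (subst integral_mult_right_zero[symmetric]) (simp add: mult_ac)
    also have "\<dots> = - (\<integral>x. q x * avg m (-e) \<phi> x - q x * \<phi> x \<partial>lborel)" unfolding mv by (simp add: right_diff_distrib)
    also have "\<dots> = (\<integral>x. q x * \<phi> x \<partial>lborel) - (\<integral>x. avg m e q x * \<phi> x \<partial>lborel)"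
      using locint_bdsupp_integrable[OF q b] locint_bdsupp_integrable[OF q m.avg_bdsupp[OF b], of "-e"]
      by (simp add: m.avg_adjoint[OF q b])
    finally have 1: "(\<integral>x. - (e\<^sup>2 * avg k e q x) * laplacian \<phi> x \<partial>lborel)
        = (\<integral>x. q x * \<phi> x \<partial>lborel) - (\<integral>x. avg m e q x * \<phi> x \<partial>lborel)" .
    have 2: "(\<integral>x. (avg m e q x - q x) * \<phi> x \<partial>lborel) = (\<integral>x. avg m e q x * \<phi> x \<partial>lborel) - (\<integral>x. q x * \<phi> x \<partial>lborel)"
      using locint_bdsupp_integrable[OF q b] locint_bdsupp_integrable[OF m.locint_avg[OF q] b, of e] by (simp add: left_diff_distrib)
    show "0 \<le> (\<integral>x. - (e\<^sup>2 * avg k e q x) * laplacian \<phi> x \<partial>lborel) + (\<integral>x. (avg m e q x - q x) * \<phi> x \<partial>lborel)"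
      unfolding 1 2 by simp
  qed
qed

text \<open>Subtracting a potential of \<open>f\<close> reduces the a priori bound to the case of a bounded right-hand side.\<close>
lemma local_upper_bound:
  fixes f :: "real^'n::finite \<Rightarrow> real"
  assumes ko: "ko_summable g" and mono: "mono g" and g0: "0 \<le> g 0" and f: "locint f" and f0: "\<And>x. 0 \<le> f x"
  shows "\<exists>w. locint w \<and> (\<forall>u F. wsub u (\<lambda>x. F x - g (u x)) \<longrightarrow> (\<forall>x. F x \<le> f x) \<longrightarrow>
    (AE x in lborel. x \<in> ball 0 \<rho> \<longrightarrow> u x \<le> w x))"
proof -
  interpret m: kernel "eta_measure :: (real^'n) measure" by (rule kernel_eta)
  interpret k: kernel "ball_k :: (real^'n) measure" by (rule kernel_ball_k)
  note [measurable] = locint_measurable[OF f] bdsupp_measurable[OF bdsupp_eta[where 'n = 'n]]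
  \<comment> \<open>The datum is cut off to the ball on which the bound is derived, so that it is
    globally integrable; one unit of radius is for the halvings, the other keeps \<open>R'\<close>
    strictly inside.\<close>
  define q where "q x = indicator (ball 0 (\<rho> + 2)) x * f x" for x
  have qm[measurable]: "q \<in> borel_measurable borel" unfolding q_def by measurable
  have q0: "0 \<le> q x" for x using f0 by (simp add: q_def)
  have q: "locint q" by (rule locint_bound[OF f qm]) (auto simp: q_def indicator_def f0)
  have iq: "integrable lborel q"
  proof -
    have "integrable lborel (\<lambda>x. q x * indicator (cball 0 (\<rho> + 2)) x)" by (rule locint_bdsupp_integrable[OF q bdsupp_indicator])
    moreover have "q x * indicator (cball 0 (\<rho> + 2)) x = q x" for x by (auto simp: q_def indicator_def)
    ultimately show ?thesis by simp
  qed
  obtain E where E: "E > 0" "\<And>y. \<bar>eta (y::real^'n)\<bar> \<le> E" using bdsuppE[OF bdsupp_eta] by metis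
  \<comment> \<open>The averaged datum is bounded by the supremum of \<open>eta\<close> times the
    total mass of \<open>q\<close>.\<close>
  define C where "C = E * integral\<^sup>L lborel q"
  have C0: "0 \<le> C" unfolding C_def using E q0 by simp
  have Aq: "avg eta_measure 1 q x \<le> C" for x
  proof -
    have "integrable lborel (\<lambda>y. q (y + x))" using lborel_integrable_translate[of q x] iq by simp
    then have iE: "integrable lborel (\<lambda>y. E * q (x + y))" by (simp add: add.commute)
    have "avg eta_measure 1 q x = (\<integral>y. eta y * q (x + y) \<partial>lborel)" by (simp add: avg_eta)
    also have "\<dots> \<le> (\<integral>y. E * q (x + y) \<partial>lborel)"
    proof (rule integral_mono_AE')
      have le: "eta y \<le> E" for y :: "real^'n" using E(2)[of y] by simp
      show "AE y in lborel. eta y * q (x + y) \<le> E * q (x + y)" by (intro AE_I2 mult_right_mono le q0)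
      show "AE y in lborel. 0 \<le> E * q (x + y)" using E q0 by simp
    qed (rule iE)
    also have "\<dots> = C" using lborel_integral_translate[of q x] by (simp add: C_def add.commute)
    finally show ?thesis .
  qed
  define p where "p x = 1\<^sup>2 * avg ball_k 1 q x" for x
  have p0: "0 \<le> p x" for x unfolding p_def by (simp add: k.avg_nonneg q0)
  have p: "locint p" unfolding p_def by (intro locint_cmult k.locint_avg q)
  define s where "s k = sqrt (2 ^ k * (1 / 2) / g (2 ^ k * (1 / 2)))" for k :: nat
  have ss: "summable s" unfolding s_def using ko unfolding ko_summable_def by (metis half_gt_zero zero_less_one)
  have s0: "0 \<le> s k" for k using ko by (auto simp: s_def ko_summable_def less_imp_le)
  define c where "c = sqrt (24 * real CARD('n))"
  have c: "c > 0" by (simp add: c_def)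
  obtain N where N: "\<And>m n. N \<le> m \<Longrightarrow> norm (sum s {m..<n}) < 1 / c"
    using ss c unfolding summable_Cauchy by (metis zero_less_divide_1_iff)
  obtain s1 where s1: "1 \<le> s1" "2 * C + 1 \<le> g s1" using ko_unbounded[OF ko] by blast
  obtain N' :: nat where N': "2 * s1 < 2 ^ N'" using real_arch_pow[of 2 "2 * s1"] by auto
  define j where "j = max N N'"
  \<comment> \<open>The level is chosen so high that g(t/2) absorbs \<open>C\<close> and that the
    remaining radii, a tail of the convergent series, sum to at most 1. It depends on neither
    \<open>u\<close> nor \<open>F\<close>.\<close>
  define t :: real where "t = 2 ^ j"
  have t: "t > 0" by (simp add: t_def)
  have "(2::real) ^ N' \<le> t" unfolding t_def j_def by (intro power_increasing) auto
  then have "s1 \<le> t / 2" using N' by simp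
  then have gt: "2 * C + 1 \<le> g (t / 2)" using monoD[OF mono, of s1 "t / 2"] s1 by linarith
  have radius: "(\<Sum>k<K. sqrt (12 * real CARD('n) * (2 ^ k * t) / g (2 ^ k * t / 2))) \<le> 1" for K
  proof -
    have "(\<Sum>k<K. sqrt (12 * real CARD('n) * (2 ^ k * t) / g (2 ^ k * t / 2))) = (\<Sum>k<K. c * s (k + j))"
      unfolding ko_radius c_def s_def t_def by (simp add: power_add)
    also have "\<dots> = c * (\<Sum>k\<in>{j..<K + j}. s k)"
      using sum.shift_bounds_nat_ivl[of s 0 j K] by (simp add: sum_distrib_left atLeast0LessThan)
    also have "\<dots> \<le> c * (1 / c)"
      using N[of j "K + j"] c by (intro mult_left_mono) (auto simp: j_def)
    finally show ?thesis using c by simp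
  qed
  have main: "AE x in lborel. x \<in> ball 0 \<rho> \<longrightarrow> u x \<le> t + p x"
    if u: "wsub u (\<lambda>x. F x - g (u x))" and F: "\<forall>x. F x \<le> f x" for u F
  proof -
    \<comment> \<open>Subtracting the potential trades F - q, which is nonpositive on the ball, for
      the bounded average; as p \<ge> 0, replacing g(u) by g(u - p) only helps.\<close>
    have "wsub (\<lambda>x. u x + - p x) (\<lambda>x. (F x - g (u x)) + (avg eta_measure 1 q x - q x))"
      unfolding p_def by (rule wsub_add[OF u wsub_potential[OF mvpair_ball q]])
    then have "AE x in lborel. x \<in> ball 0 \<rho> \<longrightarrow> u x + - p x \<le> t"
    proof (rule keller_osserman_bound[OF _ _ mono g0 C0 t, of _ _ "\<rho> + 2" \<rho> "\<rho> + 1"])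
      show "AE x in lborel. x \<in> ball 0 (\<rho> + 2) \<longrightarrow> 0 < u x + - p x \<longrightarrow>
         F x - g (u x) + (avg eta_measure 1 q x - q x) \<le> C - g (u x + - p x)"
      proof (rule AE_I2, intro impI)
        fix x :: "real^'n" assume "x \<in> ball 0 (\<rho> + 2)"
        then have "q x = f x" by (simp add: q_def)
        moreover have "g (u x + - p x) \<le> g (u x)" using p0[of x] by (intro monoD[OF mono]) simp
        ultimately show "F x - g (u x) + (avg eta_measure 1 q x - q x) \<le> C - g (u x + - p x)"
          using Aq[of x] F[rule_format, of x] by linarith
      qed
      show "\<rho> + (\<Sum>k<K. sqrt (12 * real CARD('n) * (2 ^ k * t) / g (2 ^ k * t / 2))) \<le> \<rho> + 1" for K
        using radius by simp
    qed (use gt C0 in auto)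
    then show ?thesis by eventually_elim auto
  qed
  have "locint (\<lambda>x. t + p x)" by (intro locint_add locint_const p)
  with main show ?thesis by (intro exI[of _ "\<lambda>x. t + p x"] conjI allI impI)
qed

section \<open>Existence\<close>

lemma monotone_AE_limit:
  fixes u :: "nat \<Rightarrow> 'a::euclidean_space \<Rightarrow> real"
  assumes "\<And>n. AE x in lborel. u n x \<le> u (Suc n) x" and "AE x in lborel. \<exists>c. \<forall>n. u n x \<le> c"
  shows "AE x in lborel. (\<lambda>n. u n x) \<longlonglongrightarrow> lim (\<lambda>n. u n x) \<and> (\<forall>n. u n x \<le> lim (\<lambda>n. u n x)) \<and> incseq (\<lambda>n. u n x)"
proof -
  have "AE x in lborel. \<forall>n. u n x \<le> u (Suc n) x" using assms(1) by (simp add: AE_all_countable)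
  then show ?thesis using assms(2)
  proof eventually_elim
    case (elim x)
    then obtain c where c: "\<forall>n. u n x \<le> c" by blast
    have i: "incseq (\<lambda>n. u n x)" using elim(1) by (intro incseq_SucI) auto
    obtain L where L: "(\<lambda>n. u n x) \<longlonglongrightarrow> L" "\<forall>n. u n x \<le> L" using incseq_convergent[OF i c] by blast
    then have "lim (\<lambda>n. u n x) = L" by (intro limI)
    with L i show ?case by simp
  qed
qed

text \<open>Every test function is the difference of two nonnegative ones, obtained by adding a
  large multiple of a cutoff.\<close>

lemma weq_test:
  fixes z :: "real^'n::finite \<Rightarrow> real"
  assumes z: "weq z h" and \<phi>: "test_fun \<phi>"
  shows "(\<integral>x. z x * laplacian \<phi> x \<partial>lborel) + (\<integral>x. h x * \<phi> x \<partial>lborel) = 0"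
proof -
  define L where "L \<psi> = (\<integral>x. z x * laplacian \<psi> x \<partial>lborel) + (\<integral>x. h x * \<psi> x \<partial>lborel)" for \<psi>
  have l: "locint z" "locint h" using z by (auto simp: weq_def dest: wsub_locint)
  have pos: "L \<psi> = 0" if "test_fun \<psi>" "\<And>x. 0 \<le> \<psi> x" for \<psi>
  proof -
    have "0 \<le> L \<psi>" unfolding L_def using z that by (intro wsubD) (auto simp: weq_def)
    moreover have "0 \<le> (\<integral>x. - z x * laplacian \<psi> x \<partial>lborel) + (\<integral>x. - h x * \<psi> x \<partial>lborel)"
      using z that by (intro wsubD) (auto simp: weq_def)
    ultimately show ?thesis by (simp add: L_def)
  qed
  obtain B R where B: "B > 0" "R > 0" "\<And>x. \<bar>\<phi> x\<bar> \<le> B" "\<And>x. norm x > R \<Longrightarrow> \<phi> x = 0"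
    using bdsuppE[OF bdsupp_test[OF \<phi>]] by metis
  obtain \<psi> :: "real^'n \<Rightarrow> real" where \<psi>: "test_fun \<psi>" "\<And>x. 0 \<le> \<psi> x" "\<And>x. norm x \<le> R \<Longrightarrow> 1 \<le> \<psi> x"
    using test_fun_positive_on_ball[of R] by metis
  define \<omega> where "\<omega> x = B * \<psi> x + 1 * \<phi> x" for x
  have t: "test_fun \<omega>" unfolding \<omega>_def by (rule test_fun_lincomb[OF \<psi>(1) \<phi>])
  have nn: "0 \<le> \<omega> x" for x
  proof (cases "norm x \<le> R")
    case True
    have "B * 1 \<le> B * \<psi> x" using \<psi>(3)[OF True] B by (intro mult_left_mono) auto
    then show ?thesis using B(3)[of x] by (simp add: \<omega>_def)
  qed (use B \<psi>(2) in \<open>simp add: \<omega>_def\<close>)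
  have sm: "smooth \<psi>" "smooth \<phi>" using \<psi> \<phi> by (auto simp: test_fun_def)
  note int = locint_bdsupp_integrable
  note i = int[OF l(1) bdsupp_laplacian[OF \<psi>(1)]] int[OF l(1) bdsupp_laplacian[OF \<phi>]]
    int[OF l(2) bdsupp_test[OF \<psi>(1)]] int[OF l(2) bdsupp_test[OF \<phi>]]
  have "L \<omega> = (\<integral>x. B * (z x * laplacian \<psi> x) + z x * laplacian \<phi> x \<partial>lborel)
      + (\<integral>x. B * (h x * \<psi> x) + h x * \<phi> x \<partial>lborel)"
    unfolding L_def \<omega>_def[abs_def] laplacian_lincomb[OF sm] by (simp add: algebra_simps)
  also have "\<dots> = B * L \<psi> + L \<phi>" using i by (simp add: L_def distrib_left)
  finally show ?thesis using pos[OF t nn] pos[OF \<psi>(1,2)] by (simp add: L_def)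
qed

text \<open>Two parameters: \<open>j\<close> for the Lipschitz envelope of \<open>g\<close>,
  \<open>n\<close> for the truncation of \<open>f\<close>. First j tends to infinity with
  \<open>n\<close> fixed, where a constant bounds all solutions from above, then n tends to
  infinity, where only the local bound independent of the truncation remains.\<close>

lemma existence_bounded_below:
  fixes V f :: "real^'n::finite \<Rightarrow> real"
  assumes "bounded_below g b" and ko: "ko_summable g" and g0: "0 \<le> g 0"
    and V: "wsub V (\<lambda>x. - g (V x))" and f: "locint f" and f0: "\<And>x. 0 \<le> f x"
  shows "\<exists>u. weq u (\<lambda>x. f x - g (u x)) \<and> (AE x in lborel. V x \<le> u x)"
proof -
  interpret bounded_below g b by fact
  note g_measurable[measurable] = borel_measurable_mono[OF g_mono]
  have V0: "AE x in lborel. V x \<le> 0" by (rule subsolution_nonpos[OF ko g_mono g0 V])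
  have lV: "locint V" and lgV: "locint (\<lambda>x. g (V x))"
    using wsub_locint[OF V] locint_uminus[of "\<lambda>x. - g (V x)"] by auto
  note [measurable] = locint_measurable[OF lV] locint_measurable[OF f]
  define H where "H j = infconv g (real (Suc j))" for j
  have Hm[measurable]: "H j \<in> borel_measurable borel" for j
    unfolding H_def by (rule borel_measurable_mono[OF infconv_mono]) simp
  have Hle: "H j s \<le> g s" and Hge: "- b \<le> H j s" and HS: "H j s \<le> H (Suc j) s" for j s
    unfolding H_def by (auto intro!: infconv_le_self infconv_lower infconv_slope_mono)
  define F where "F n x = min (f x) (real n)" for n x
  have Fm[measurable]: "F n \<in> borel_measurable borel" for n unfolding F_def by measurable
  have F: "0 \<le> F n x" "F n x \<le> f x" "F n x \<le> F (Suc n) x" "F n x \<le> real n" for n x using f0[of x] by (auto simp: F_def)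
  have lF: "locint (F n)" for n by (rule locint_bound[OF f Fm]) (use F in auto)
  \<comment> \<open>The constant supersolutions depend on \<open>n\<close> only, so they survive the
    limit in \<open>j\<close>.\<close>
  have "\<exists>M\<ge>0. \<forall>j. real n \<le> H j M" for n
  proof -
    obtain t where t: "1 \<le> t" "real n \<le> g t" using ko_unbounded[OF ko] by blast
    have "real n \<le> H j (\<bar>t\<bar> + \<bar>real n\<bar> + b)" for j
      unfolding H_def by (rule infconv_large[OF t(2)]) auto
    then show ?thesis using t b_nonneg by (intro exI[of _ "\<bar>t\<bar> + \<bar>real n\<bar> + b"]) auto
  qed
  then obtain M where M0: "\<And>n. 0 \<le> M n" and M: "\<And>n j. real n \<le> H j (M n)" by metis
  define Q where "Q j n u \<longleftrightarrow> weq u (\<lambda>x. F n x - H j (u x)) \<and> (AE x in lborel. V x \<le> u x) \<and>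
    (\<forall>Y. wsub (\<lambda>x. - Y x) (\<lambda>x. H j (Y x) - F n x) \<longrightarrow> (AE x in lborel. V x \<le> Y x) \<longrightarrow> (AE x in lborel. u x \<le> Y x))"
    for j n u
  have lHV: "locint (\<lambda>x. H j (V x))" for j
    by (rule locint_between[OF locint_const[of "- b"] lgV]) (use Hle Hge in auto)
  have superM: "wsub (\<lambda>x::real^'n. - M n) (\<lambda>x. H j (M n) - F n x)" for j n
  proof (rule wsub_mono[OF wsub_const])
    show "AE x in lborel. 0 \<le> H j (M n) - F n x"
    proof (rule AE_I2)
      fix x show "0 \<le> H j (M n) - F n x" using F(4)[of n x] M[of n j] by linarith
    qed
  qed (intro locint_diff locint_const lF)
  have "\<exists>u. Q j n u" for j n unfolding Q_def
  proof (rule lipschitz_minimal_solution[where lam = "real (Suc j)" and Z = "\<lambda>_. M n"])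
    show "mono (H j)" unfolding H_def by (rule infconv_mono) simp
    show "H j t - H j s \<le> real (Suc j) * (t - s)" if "s \<le> t" for s t
      unfolding H_def by (rule infconv_lipschitz) (use that in auto)
    \<comment> \<open>\<open>V\<close> is a subsolution of every approximate problem, since the
      envelopes lie below \<open>g\<close> and the data are nonnegative.\<close>
    show "wsub V (\<lambda>x. F n x - H j (V x))"
    proof (rule wsub_mono[OF V])
      show "AE x in lborel. - g (V x) \<le> F n x - H j (V x)"
      proof (rule AE_I2)
        fix x show "- g (V x) \<le> F n x - H j (V x)" using F(1)[of n x] Hle[of j "V x"] by linarith
      qed
    qed (intro locint_diff lF lHV)
    show "AE x in lborel. V x \<le> M n" using V0 by eventually_elim (use M0[of n] in linarith)
  qed (use lF superM in auto)
  then obtain U where U: "\<And>j n. Q j n (U j n)" by metis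
  have weqU: "weq (U j n) (\<lambda>x. F n x - H j (U j n x))" and VU: "AE x in lborel. V x \<le> U j n x" for j n
    using U[of j n] by (auto simp: Q_def)
  have minU: "AE x in lborel. U j n x \<le> Y x"
    if "wsub (\<lambda>x. - Y x) (\<lambda>x. H j (Y x) - F n x)" "AE x in lborel. V x \<le> Y x" for j n Y
    using U[of j n] that by (auto simp: Q_def)
  have VUA: "AE x in lborel. \<forall>j. V x \<le> U j n x" for n using VU by (simp add: AE_all_countable)
  have lU: "locint (U j n)" for j n using weqU[of j n] by (auto simp: weq_def dest: wsub_locint)
  note [measurable] = lU[THEN locint_measurable]
  have UM: "AE x in lborel. U j n x \<le> M n" for j n
    by (rule minU[OF superM]) (use V0 in eventually_elim, use M0[of n] in linarith)
  have lHU: "locint (\<lambda>x. H i (U j n x))" for i j n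
  proof (rule locint_between[OF locint_const[of "- b"] locint_const[of "g (M n)"]])
    show "AE x in lborel. H i (U j n x) \<le> g (M n)" using UM[of j n]
    proof eventually_elim
      case (elim x) then show ?case using Hle[of i "U j n x"] monoD[OF g_mono elim] by linarith
    qed
  qed (use Hge in auto)
  have super: "wsub (\<lambda>x. - U j n x) (\<lambda>x. H j (U j n x) - F n x)" for j n
    using weqU[of j n] by (simp add: weq_def)
  \<comment> \<open>A solution for slope \<open>j\<close> is a supersolution for the larger
    envelope, so minimality orders the solutions; the next fact uses the same argument for
    increasing data.\<close>
  have decU: "AE x in lborel. U (Suc j) n x \<le> U j n x" for j n
    by (rule minU[OF wsub_mono[OF super[of j n]] VU]) (use HS lHU lF in \<open>auto intro!: locint_diff\<close>)
  have incU: "AE x in lborel. U j n x \<le> U j (Suc n) x" for j n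
    by (rule minU[OF wsub_mono[OF super[of j "Suc n"]] VU]) (use F(3) lHU lF in \<open>auto intro!: locint_diff\<close>)
  have incUA: "AE x in lborel. \<forall>j. U j n x \<le> U j (Suc n) x" for n using incU by (simp add: AE_all_countable)
  define v where "v n x = lim (\<lambda>j. U j n x)" for n x
  have vm[measurable]: "v n \<in> borel_measurable borel" for n unfolding v_def by measurable
  have limU: "AE x in lborel. (\<lambda>j. U j n x) \<longlonglongrightarrow> v n x \<and> (\<forall>j. v n x \<le> U j n x)" for n
  proof -
    have "AE x in lborel. \<exists>c. \<forall>j. - U j n x \<le> c"
      using VUA[of n]
    proof eventually_elim
      case (elim x) then show ?case by (intro exI[of _ "- V x"]) auto
    qed
    then have "AE x in lborel. (\<lambda>j. - U j n x) \<longlonglongrightarrow> lim (\<lambda>j. - U j n x) \<and> (\<forall>j. - U j n x \<le> lim (\<lambda>j. - U j n x)) \<and> incseq (\<lambda>j. - U j n x)"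
      by (intro monotone_AE_limit) (use decU in auto)
    then show ?thesis
    proof eventually_elim
      case (elim x)
      then have "(\<lambda>j. U j n x) \<longlonglongrightarrow> - lim (\<lambda>j. - U j n x)" using tendsto_minus by fastforce
      moreover from this have "v n x = - lim (\<lambda>j. - U j n x)" unfolding v_def by (rule limI)
      ultimately show ?case using elim by (auto simp: minus_le_iff)
    qed
  qed
  define B where "B n x = \<bar>V x\<bar> + M n" for n x
  have lB: "locint (B n)" for n unfolding B_def by (intro locint_add locint_abs locint_const lV)
  have UB: "AE x in lborel. \<bar>U j n x\<bar> \<le> B n x" for j n using VU[of j n] UM[of j n]
    by eventually_elim (use M0[of n] in \<open>auto simp: B_def abs_le_iff\<close>)
  have weqv: "weq (v n) (\<lambda>x. F n x - g (v n x))" for n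
  proof (rule weq_limit[OF weqU vm lB UB])
    show "AE x in lborel. (\<lambda>j. U j n x) \<longlonglongrightarrow> v n x" using limU[of n] by eventually_elim simp
    show "AE x in lborel. (\<lambda>j. F n x - H j (U j n x)) \<longlonglongrightarrow> F n x - g (v n x)" using limU[of n]
      by eventually_elim (unfold H_def, intro tendsto_diff tendsto_const infconv_tendsto_from_above, auto)
    show "(\<lambda>x. F n x - g (v n x)) \<in> borel_measurable borel" by measurable
    show "locint (\<lambda>x. \<bar>F n x\<bar> + (b + \<bar>g (M n)\<bar>))" by (intro locint_add locint_abs lF locint_const)
    show "AE x in lborel. \<bar>F n x - H j (U j n x)\<bar> \<le> \<bar>F n x\<bar> + (b + \<bar>g (M n)\<bar>)" for j using UM[of j n]
    proof eventually_elim
      case (elim x)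
      have "H j (U j n x) \<le> g (M n)" using Hle[of j "U j n x"] monoD[OF g_mono elim] by linarith
      then show ?case using Hge[of j "U j n x"] b_nonneg by linarith
    qed
  qed
  have lv: "locint (v n)" and lgv: "locint (\<lambda>x. g (v n x))" for n
  proof -
    show "locint (v n)" using weqv[of n] by (auto simp: weq_def dest: wsub_locint)
    have "locint (\<lambda>x. F n x - g (v n x))" using weqv[of n] by (auto simp: weq_def dest: wsub_locint)
    from locint_diff[OF lF[of n] this] show "locint (\<lambda>x. g (v n x))" by simp
  qed
  have Vv: "AE x in lborel. \<forall>n. V x \<le> v n x"
  proof -
    have "AE x in lborel. V x \<le> v n x" for n
      using limU[of n] VUA[of n]
      by eventually_elim (rule LIMSEQ_le_const, auto)
    then show ?thesis by (simp add: AE_all_countable)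
  qed
  have incv: "AE x in lborel. v n x \<le> v (Suc n) x" for n
    using limU[of n] limU[of "Suc n"] incUA[of n]
    by eventually_elim (rule LIMSEQ_le, auto)
  \<comment> \<open>The constants \<open>M n\<close> are of no use as n grows; here the majorant is
    common to all \<open>n\<close>.\<close>
  have "\<exists>w. locint w \<and> (\<forall>n. AE x in lborel. x \<in> ball 0 \<rho> \<longrightarrow> v n x \<le> w x)" for \<rho>
  proof -
    obtain w where w: "locint w" "\<And>u F. wsub u (\<lambda>x. F x - g (u x)) \<Longrightarrow> \<forall>x. F x \<le> f x \<Longrightarrow> AE x in lborel. x \<in> ball 0 \<rho> \<longrightarrow> u x \<le> w x"
      using local_upper_bound[OF ko g_mono g0 f f0, of \<rho>] by blast
    have "AE x in lborel. x \<in> ball 0 \<rho> \<longrightarrow> v n x \<le> w x" for n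
      by (rule w(2)[of _ "F n"]) (use weqv[of n] F(2) in \<open>auto simp: weq_def\<close>)
    with w(1) show ?thesis by blast
  qed
  then obtain w where lw: "\<And>\<rho>. locint (w \<rho>)" and w: "\<And>\<rho> n. AE x in lborel. x \<in> ball 0 \<rho> \<longrightarrow> v n x \<le> w \<rho> x" by metis
  have wA: "AE x in lborel. \<forall>n. x \<in> ball 0 \<rho> \<longrightarrow> v n x \<le> w \<rho> x" for \<rho>
    unfolding AE_all_countable using w by blast
  define u where "u x = lim (\<lambda>n. v n x)" for x
  have um[measurable]: "u \<in> borel_measurable borel" unfolding u_def by measurable
  have limv: "AE x in lborel. (\<lambda>n. v n x) \<longlonglongrightarrow> u x \<and> (\<forall>n. v n x \<le> u x) \<and> incseq (\<lambda>n. v n x)"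
    unfolding u_def
  proof (rule monotone_AE_limit[where u = v, OF incv])
    have "AE x in lborel. \<forall>m::nat. \<forall>n. x \<in> ball 0 (real m) \<longrightarrow> v n x \<le> w (real m) x"
      unfolding AE_all_countable using w by blast
    then show "AE x in lborel. \<exists>c. \<forall>n. v n x \<le> c"
    proof eventually_elim
      case (elim x)
      obtain m :: nat where "norm x < m" using reals_Archimedean2 by blast
      then show ?case using elim by (intro exI[of _ "w (real m) x"]) auto
    qed
  qed
  have lu: "locint u"
  proof (rule locintI[OF um])
    fix R
    have i: "integrable lborel (\<lambda>x. indicator (cball 0 R) x * (\<bar>V x\<bar> + \<bar>w (R + 1) x\<bar>))"
      using locint_add[OF locint_abs[OF lV] locint_abs[OF lw]] by (auto simp: locint_def)
    show "integrable lborel (\<lambda>x. indicator (cball 0 R) x * u x)"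
    proof (rule Bochner_Integration.integrable_bound[OF i])
      show "AE x in lborel. norm (indicator (cball 0 R) x * u x) \<le> norm (indicator (cball 0 R) x * (\<bar>V x\<bar> + \<bar>w (R + 1) x\<bar>))"
        using limv Vv wA[of "R + 1"]
      proof eventually_elim
        case (elim x)
        show ?case
        proof (cases "x \<in> cball 0 R")
          case True
          have "u x \<le> w (R + 1) x" by (rule LIMSEQ_le_const2[of "\<lambda>n. v n x"]) (use elim True in auto)
          moreover have "V x \<le> u x" using elim order_trans[of "V x" "v 0 x" "u x"] by blast
          ultimately have "\<bar>u x\<bar> \<le> \<bar>V x\<bar> + \<bar>w (R + 1) x\<bar>" by linarith
          then show ?thesis using True by simp
        qed simp
      qed
    qed measurable
  qed
  have Vu: "AE x in lborel. V x \<le> u x" using limv Vv by eventually_elim (meson order_trans)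
  have gcont: "isCont g s" for s using g_cont by (simp add: continuous_on_eq_continuous_at)
  \<comment> \<open>No pointwise domination of g(v n) is available at this stage. Adding
    \<open>b\<close> makes the integrands nonnegative and increasing in \<open>n\<close>; the
    equation tested with a cutoff bounds their integrals by \<open>D\<close>, and monotone
    convergence applies.\<close>
  have lgu: "locint (\<lambda>x. g (u x))"
  proof (rule locintI)
    fix R
    obtain \<phi> :: "real^'n \<Rightarrow> real" where \<phi>: "test_fun \<phi>" "\<And>x. 0 \<le> \<phi> x" "\<And>x. norm x \<le> R \<Longrightarrow> 1 \<le> \<phi> x"
      using test_fun_positive_on_ball[of R] by metis
    note bp = bdsupp_test[OF \<phi>(1)] and bl = bdsupp_laplacian[OF \<phi>(1)]
    note [measurable] = bdsupp_measurable[OF bp]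
    note int = locint_bdsupp_integrable
    let ?h = "\<lambda>n x. (g (v n x) + b) * \<phi> x"
    define D where "D = (\<integral>x. f x * \<phi> x \<partial>lborel) + (\<integral>x. (\<bar>V x\<bar> + \<bar>u x\<bar>) * \<bar>laplacian \<phi> x\<bar> \<partial>lborel) + (\<integral>x. b * \<phi> x \<partial>lborel)"
    have ih: "integrable lborel (?h n)" for n by (intro int[OF locint_add[OF lgv locint_const] bp])
    have bound: "(\<integral>x. ?h n x \<partial>lborel) \<le> D" for n
    proof -
      have "(\<integral>x. ?h n x \<partial>lborel) = (\<integral>x. g (v n x) * \<phi> x \<partial>lborel) + (\<integral>x. b * \<phi> x \<partial>lborel)"
        using int[OF lgv bp, of n] int[OF locint_const[of b] bp] by (simp add: distrib_right)
      moreover have "(\<integral>x. (F n x - g (v n x)) * \<phi> x \<partial>lborel) = (\<integral>x. F n x * \<phi> x \<partial>lborel) - (\<integral>x. g (v n x) * \<phi> x \<partial>lborel)"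
        using int[OF lgv bp, of n] int[OF lF bp, of n] by (simp add: left_diff_distrib)
      moreover have "(\<integral>x. F n x * \<phi> x \<partial>lborel) \<le> (\<integral>x. f x * \<phi> x \<partial>lborel)"
        by (intro Bochner_Integration.integral_mono int lF f bp mult_right_mono F \<phi>)
      moreover have "(\<integral>x. v n x * laplacian \<phi> x \<partial>lborel) \<le> (\<integral>x. (\<bar>V x\<bar> + \<bar>u x\<bar>) * \<bar>laplacian \<phi> x\<bar> \<partial>lborel)"
      proof (rule integral_mono_AE[OF int[OF lv bl]])
        have "integrable lborel (\<lambda>x. \<bar>(\<bar>V x\<bar> + \<bar>u x\<bar>) * laplacian \<phi> x\<bar>)"
          by (intro integrable_abs int locint_add locint_abs lV lu bl)
        then show "integrable lborel (\<lambda>x. (\<bar>V x\<bar> + \<bar>u x\<bar>) * \<bar>laplacian \<phi> x\<bar>)" by (simp add: abs_mult)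
        show "AE x in lborel. v n x * laplacian \<phi> x \<le> (\<bar>V x\<bar> + \<bar>u x\<bar>) * \<bar>laplacian \<phi> x\<bar>"
          using limv Vv
        proof eventually_elim
          case (elim x)
          then have "V x \<le> v n x" "v n x \<le> u x" by auto
          then have "\<bar>v n x\<bar> \<le> \<bar>V x\<bar> + \<bar>u x\<bar>" by linarith
          then have "\<bar>v n x\<bar> * \<bar>laplacian \<phi> x\<bar> \<le> (\<bar>V x\<bar> + \<bar>u x\<bar>) * \<bar>laplacian \<phi> x\<bar>" by (rule mult_right_mono) simp
          then show ?case using abs_ge_self[of "v n x * laplacian \<phi> x"] by (simp add: abs_mult)
        qed
      qed
      ultimately show ?thesis using weq_test[OF weqv \<phi>(1), of n] unfolding D_def by linarith
    qed
    have inch: "AE x in lborel. mono (\<lambda>n. ?h n x)" using limv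
    proof eventually_elim
      case (elim x)
      show ?case
      proof (rule monoI)
        fix m n :: nat assume "m \<le> n"
        then have "v m x \<le> v n x" using elim by (auto dest: incseqD)
        then have "g (v m x) \<le> g (v n x)" by (rule monoD[OF g_mono])
        then show "(g (v m x) + b) * \<phi> x \<le> (g (v n x) + b) * \<phi> x" using \<phi>(2)[of x] by (intro mult_right_mono) auto
      qed
    qed
    have limh: "AE x in lborel. (\<lambda>n. ?h n x) \<longlonglongrightarrow> (g (u x) + b) * \<phi> x"
      using limv by eventually_elim (intro tendsto_mult tendsto_add tendsto_const isCont_tendsto_compose[OF gcont], auto)
    have "incseq (\<lambda>n. integral\<^sup>L lborel (?h n))"
      by (intro incseq_SucI integral_mono_AE ih) (use inch in \<open>auto elim!: eventually_mono dest: incseq_SucD\<close>)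
    then obtain L where L: "(\<lambda>n. integral\<^sup>L lborel (?h n)) \<longlonglongrightarrow> L"
      using incseq_convergent[of "\<lambda>n. integral\<^sup>L lborel (?h n)" D] bound by blast
    have "integrable lborel (\<lambda>x. (g (u x) + b) * \<phi> x)"
      by (rule integrable_monotone_convergence[OF ih inch limh L]) measurable
    moreover have "integrable lborel (\<lambda>x::real^'n. indicator (cball 0 R) x * b)" using locint_const[of b] by (auto simp: locint_def)
    ultimately have i: "integrable lborel (\<lambda>x. (g (u x) + b) * \<phi> x + indicator (cball 0 R) x * b)" by simp
    show "integrable lborel (\<lambda>x. indicator (cball 0 R) x * g (u x))"
    proof (rule Bochner_Integration.integrable_bound[OF i])
      show "AE x in lborel. norm (indicator (cball 0 R) x * g (u x)) \<le> norm ((g (u x) + b) * \<phi> x + indicator (cball 0 R) x * b)"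
      proof (rule AE_I2)
        fix x
        have gb: "0 \<le> g (u x) + b" using g_lower[of "u x"] by simp
        show "norm (indicator (cball 0 R) x * g (u x)) \<le> norm ((g (u x) + b) * \<phi> x + indicator (cball 0 R) x * b)"
        proof (cases "x \<in> cball 0 R")
          case True
          then have "(g (u x) + b) * 1 \<le> (g (u x) + b) * \<phi> x" using gb \<phi>(3)[of x] by (intro mult_left_mono) auto
          then show ?thesis using True gb b_nonneg by simp
        qed simp
      qed
    qed measurable
  qed measurable
  have "weq u (\<lambda>x. f x - g (u x))"
  proof (rule weq_limit[OF weqv um])
    show "locint (\<lambda>x. \<bar>V x\<bar> + \<bar>u x\<bar>)" by (intro locint_add locint_abs lV lu)
    show "AE x in lborel. \<bar>v n x\<bar> \<le> \<bar>V x\<bar> + \<bar>u x\<bar>" for n using limv Vv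
    proof eventually_elim
      case (elim x)
      then have "V x \<le> v n x" "v n x \<le> u x" by auto
      then show ?case by linarith
    qed
    show "AE x in lborel. (\<lambda>n. v n x) \<longlonglongrightarrow> u x" using limv by eventually_elim simp
    show "(\<lambda>x. f x - g (u x)) \<in> borel_measurable borel" by measurable
    show "locint (\<lambda>x. \<bar>f x\<bar> + (b + \<bar>g (u x)\<bar>))" by (intro locint_add locint_abs locint_const f lgu)
    show "AE x in lborel. \<bar>F n x - g (v n x)\<bar> \<le> \<bar>f x\<bar> + (b + \<bar>g (u x)\<bar>)" for n using limv
    proof eventually_elim
      case (elim x)
      then have "g (v n x) \<le> g (u x)" by (auto intro: monoD[OF g_mono])
      then show ?case using g_lower[of "v n x"] F(1,2)[of n x] b_nonneg by linarith
    qed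
    show "AE x in lborel. (\<lambda>n. F n x - g (v n x)) \<longlonglongrightarrow> f x - g (u x)" using limv
    proof eventually_elim
      case (elim x)
      obtain N :: nat where N: "f x \<le> N" using real_arch_simple by blast
      have "(\<lambda>n. F n x) \<longlonglongrightarrow> f x"
        by (rule tendsto_eventually) (use N in \<open>auto simp: F_def eventually_sequentially intro!: exI[of _ N]\<close>)
      then show ?case using elim by (intro tendsto_diff isCont_tendsto_compose[OF gcont]) auto
    qed
  qed
  with Vu show ?thesis by blast
qed

section \<open>Passing between Lebesgue and Borel measurable functions\<close>

lemma AE_lebesgue_iff: "(AE x in lebesgue. P x) \<longleftrightarrow> (AE x in lborel. P x)"
  by (rule AE_completion_iff)

text \<open>\<open>loc_int\<close> has no measurability clause of its own; exhaustion by balls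
  supplies it.\<close>

lemma loc_int_imp_measurable:
  fixes u :: "real^'n::finite \<Rightarrow> real"
  assumes "loc_int u" shows "u \<in> borel_measurable lebesgue"
proof -
  have m: "(\<lambda>x. indicator (cball 0 (real n)) x *\<^sub>R u x) \<in> borel_measurable lebesgue" for n :: nat
    using assms unfolding loc_int_def set_integrable_def by (intro borel_measurable_integrable) auto
  have "(\<lambda>n. indicator (cball 0 (real n)) x *\<^sub>R u x) \<longlonglongrightarrow> u x" for x
  proof (rule tendsto_eventually)
    obtain N :: nat where "norm x \<le> N" using real_arch_simple by blast
    then show "\<forall>\<^sub>F n in sequentially. indicator (cball 0 (real n)) x *\<^sub>R u x = u x"
      unfolding eventually_sequentially by (intro exI[of _ N]) (auto simp: indicator_def)
  qed
  then show ?thesis by (intro borel_measurable_LIMSEQ_real[OF _ m])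
qed

lemma loc_int_cong_AE:
  assumes "loc_int u" "AE x in lebesgue. u x = v x" "v \<in> borel_measurable lebesgue" shows "loc_int v"
  unfolding loc_int_def set_integrable_def
proof (intro allI impI)
  fix K :: "(real^'a) set" assume K: "compact K"
  have Ks: "K \<in> sets lebesgue" using K by (intro sets_completionI_sets) (simp add: compact_imp_closed borel_closed)
  have "integrable lebesgue (\<lambda>x. indicator K x *\<^sub>R u x)"
    using assms(1) K unfolding loc_int_def set_integrable_def by blast
  then show "integrable lebesgue (\<lambda>x. indicator K x *\<^sub>R v x)"
    by (rule integrable_cong_AE_imp)
      (use assms(2,3) Ks in \<open>auto intro!: borel_measurable_scaleR borel_measurable_indicator\<close>)
qed

lemma loc_int_iff_locint:
  fixes u :: "real^'n::finite \<Rightarrow> real"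
  assumes u: "u \<in> borel_measurable borel"
  shows "loc_int u \<longleftrightarrow> locint u"
proof
  assume l: "loc_int u"
  show "locint u"
  proof (rule locintI[OF u])
    fix R
    have "integrable lebesgue (\<lambda>x. indicator (cball 0 R) x *\<^sub>R u x)"
      using l unfolding loc_int_def set_integrable_def by (auto simp: compact_cball)
    then show "integrable lborel (\<lambda>x. indicator (cball 0 R) x * u x)"
      using u by (subst (asm) integrable_completion) auto
  qed
next
  assume l: "locint u"
  show "loc_int u" unfolding loc_int_def set_integrable_def
  proof (intro allI impI)
    fix K :: "(real^'n) set" assume K: "compact K"
    then obtain R where R: "\<And>x. x \<in> K \<Longrightarrow> norm x \<le> R" by (meson bounded_iff compact_imp_bounded)
    have Km: "K \<in> sets borel" using K by (simp add: compact_imp_closed borel_closed)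
    have "integrable lborel (\<lambda>x. u x * indicator K x)"
      by (rule locint_bdsupp_integrable[OF l bdsuppI[of _ 1 R]]) (use R Km in \<open>auto simp: indicator_def not_less[symmetric]\<close>)
    then have "integrable lborel (\<lambda>x. indicator K x *\<^sub>R u x)" by (simp add: mult.commute)
    then show "integrable lebesgue (\<lambda>x. indicator K x *\<^sub>R u x)"
      using u Km by (subst integrable_completion) auto
  qed
qed

lemma borel_version:
  fixes u :: "real^'n::finite \<Rightarrow> real"
  assumes "loc_int u" obtains v where "locint v" "AE x in lborel. u x = v x"
proof -
  obtain v where v: "v \<in> borel_measurable lborel" "AE x in lborel. u x = v x"
    using completion_ex_borel_measurable_real[OF loc_int_imp_measurable[OF assms]] by blast
  have "loc_int v"
    by (rule loc_int_cong_AE[OF assms]) (use v in \<open>auto simp: AE_lebesgue_iff intro: measurable_completion\<close>)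
  then have "locint v" using v by (subst (asm) loc_int_iff_locint) auto
  then show ?thesis using that v by blast
qed

lemma integral_lebesgue_cong:
  fixes p q :: "real^'n::finite \<Rightarrow> real"
  assumes "AE x in lborel. p x = q x" "q \<in> borel_measurable borel" "p \<in> borel_measurable lebesgue"
  shows "integral\<^sup>L lebesgue p = integral\<^sup>L lborel q"
proof -
  have "integral\<^sup>L lebesgue p = integral\<^sup>L lebesgue q"
    by (rule integral_cong_AE) (use assms in \<open>auto simp: AE_lebesgue_iff intro: measurable_completion\<close>)
  also have "\<dots> = integral\<^sup>L lborel q" by (rule integral_completion) (use assms in simp)
  finally show ?thesis .
qed

text \<open>The definitions use one Lebesgue integral of three terms. It is passed to Borel
  representatives and then split, which is legitimate because each part pairs a locally integrable
  function with a bounded one of bounded support.\<close>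

lemma weak_form_integral:
  fixes u f :: "real^'n::finite \<Rightarrow> real"
  assumes l: "loc_int u" "loc_int (\<lambda>x. g (u x))" "loc_int f" and l': "locint u'" "locint f'" "locint (\<lambda>x. g (u' x))"
    and eq: "AE x in lborel. u x = u' x" "AE x in lborel. f x = f' x" and \<phi>: "test_fun \<phi>"
  shows "integral\<^sup>L lebesgue (\<lambda>x. - u x * laplacian \<phi> x + g (u x) * \<phi> x - f x * \<phi> x)
    = - ((\<integral>x. u' x * laplacian \<phi> x \<partial>lborel) + (\<integral>x. (f' x - g (u' x)) * \<phi> x \<partial>lborel))"
proof -
  note [measurable] = bdsupp_measurable[OF bdsupp_test[OF \<phi>]] bdsupp_measurable[OF bdsupp_laplacian[OF \<phi>]]
    l'[THEN locint_measurable]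
  have \<phi>m: "\<phi> \<in> borel_measurable lebesgue" "laplacian \<phi> \<in> borel_measurable lebesgue"
    by (auto intro: measurable_completion)
  have "integral\<^sup>L lebesgue (\<lambda>x. - u x * laplacian \<phi> x + g (u x) * \<phi> x - f x * \<phi> x)
    = (\<integral>x. - (u' x * laplacian \<phi> x) - (f' x - g (u' x)) * \<phi> x \<partial>lborel)"
  proof (rule integral_lebesgue_cong)
    show "AE x in lborel. - u x * laplacian \<phi> x + g (u x) * \<phi> x - f x * \<phi> x
       = - (u' x * laplacian \<phi> x) - (f' x - g (u' x)) * \<phi> x"
      using eq by eventually_elim (simp add: algebra_simps)
    show "(\<lambda>x. - u x * laplacian \<phi> x + g (u x) * \<phi> x - f x * \<phi> x) \<in> borel_measurable lebesgue"
      using \<phi>m l[THEN loc_int_imp_measurable] by measurable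
  qed measurable
  also have "\<dots> = - ((\<integral>x. u' x * laplacian \<phi> x \<partial>lborel) + (\<integral>x. (f' x - g (u' x)) * \<phi> x \<partial>lborel))"
    using locint_bdsupp_integrable[OF l'(1) bdsupp_laplacian[OF \<phi>]]
      locint_bdsupp_integrable[OF locint_diff[OF l'(2,3)] bdsupp_test[OF \<phi>]] by simp
  finally show ?thesis .
qed

lemma locint_comp_version:
  assumes g: "g \<in> borel_measurable borel" and "loc_int (\<lambda>x. g (u x))" "locint u'" "AE x in lborel. u x = u' x"
  shows "locint (\<lambda>x. g (u' x))"
proof -
  have m: "(\<lambda>x. g (u' x)) \<in> borel_measurable borel" using locint_measurable[OF assms(3)] g by measurable
  have "loc_int (\<lambda>x. g (u' x))"
    by (rule loc_int_cong_AE[OF assms(2)])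
      (use assms(4) m in \<open>auto simp: AE_lebesgue_iff intro: measurable_completion elim!: eventually_mono\<close>)
  then show ?thesis by (simp add: loc_int_iff_locint[OF m])
qed

lemma subsolution_imp_wsub:
  fixes u :: "real^'n::finite \<Rightarrow> real"
  assumes s: "is_subsolution g (\<lambda>_. 0) u" and g: "g \<in> borel_measurable borel"
    and u': "locint u'" "AE x in lborel. u x = u' x"
  shows "wsub u' (\<lambda>x. - g (u' x))"
proof -
  have l: "loc_int u" "loc_int (\<lambda>x. g (u x))" using s by (auto simp: is_subsolution_def)
  have lg: "locint (\<lambda>x. g (u' x))" by (rule locint_comp_version[OF g l(2) u'])
  have l0: "loc_int (\<lambda>x::real^'n. 0)" by (simp add: loc_int_def)
  show ?thesis unfolding wsub_def
  proof (intro conjI u' locint_uminus lg allI impI)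
    fix \<phi> :: "real^'n \<Rightarrow> real" assume \<phi>: "test_fun \<phi>" "\<forall>x. 0 \<le> \<phi> x"
    have "integral\<^sup>L lebesgue (\<lambda>x. - u x * laplacian \<phi> x + g (u x) * \<phi> x - 0 * \<phi> x) \<le> 0"
      using s \<phi> unfolding is_subsolution_def by blast
    then show "0 \<le> (\<integral>x. u' x * laplacian \<phi> x \<partial>lborel) + (\<integral>x. - g (u' x) * \<phi> x \<partial>lborel)"
      unfolding weak_form_integral[OF l l0 u'(1) locint_const lg u'(2) AE_I2[OF refl] \<phi>(1)] by simp
  qed
qed

lemma solution_imp_weq:
  fixes u f :: "real^'n::finite \<Rightarrow> real"
  assumes s: "is_solution g f u" and g: "g \<in> borel_measurable borel" and lf: "loc_int f"
    and u': "locint u'" "AE x in lborel. u x = u' x" and f': "locint f'" "AE x in lborel. f x = f' x"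
  shows "weq u' (\<lambda>x. f' x - g (u' x))"
proof -
  have l: "loc_int u" "loc_int (\<lambda>x. g (u x))" using s by (auto simp: is_solution_def)
  have lg: "locint (\<lambda>x. g (u' x))" by (rule locint_comp_version[OF g l(2) u'])
  have z: "(\<integral>x. u' x * laplacian \<phi> x \<partial>lborel) + (\<integral>x. (f' x - g (u' x)) * \<phi> x \<partial>lborel) = 0" if \<phi>: "test_fun \<phi>" for \<phi>
  proof -
    have "integral\<^sup>L lebesgue (\<lambda>x. - u x * laplacian \<phi> x + g (u x) * \<phi> x - f x * \<phi> x) = 0"
      using s \<phi> unfolding is_solution_def by blast
    then show ?thesis
      unfolding weak_form_integral[OF l lf u'(1) f'(1) lg u'(2) f'(2) \<phi>] by simp
  qed
  have m: "(\<integral>x. - u' x * laplacian \<phi> x \<partial>lborel) + (\<integral>x. - (f' x - g (u' x)) * \<phi> x \<partial>lborel) = 0" if \<phi>: "test_fun \<phi>" for \<phi>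
    using z[OF \<phi>] unfolding mult_minus_left Bochner_Integration.integral_minus by linarith
  have "wsub u' (\<lambda>x. f' x - g (u' x))"
    unfolding wsub_def by (intro conjI u' locint_diff f' lg allI impI) (simp add: z)
  moreover have "wsub (\<lambda>x. - u' x) (\<lambda>x. - (f' x - g (u' x)))"
    unfolding wsub_def by (intro conjI u' locint_uminus locint_diff f' lg allI impI) (simp only: m order_refl)
  ultimately show ?thesis by (simp add: weq_def)
qed

lemma weq_imp_solution:
  fixes u f :: "real^'n::finite \<Rightarrow> real"
  assumes w: "weq u (\<lambda>x. f' x - g (u x))" and g: "g \<in> borel_measurable borel" and lf: "loc_int f"
    and f': "locint f'" "AE x in lborel. f x = f' x"
  shows "is_solution g f u"
proof -
  have u: "locint u" and "locint (\<lambda>x. f' x - g (u x))" using w by (auto simp: weq_def dest: wsub_locint)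
  from locint_diff[OF f'(1) this(2)] have lg: "locint (\<lambda>x. g (u x))" by simp
  have l: "loc_int u" "loc_int (\<lambda>x. g (u x))"
    using u lg loc_int_iff_locint locint_measurable by blast+
  show ?thesis unfolding is_solution_def
  proof (intro conjI l allI impI)
    fix \<phi> :: "real^'n \<Rightarrow> real" assume \<phi>: "test_fun \<phi>"
    show "integral\<^sup>L lebesgue (\<lambda>x. - u x * laplacian \<phi> x + g (u x) * \<phi> x - f x * \<phi> x) = 0"
      unfolding weak_form_integral[OF l lf u f'(1) lg AE_I2[OF refl] f'(2) \<phi>] using weq_test[OF w \<phi>] by simp
  qed
qed

section \<open>Existence and uniqueness of solutions\<close>

text \<open>Either \<open>g\<close> is nonnegative everywhere, or it is nonpositive at some s \<le>
  0. In the latter case the truncation at \<open>s\<close> changes nothing for functions above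
  \<open>s\<close>, and the solution found is of this kind because it lies above max V s.\<close>

lemma existence:
  fixes V f :: "real^'n::finite \<Rightarrow> real"
  assumes cont: "continuous_on UNIV g" and mono: "mono g" and g0: "0 \<le> g 0" and ko: "ko_summable g"
    and V: "wsub V (\<lambda>x. - g (V x))" and f: "locint f" and f0: "\<And>x. 0 \<le> f x"
  shows "\<exists>u. weq u (\<lambda>x. f x - g (u x)) \<and> (AE x in lborel. V x \<le> u x)"
proof (cases "\<exists>s\<le>0. g s \<le> 0")
  case False
  then have "- 0 \<le> g s" for s
    using monoD[OF mono, of 0 s] g0 by (cases "s \<le> 0") fastforce+
  note pos = this
  have "bounded_below g 0" by standard (use cont mono pos in auto)
  then show ?thesis by (rule existence_bounded_below[OF _ ko g0 V f f0])
next
  case True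
  text \<open>A constant subsolution allows us to truncate \<open>g\<close> from below.\<close>
  then obtain s where s: "s \<le> 0" "g s \<le> 0" by blast
  define h where "h t = g (max t s)" for t
  note gm[measurable] = borel_measurable_mono[OF mono]
  have "bounded_below h \<bar>g s\<bar>"
  proof
    show "continuous_on UNIV h" unfolding h_def
      by (rule continuous_on_compose2[OF cont]) (auto intro!: continuous_intros)
    show "mono h" unfolding h_def by (intro monoI monoD[OF mono]) auto
    show "- \<bar>g s\<bar> \<le> h t" for t unfolding h_def using monoD[OF mono, of s "max t s"] by simp
  qed simp
  moreover have hg: "h t = g t" if "s \<le> t" for t using that by (simp add: h_def max_def)
  have kh: "ko_summable h" using ko s hg by (simp add: ko_summable_def mult_nonneg_nonneg order_trans[OF s(1)])
  have lV: "locint V" and lgV: "locint (\<lambda>x. g (V x))"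
    using wsub_locint[OF V] locint_uminus[of "\<lambda>x. - g (V x)"] by auto
  define W where "W x = max (V x) s" for x
  have W: "wsub W (\<lambda>x. - h (W x))"
  proof -
    have lhW: "locint (\<lambda>x. - h (W x))"
    proof -
      have "locint (\<lambda>x. max (g (V x)) (g s))" by (intro locint_max lgV locint_const)
      moreover have "max (g (V x)) (g s) = h (W x)" for x
        using monoD[OF mono, of "V x" s] monoD[OF mono, of s "V x"] by (auto simp: h_def W_def max_def)
      ultimately show ?thesis by (intro locint_uminus) simp
    qed
    have "wsub W (\<lambda>x. if V x > s then - g (V x) else 0)"
      unfolding W_def by (rule wsub_max[OF V wsub_const])
    then show ?thesis
      by (rule wsub_mono[OF _ lhW]) (use s in \<open>auto simp: h_def W_def max_def\<close>)
  qed
  moreover have "0 \<le> h 0" using hg[of 0] s g0 by simp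
  ultimately obtain u where u: "weq u (\<lambda>x. f x - h (u x))" "AE x in lborel. W x \<le> u x"
    using existence_bounded_below[of h "\<bar>g s\<bar>" W f] kh f f0 by blast
  have us: "AE x in lborel. s \<le> u x \<and> V x \<le> u x" using u(2) by eventually_elim (simp add: W_def)
  have "locint u" and lr: "locint (\<lambda>x. f x - h (u x))" using u(1) by (auto simp: weq_def dest: wsub_locint)
  \<comment> \<open>This representative turns the a.e. identity between the truncated and the
    original nonlinearity into one holding everywhere.\<close>
  define u' where "u' x = max (u x) s" for x
  have lu': "locint u'" unfolding u'_def by (intro locint_max locint_const \<open>locint u\<close>)
  have hu: "h (u x) = g (u' x)" for x by (simp add: h_def u'_def)
  have eq: "AE x in lborel. u x = u' x" using us by eventually_elim (simp add: u'_def)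
  then have eq': "AE x in lborel. - u x = - u' x" by eventually_elim simp
  have "weq u' (\<lambda>x. f x - g (u' x))"
    using u(1) wsub_cong_AE[OF _ lu' eq] wsub_cong_AE[OF _ locint_uminus[OF lu'] eq'] unfolding weq_def hu by blast
  moreover have "AE x in lborel. V x \<le> u' x" using us by eventually_elim (simp add: u'_def)
  ultimately show ?thesis by blast
qed

text \<open>Both a + w and b are convex combinations of a and b + w, with complementary weights;
  adding the two convexity inequalities gives the claim.\<close>

lemma convex_increment_mono:
  fixes g :: "real \<Rightarrow> real"
  assumes conv: "convex_on UNIV g" and "a \<le> b" "0 \<le> w"
  shows "g (a + w) - g a \<le> g (b + w) - g b"
proof (cases "w = 0 \<or> a = b")
  case False
  then have p: "0 < w" "a < b" using assms by auto
  define \<theta> where "\<theta> = w / (b + w - a)"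
  have \<theta>: "0 \<le> \<theta>" "\<theta> \<le> 1" using p by (auto simp: \<theta>_def field_simps)
  have d: "\<theta> * (b + w - a) = w" using p by (simp add: \<theta>_def)
  have e1: "a + w = (1 - \<theta>) * a + \<theta> * (b + w)" using d by (simp add: algebra_simps)
  have e2: "b = (1 - (1 - \<theta>)) * a + (1 - \<theta>) * (b + w)" using d by (simp add: algebra_simps)
  have "g (a + w) \<le> (1 - \<theta>) * g a + \<theta> * g (b + w)"
    using convex_onD[OF conv, of \<theta> a "b + w"] \<theta> e1 by simp
  moreover have "g b \<le> (1 - (1 - \<theta>)) * g a + (1 - \<theta>) * g (b + w)"
    using convex_onD[OF conv, of "1 - \<theta>" a "b + w"] \<theta> e2 by simp
  ultimately show ?thesis by (simp add: algebra_simps)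
qed auto

text \<open>Chord slopes of a convex function increase, so those left of 0 are at most the slope
  over [0, 1]. The three-point inequality is used twice, to compare with that slope across the point
  \<open>t\<close>.\<close>

lemma convex_lipschitz_left:
  fixes g :: "real \<Rightarrow> real"
  assumes conv: "convex_on UNIV g" and "s \<le> t" "t \<le> 0"
  shows "g t - g s \<le> (g 1 - g 0) * (t - s)"
proof -
  have three: "(c - a) * g b \<le> (c - b) * g a + (b - a) * g c" if "a \<le> b" "b \<le> c" "a < c" for a b c
  proof -
    define \<theta> where "\<theta> = (b - a) / (c - a)"
    have \<theta>: "0 \<le> \<theta>" "\<theta> \<le> 1" using that by (auto simp: \<theta>_def)
    have d: "\<theta> * (c - a) = b - a" using that by (simp add: \<theta>_def)
    have "b = (1 - \<theta>) * a + \<theta> * c" using d by (simp add: algebra_simps)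
    then have "g b \<le> (1 - \<theta>) * g a + \<theta> * g c"
      using convex_onD[OF conv, of \<theta> a c] \<theta> by simp
    then have "(c - a) * g b \<le> (c - a) * ((1 - \<theta>) * g a + \<theta> * g c)" using that by (intro mult_left_mono) auto
    also have "\<dots> = ((c - a) - \<theta> * (c - a)) * g a + (\<theta> * (c - a)) * g c" by (simp add: algebra_simps)
    also have "\<dots> = (c - b) * g a + (b - a) * g c" unfolding d by simp
    finally show ?thesis .
  qed
  have A: "(1 - t) * g 0 \<le> (1 - 0) * g t + (0 - t) * g 1" by (rule three) (use assms in auto)
  have B: "(1 - s) * g t \<le> (1 - t) * g s + (t - s) * g 1" by (rule three) (use assms in auto)
  have "g 1 - g t \<le> (1 - t) * (g 1 - g 0)" using A by (simp add: algebra_simps)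
  then have "(t - s) * (g 1 - g t) \<le> (t - s) * ((1 - t) * (g 1 - g 0))" using assms by (intro mult_left_mono) auto
  moreover have "(1 - t) * (g t - g s) \<le> (t - s) * (g 1 - g t)" using B by (simp add: algebra_simps)
  ultimately have "(1 - t) * (g t - g s) \<le> (1 - t) * ((g 1 - g 0) * (t - s))" by (simp add: mult_ac)
  then show ?thesis using assms by simp
qed

text \<open>Solutions for \<open>f \<ge> 0\<close> lie above the unique solution for \<open>f = 0\<close>: on \<open>(-\<infinity>, 0]\<close> a convex
  nondecreasing \<open>g\<close> is Lipschitz, so there is a solution between \<open>V\<close> and \<open>min u 0\<close>.\<close>
lemma solution_between:
  fixes V u f :: "real^'n::finite \<Rightarrow> real"
  assumes mono: "mono g" and g0: "0 \<le> g 0" and ko: "ko_summable g" and conv: "convex_on UNIV g"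
    and V: "wsub V (\<lambda>x. - g (V x))" and f: "locint f" and f0: "\<And>x. 0 \<le> f x"
    and u: "weq u (\<lambda>x. f x - g (u x))" and Vu: "AE x in lborel. V x \<le> u x"
  shows "\<exists>z. weq z (\<lambda>x. 0 - g (z x)) \<and> (AE x in lborel. V x \<le> z x \<and> z x \<le> u x)"
proof -
  note gm[measurable] = borel_measurable_mono[OF mono]
  have V0: "AE x in lborel. V x \<le> 0" by (rule subsolution_nonpos[OF ko mono g0 V])
  have lV: "locint V" using wsub_locint[OF V] by simp
  have lu: "locint u" and lr: "locint (\<lambda>x. f x - g (u x))" using u by (auto simp: weq_def dest: wsub_locint)
  note [measurable] = locint_measurable[OF lV] locint_measurable[OF lu]
  from locint_diff[OF f lr] have lgu: "locint (\<lambda>x. g (u x))" by simp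
  \<comment> \<open>Freezing \<open>g\<close> beyond 0 makes it globally Lipschitz, so that the
    theorem on minimal solutions applies directly.\<close>
  define H where "H s = g (min s 0)" for s
  define Z where "Z x = - max (- u x) 0" for x
  have Zmin: "Z x = min (u x) 0" for x by (simp add: Z_def)
  define lam where "lam = g 1 - g 0"
  have lip: "H t - H s \<le> lam * (t - s)" if "s \<le> t" for s t
  proof -
    define t' where "t' = min t 0"
    define s' where "s' = min s 0"
    have st: "s' \<le> t'" "t' \<le> 0" "t' - s' \<le> t - s" using that by (auto simp: s'_def t'_def)
    have lam0: "0 \<le> lam" unfolding lam_def using monoD[OF mono, of 0 1] by simp
    have "g t' - g s' \<le> lam * (t' - s')"
      unfolding lam_def by (rule convex_lipschitz_left[OF conv st(1,2)])
    also have "\<dots> \<le> lam * (t - s)" using st lam0 by (intro mult_left_mono)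
    finally show ?thesis by (simp add: H_def s'_def t'_def)
  qed
  have HZ: "H (Z x) = g (Z x)" for x by (simp add: H_def Zmin)
  have HV: "AE x in lborel. H (V x) = g (V x)" using V0 by eventually_elim (simp add: H_def min_def)
  have "wsub V (\<lambda>x. 0 - H (V x))"
  proof (rule wsub_mono[OF V])
    have "locint (\<lambda>x. - g (V x))" using wsub_locint[OF V] by simp
    then have "locint (\<lambda>x. \<bar>- g (V x)\<bar>)" by (rule locint_abs)
    then show "locint (\<lambda>x. 0 - H (V x))"
      by (rule locint_bound) (use HV in \<open>auto simp: H_def elim!: eventually_mono\<close>)
    show "AE x in lborel. - g (V x) \<le> 0 - H (V x)" using HV by eventually_elim simp
  qed
  \<comment> \<open>Kato's inequality for the maximum of -u and 0: where u < 0 the datum f \<ge> 0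
    is dropped, elsewhere the constant 0 is a supersolution because g 0 \<ge> 0.\<close>
  moreover have "wsub (\<lambda>x. - Z x) (\<lambda>x. H (Z x) - 0)"
  proof -
    have "wsub (\<lambda>x. max (- u x) 0) (\<lambda>x. if - u x > 0 then - (f x - g (u x)) else 0)"
      using u by (intro wsub_max wsub_const) (simp add: weq_def)
    then have "wsub (\<lambda>x. - Z x) (\<lambda>x. if - u x > 0 then - (f x - g (u x)) else 0)" by (simp add: Z_def)
    then show ?thesis
    proof (rule wsub_mono)
      have "locint (\<lambda>x. \<bar>g (u x)\<bar> + \<bar>g 0\<bar>)" by (intro locint_add locint_abs lgu locint_const)
      then show "locint (\<lambda>x. H (Z x) - 0)"
        by (rule locint_bound) (auto simp: H_def Zmin min_def)
      show "AE x in lborel. (if - u x > 0 then - (f x - g (u x)) else 0) \<le> H (Z x) - 0"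
        using f0 g0 by (auto simp: H_def Zmin min_def)
    qed
  qed
  moreover have VZ: "AE x in lborel. V x \<le> Z x" using Vu V0 by eventually_elim (simp add: Zmin)
  moreover have "mono H" unfolding H_def by (intro monoI monoD[OF mono]) auto
  ultimately obtain z where z: "weq z (\<lambda>x. 0 - H (z x))" "AE x in lborel. V x \<le> z x"
    "\<And>Y. wsub (\<lambda>x. - Y x) (\<lambda>x. H (Y x) - 0) \<Longrightarrow> AE x in lborel. V x \<le> Y x \<Longrightarrow> AE x in lborel. z x \<le> Y x"
    using lipschitz_minimal_solution[of H lam "\<lambda>_::real^'n. 0" V Z] lip locint_const by blast
  have zZ: "AE x in lborel. z x \<le> Z x"
    by (rule z(3)) (use \<open>wsub (\<lambda>x. - Z x) (\<lambda>x. H (Z x) - 0)\<close> VZ in auto)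
  have lz: "locint z" and lHz: "locint (\<lambda>x. 0 - H (z x))" using z(1) by (auto simp: weq_def dest: wsub_locint)
  define z' where "z' x = min (z x) 0" for x
  have lz': "locint z'" using locint_uminus[OF locint_max[OF locint_uminus[OF lz] locint_const[of 0]]]
    by (simp add: z'_def[abs_def] minus_max_eq_min)
  have eq: "AE x in lborel. z x = z' x" using zZ by eventually_elim (simp add: z'_def Zmin)
  then have eq': "AE x in lborel. - z x = - z' x" by eventually_elim simp
  have Hz: "H (z x) = g (z' x)" for x by (simp add: H_def z'_def)
  have "weq z' (\<lambda>x. 0 - g (z' x))"
    using z(1) wsub_cong_AE[OF _ lz' eq] wsub_cong_AE[OF _ locint_uminus[OF lz'] eq'] unfolding weq_def Hz by blast
  moreover have "AE x in lborel. V x \<le> z' x \<and> z' x \<le> u x"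
    using z(2) zZ eq by eventually_elim (simp add: Zmin)
  ultimately show ?thesis by blast
qed

lemma comparison_of_solutions:
  fixes V u1 u2 f z :: "real^'n::finite \<Rightarrow> real"
  assumes cont: "continuous_on UNIV g" and mono: "mono g" and g0: "0 \<le> g 0" and ko: "ko_summable g"
    and conv: "convex_on UNIV g"
    and V: "wsub V (\<lambda>x. - g (V x))" and f: "locint f" and f0: "\<And>x. 0 \<le> f x"
    and unique: "\<And>y. weq y (\<lambda>x. 0 - g (y x)) \<Longrightarrow> AE x in lborel. V x \<le> y x \<Longrightarrow> AE x in lborel. y x = z x"
    and lz: "locint z"
    and u1: "weq u1 (\<lambda>x. f x - g (u1 x))" "AE x in lborel. V x \<le> u1 x"
    and u2: "weq u2 (\<lambda>x. f x - g (u2 x))"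
  shows "AE x in lborel. u2 x \<le> u1 x"
proof -
  note gm[measurable] = borel_measurable_mono[OF mono]
  obtain y where y: "weq y (\<lambda>x. 0 - g (y x))" "AE x in lborel. V x \<le> y x \<and> y x \<le> u1 x"
    using solution_between[OF mono g0 ko conv V f f0 u1] by blast
  define w where "w x = max (u2 x) (u1 x) - u1 x" for x
  have l: "locint y" "locint (\<lambda>x. 0 - g (y x))" "locint u1" "locint (\<lambda>x. f x - g (u1 x))" "locint u2" "locint (\<lambda>x. f x - g (u2 x))"
    using y(1) u1(1) u2 by (auto simp: weq_def dest: wsub_locint)
  have lg: "locint (\<lambda>x. g (y x))" "locint (\<lambda>x. g (u1 x))" "locint (\<lambda>x. g (u2 x))"
    using locint_uminus[OF l(2)] locint_diff[OF f l(4)] locint_diff[OF f l(6)] by auto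
  note [measurable] = l(1,3,5)[THEN locint_measurable]
  have lw: "locint w" unfolding w_def by (intro locint_diff locint_max l)
  have w0: "0 \<le> w x" for x by (simp add: w_def)
  \<comment> \<open>The datum cancels in both branches, leaving g(u1) - g(max u2 u1) - g(y).\<close>
  let ?r = "\<lambda>x. - (f x - g (u1 x)) + (if u2 x > u1 x then f x - g (u2 x) else f x - g (u1 x)) + (0 - g (y x))"
  have "wsub (\<lambda>x. - u1 x + max (u2 x) (u1 x) + y x) ?r"
    using u1(1) u2 y(1) by (intro wsub_add wsub_max) (auto simp: weq_def)
  moreover have "(\<lambda>x. - u1 x + max (u2 x) (u1 x) + y x) = (\<lambda>x. y x + w x)" by (auto simp: w_def)
  ultimately have sw: "wsub (\<lambda>x. y x + w x) ?r" by simp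
  \<comment> \<open>Here y \<le> u1 enters: by convexity the increment of \<open>g\<close> over
    \<open>w\<close> is smaller from \<open>y\<close> than from \<open>u1\<close>, and u1 + w is the
    maximum of the two solutions.\<close>
  have gw: "AE x in lborel. g (y x + w x) - g (y x) \<le> g (max (u2 x) (u1 x)) - g (u1 x)" using y(2)
  proof eventually_elim
    case (elim x)
    then show ?case using convex_increment_mono[OF conv, of "y x" "u1 x" "w x"] w0[of x] by (simp add: w_def)
  qed
  have gmax: "g (max (u2 x) (u1 x)) = (if u2 x > u1 x then g (u2 x) else g (u1 x))" for x by (simp add: max_def)
  have lgw: "locint (\<lambda>x. g (y x + w x))"
  proof (rule locint_between[OF lg(1)])
    show "locint (\<lambda>x. g (y x) + ((if u2 x > u1 x then g (u2 x) else g (u1 x)) - g (u1 x)))"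
      by (intro locint_add locint_diff locint_if lg) measurable
    show "(\<lambda>x. g (y x + w x)) \<in> borel_measurable borel" unfolding w_def by measurable
    show "AE x in lborel. g (y x) \<le> g (y x + w x)" using w0 by (auto intro!: monoD[OF mono])
    show "AE x in lborel. g (y x + w x) \<le> g (y x) + ((if u2 x > u1 x then g (u2 x) else g (u1 x)) - g (u1 x))"
      using gw by eventually_elim (simp add: gmax[symmetric])
  qed
  have "wsub (\<lambda>x. y x + w x) (\<lambda>x. - g (y x + w x))"
  proof (rule wsub_mono[OF sw locint_uminus[OF lgw]])
    show "AE x in lborel. ?r x \<le> - g (y x + w x)" using gw
      by eventually_elim (simp add: max_def split: if_splits)
  qed
  \<comment> \<open>Existence is applied with y + w in the role of the given subsolution and datum
    0. Both the resulting \<open>v\<close> and \<open>y\<close> lie above \<open>V\<close>, so both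
    coincide with \<open>z\<close> and \<open>w\<close> vanishes.\<close>
  from existence[OF cont mono g0 ko this locint_const[of 0]]
  obtain v where v: "weq v (\<lambda>x. 0 - g (v x))" "AE x in lborel. y x + w x \<le> v x" by auto
  have "AE x in lborel. V x \<le> v x" using v(2) y(2) by eventually_elim (use w0 in \<open>smt (verit)\<close>)
  then have "AE x in lborel. v x = z x" by (rule unique[OF v(1)])
  moreover have "AE x in lborel. y x = z x" by (rule unique[OF y(1)]) (use y(2) in auto)
  ultimately show ?thesis using v(2)
  proof eventually_elim
    case (elim x)
    then have "w x \<le> 0" by simp
    then show ?case by (simp add: w_def max_def split: if_splits)
  qed
qed

theorem mainTheorem6:
  fixes g :: "real \<Rightarrow> real" and V :: "real^'n::finite \<Rightarrow> real"
  assumes "CARD('n) \<ge> 2"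
    and "continuous_on UNIV g" and "mono g" and "g 0 \<ge> 0"
    and "keller_osserman g"
    and "is_subsolution g (\<lambda>_. 0) V"
  shows "(\<forall>f. loc_int f \<and> (AE x in lebesgue. f x \<ge> 0) \<longrightarrow> (\<exists>u\<in>UV V. is_solution g f u))
       \<and> ((convex_on UNIV g \<and>
           (\<exists>u\<in>UV V. is_solution g (\<lambda>_. 0) u \<and>
              (\<forall>v\<in>UV V. is_solution g (\<lambda>_. 0) v \<longrightarrow> (AE x in lebesgue. v x = u x))))
          \<longrightarrow> (\<forall>f. loc_int f \<and> (AE x in lebesgue. f x \<ge> 0) \<longrightarrow>
                (\<exists>u\<in>UV V. is_solution g f u \<and>
                   (\<forall>v\<in>UV V. is_solution g f v \<longrightarrow> (AE x in lebesgue. v x = u x)))))"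
proof -
  note cont = assms(2) and mono = assms(3) and g0 = assms(4)
  have ko: "ko_summable g" by (rule keller_osserman_summable[OF assms(5) cont mono g0])
  have gm: "g \<in> borel_measurable borel" by (rule borel_measurable_mono[OF mono])
  obtain V' where V': "locint V'" "AE x in lborel. V x = V' x"
    using borel_version assms(6) by (metis is_subsolution_def)
  have wV: "wsub V' (\<lambda>x. - g (V' x))" by (rule subsolution_imp_wsub[OF assms(6) gm V'])
  have l0: "loc_int (\<lambda>x::real^'n. 0)" by (simp add: loc_int_def)
  have l0': "locint (\<lambda>x::real^'n. 0)" by (rule locint_const)
  \<comment> \<open>The data are replaced on a null set by Borel functions that are nonnegative
    everywhere, as the preceding lemmas demand.\<close>
  have datum: "\<exists>f'. locint f' \<and> (\<forall>x. 0 \<le> f' x) \<and> (AE x in lborel. f x = f' x)"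
    if f: "loc_int f" "AE x in lebesgue. f x \<ge> 0" for f :: "real^'n \<Rightarrow> real"
  proof -
    obtain h where h: "locint h" "AE x in lborel. f x = h x" using borel_version[OF f(1)] by metis
    have "AE x in lborel. f x = max (h x) 0"
      using h(2) f(2)[unfolded AE_lebesgue_iff] by eventually_elim simp
    then show ?thesis using h(1) by (intro exI[of _ "\<lambda>x. max (h x) 0"]) (auto intro: locint_max locint_const)
  qed
  have UV_I: "u \<in> UV V" if "locint u" "AE x in lborel. V' x \<le> u x" for u
  proof -
    have "AE x in lborel. V x \<le> u x" using that(2) V'(2) by eventually_elim simp
    moreover have "loc_int u" using that(1) loc_int_iff_locint locint_measurable by blast
    ultimately show ?thesis by (simp add: UV_def AE_lebesgue_iff)
  qed
  have ex: "\<exists>u\<in>UV V. is_solution g f u" if f: "loc_int f" "AE x in lebesgue. f x \<ge> 0" for f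
  proof -
    obtain f' where f': "locint f'" "\<And>x. 0 \<le> f' x" "AE x in lborel. f x = f' x" using datum[OF f] by blast
    obtain u where u: "weq u (\<lambda>x. f' x - g (u x))" "AE x in lborel. V' x \<le> u x"
      using existence[OF cont mono g0 ko wV f'(1,2)] by blast
    have "locint u" using u(1) by (auto simp: weq_def dest: wsub_locint)
    then show ?thesis using UV_I u(2) weq_imp_solution[OF u(1) gm f(1) f'(1,3)] by blast
  qed
  moreover have "\<exists>u\<in>UV V. is_solution g f u \<and> (\<forall>v\<in>UV V. is_solution g f v \<longrightarrow> (AE x in lebesgue. v x = u x))"
    if conv: "convex_on UNIV g" and z: "z \<in> UV V" "is_solution g (\<lambda>_. 0) z"
      "\<forall>v\<in>UV V. is_solution g (\<lambda>_. 0) v \<longrightarrow> (AE x in lebesgue. v x = z x)"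
      and f: "loc_int f" "AE x in lebesgue. f x \<ge> 0" for f z
  proof -
    obtain f' where f': "locint f'" "\<And>x. 0 \<le> f' x" "AE x in lborel. f x = f' x" using datum[OF f] by blast
    obtain z' where z': "locint z'" "AE x in lborel. z x = z' x"
      using borel_version[of z] z(2) by (metis is_solution_def)
    have unique0: "AE x in lborel. y x = z' x"
      if y: "weq y (\<lambda>x. 0 - g (y x))" "AE x in lborel. V' x \<le> y x" for y
    proof -
      have "locint y" using y(1) by (auto simp: weq_def dest: wsub_locint)
      then have "y \<in> UV V" by (rule UV_I[OF _ y(2)])
      moreover have "is_solution g (\<lambda>_. 0) y" by (rule weq_imp_solution[OF y(1) gm l0 l0']) simp
      ultimately have "AE x in lborel. y x = z x" using z(3) by (simp add: AE_lebesgue_iff)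
      then show ?thesis using z'(2) by eventually_elim simp
    qed
    have rep: "\<exists>v'. weq v' (\<lambda>x. f' x - g (v' x)) \<and> (AE x in lborel. V' x \<le> v' x) \<and> (AE x in lborel. v x = v' x)"
      if v: "v \<in> UV V" "is_solution g f v" for v
    proof -
      obtain v' where v': "locint v'" "AE x in lborel. v x = v' x"
        using borel_version v(2) by (metis is_solution_def)
      have "weq v' (\<lambda>x. f' x - g (v' x))" by (rule solution_imp_weq[OF v(2) gm f(1) v' f'(1,3)])
      moreover have "AE x in lborel. V' x \<le> v' x"
        using v(1)[unfolded UV_def AE_lebesgue_iff, simplified, THEN conjunct2] V'(2) v'(2) by eventually_elim simp
      ultimately show ?thesis using v'(2) by blast
    qed
    obtain u where u: "u \<in> UV V" "is_solution g f u" using ex[OF f] by blast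
    have "AE x in lebesgue. v x = u x" if v: "v \<in> UV V" "is_solution g f v" for v
    proof -
      obtain u' where u': "weq u' (\<lambda>x. f' x - g (u' x))" "AE x in lborel. V' x \<le> u' x" "AE x in lborel. u x = u' x"
        using rep[OF u] by blast
      obtain v' where v': "weq v' (\<lambda>x. f' x - g (v' x))" "AE x in lborel. V' x \<le> v' x" "AE x in lborel. v x = v' x"
        using rep[OF v] by blast
      note cmp = comparison_of_solutions[OF cont mono g0 ko conv wV f'(1,2) unique0 z'(1)]
      \<comment> \<open>The comparison is one-sided and is used once for each order of the two
        solutions.\<close>
      have "AE x in lborel. v' x \<le> u' x" "AE x in lborel. u' x \<le> v' x"
        by (rule cmp[OF _ _ u'(1,2) v'(1)]; assumption) (rule cmp[OF _ _ v'(1,2) u'(1)]; assumption)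
      then show ?thesis using u'(3) v'(3) unfolding AE_lebesgue_iff by eventually_elim simp
    qed
    with u show ?thesis by blast
  qed
  ultimately show ?thesis by blast
qed

end
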